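(* Let $M\in\mathcal C'$. Then $M^\vee\in\mathcal C'$. Moreover, $\dim (M^{\vee\vee})_{\mathbf a}=\dim M_{\mathbf a}$ for all $\mathbf a\in\mathbb{K}_1^I$, where $M^{\vee\vee}:=(M^\vee)^\vee$.
   Context: Base field. $\mathbb{K}$ is an algebraic closure of $\mathbb{C}(q)$, regarded (Puiseux) as a subfield of $\bigcup_{n\ge 1}\mathbb{C}((q^{1/n}))$; $\mathbb{K}_1\subset\mathbb{K}$ is the subring of elements admitting an expansion $\sum_{m\ge 0}a_m(q^{1/n}-1)^m$ ($a_m\in\mathbb{C}$) for some $n\ge1$; $\overline{\,\cdot\,}:\mathbb{K}_1\to\mathbb{C}$ is the ring homomorphism sending such an element to $a_0$ (classical limit). Notation: $[x,y]=xy-yx$, $[z;n]_{q^a}=\frac{q^{an}z-q^{-an}z^{-1}}{q^a-q^{-a}}$, $(x;n)_{q^a}=\frac{q^{an}x-1}{q^a-1}$. Satake diagram $(I,I_\bullet,\tau)$: $I$ is the Dynkin diagram of a complex semisimple Lie algebra $\mathfrak g$ (Cartan subalgebra $\mathfrak h$, Cartan matrix $(a_{i,j})$, simple roots $\alpha_i$, simple coroots $h_i$, root lattice $Q$, $q_i=q^{d_i}$ where $d_i$ are the symmetrizing integers, $d_ia_{i,j}=d_ja_{j,i}$), $I_\bullet\subset I$, $I_\circ=I\setminus I_\bullet$, $\tau$ an involutive diagram automorphism preserving $I_\bullet$, such that $w_\bullet(\alpha_i)=-\alpha_{\tau(i)}$ for $i\in I_\bullet$ ($w_\bullet$ = longest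 element of the Weyl group of $I_\bullet$) and $\langle\rho_\bullet^\vee,\alpha_i\rangle\in\mathbb{Z}$ for $i\in I_\circ$ with $\tau(i)=i$. Here $\rho_\bullet^\vee$ (resp. $\rho_\bullet$) is half the sum of positive coroots (resp. roots) of $I_\bullet$. $\mathbf U=U_q(\mathfrak g)$ is the quantum group over $\mathbb{K}$ with generators $E_i,F_i,K_i^{\pm1}$, relations $K_iE_j=q_i^{a_{i,j}}E_jK_i$, $K_iF_j=q_i^{-a_{i,j}}F_jK_i$, $[E_i,F_j]=\delta_{i,j}[K_i;0]_{q_i}$, commuting $K_i$, and the quantum Serre relations; $K_\alpha=\prod K_i^{c_i}$ for $\alpha=\sum c_i\alpha_i\in Q$. Antipode: $S(E_i)=-K_i^{-1}E_i$, $S(F_i)=-F_iK_i$, $S(K_i)=K_i^{-1}$. $\omega$ is the automorphism $E_i\leftrightarrow F_i$, $K_i\mapsto K_i^{-1}$, and $\tau$ also denotes the automorphism of $\mathbf U$ permuting the indices of the generators by $\tau$. $T_i$ is Lusztig's automorphism $T''_{i,1}$: $T_i(E_i)=-F_iK_i$, $T_i(F_i)=-K_i^{-1}E_i$, $T_i(E_j)=\sum_{r+s=-a_{i,j}}(-1)^rq_i^{-r}E_i^{(s)}E_jE_i^{(r)}$, $T_i(F_j)=\sum_{r+s=-a_{i,j}}(-1)^rq_i^{r}F_i^{(r)}F_jF_i^{(s)}$ for $j\ne i$ (divided powers), $T_i(K_\alpha)=K_{s_i(\alpha)}$; $T_{w_\bullet}=T_{i_1}\cdots T_{i_p}$ for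 a reduced expression $w_\bullet=s_{i_1}\cdots s_{i_p}$. Parameter: $\boldsymbol\varsigma=(\varsigma_i)_{i\in I_\circ}\in(\mathbb{K}_1^\times)^{I_\circ}$ with $\varsigma_i=\varsigma_{\tau(i)}$ whenever $\langle h_i,w_\bullet(\alpha_{\tau(i)})\rangle=0$, and $\overline{\varsigma_{\tau(i)}}=(-1)^{\langle 2\rho_\bullet^\vee,\alpha_i\rangle}\overline{\varsigma_i}$. Set $B_i=F_i+\varsigma_iT_{w_\bullet}(E_{\tau(i)})K_i^{-1}$, $k_i=K_iK_{\tau(i)}^{-1}$ for $i\in I_\circ$, and $B_i=F_i$, $k_i=K_i$ for $i\in I_\bullet$. The $\imath$quantum group $\mathbf U^\imath=\mathbf U^\imath_{\boldsymbol\varsigma}$ is the subalgebra of $\mathbf U$ generated by $E_i$ ($i\in I_\bullet$), $k_i^{\pm1}$ and $B_i$ ($i\in I$). Marked vertices: $\mathfrak k=\mathfrak g^\theta$ is the symmetric subalgebra attached to the Satake diagram, $\mathfrak h^\theta=\mathfrak h\cap\mathfrak k$. By Letzter there is a set $\Gamma$ of positive roots of $\mathfrak g$ such that $\mathfrak h^\theta\oplus\bigoplus_{\gamma\in\Gamma}\mathbb{C}(f_\gamma+e_\gamma)$ is a Cartan subalgebra of $\mathfrak k$ for suitable root vectors $e_\gamma\in\mathfrak g_\gamma$, $f_\gamma\in\mathfrak g_{-\gamma}$; $\Gamma$ is fixed (Letzter's choice) and $I_\otimes=\{i\in I\mid\alpha_i\in\Gamma\}$. It satisfies: $\tau(i)=i$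 for $i\in I_\otimes$; $a_{i,j}=0$ for $i\ne j$ in $I_\otimes$; $a_{i,j}=0$ for $i\in I_\bullet$, $j\in I_\otimes$. $\mathbf U^\imath(\mathfrak t')$ is the (commutative) subalgebra of $\mathbf U^\imath$ generated by all $k_i^{\pm1}$ ($i\in I$) and $B_j$ ($j\in I_\otimes$). A $\mathbf U^\imath$-module $M$ is a classical weight module if $\mathbf U^\imath(\mathfrak t')$ acts semisimply with eigenvalues of $(k_i;0)_{q_i}$ ($i\in I\setminus I_\otimes$) and $B_j$ ($j\in I_\otimes$) all in $\mathbb{K}_1$; $\mathcal C'$ is the category of classical weight modules whose simultaneous $\mathbf U^\imath(\mathfrak t')$-eigenspaces are finite-dimensional. For $\mathbf a=(a_i)\in\mathbb{K}_1^I$, $M_{\mathbf a}=\{m\in M\mid (k_i;0)_{q_i}m=a_im,\ B_jm=a_jm\ \ (i\in I\setminus I_\otimes,\ j\in I_\otimes)\}$, so $M=\bigoplus_{\mathbf a}M_{\mathbf a}$. Anti-automorphism $S^\imath$: $T_{w_\bullet}\tau\omega S$ restricts to an anti-isomorphism $\mathbf U^\imath_{\boldsymbol\varsigma}\to\mathbf U^\imath_{\boldsymbol\varsigma'}$ with $\varsigma'_i=\varsigma_i^{-1}q_i^{-\langle h_i,4\rho_\bullet+w_\bullet(\alpha_{\tau(i)})\rangle+2}$. Choose $\boldsymbol\eta,\boldsymbol\zeta\in(\mathbb{K}_1^\times)^I$ with $\eta_i=1$ for $i\in I_\bullet$; $\zeta_i\zeta_{\tau(i)}=1$ for all $i$;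 $\zeta_i=1$ unless $i\in I_\circ$, $\tau(i)\neq i$ and $\langle h_i,w_\bullet(\alpha_{\tau(i)})\rangle\ne0$; and $\eta_{\tau(i)}=\eta_i$ and $\varsigma'_i\zeta_i\eta_i\eta_{\tau(i)}=\varsigma_i$ for $i\in I_\circ$ (such choices exist). Then there is an isomorphism $\phi_{\boldsymbol\eta,\boldsymbol\zeta}:\mathbf U^\imath_{\boldsymbol\varsigma'}\to\mathbf U^\imath_{\boldsymbol\varsigma}$ sending $E_i\mapsto E_i$ ($i\in I_\bullet$), $B_i\mapsto\eta_i^{-1}B_i$, $k_i\mapsto\zeta_i^{-1}k_i$, and $S^\imath:=\phi_{\boldsymbol\eta,\boldsymbol\zeta}\circ T_{w_\bullet}\tau\omega S$ is an anti-automorphism of $\mathbf U^\imath$. For $M\in\mathcal C'$ the restricted dual is $M^\vee=\bigoplus_{\mathbf a}\operatorname{Hom}_{\mathbb{K}}(M_{\mathbf a},\mathbb{K})$ with the $\mathbf U^\imath$-module structure given by the anti-automorphism $S^\imath$, i.e. $(xf)(m)=f(S^\imath(x)m)$.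
   Formalization: The choice of ζ is also required to have classical limit 1 for every ζ_i; the stated conditions allow classical limit −1, and then M^∨ lies outside C' for every nonzero M (e.g. the trivial module for sl_3 with I_• empty and τ nontrivial). *)

theory Defs
  imports
    "HOL-Computational_Algebra.Computational_Algebra"
    "HOL-Library.Poly_Mapping"
    "HOL-Library.Function_Algebras"
begin

section \<open>The base field and the classical limit\<close>

text \<open>Puiseux series over the complex numbers in a variable \<open>z\<close> are represented by their
  coefficient functions: \<open>f r\<close> is the coefficient of \<open>z\<^sup>r\<close>.\<close>

definition puiseux :: "(rat \<Rightarrow> complex) \<Rightarrow> bool" where
  "puiseux f \<longleftrightarrow> (\<exists>n\<ge>1. \<exists>N. \<forall>r. f r \<noteq> 0 \<longrightarrow> N \<le> r \<and> rat_of_nat n * r \<in> \<int>)"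

definition pmonom :: "complex \<Rightarrow> rat \<Rightarrow> rat \<Rightarrow> complex" where
  "pmonom c s = (\<lambda>r. if r = s then c else 0)"

definition pmult :: "(rat \<Rightarrow> complex) \<Rightarrow> (rat \<Rightarrow> complex) \<Rightarrow> rat \<Rightarrow> complex" where
  "pmult f g = (\<lambda>r. \<Sum>s | f s \<noteq> 0 \<and> g (r - s) \<noteq> 0. f s * g (r - s))"

definition puiseux_of_fps :: "complex fps \<Rightarrow> rat \<Rightarrow> complex" where
  "puiseux_of_fps A = (\<lambda>r. if r \<in> \<nat> then fps_nth A (nat \<lfloor>r\<rfloor>) else 0)"

definition puiseux_embedding ::
  "(complex \<Rightarrow> 'k::field) \<Rightarrow> ('k \<Rightarrow> rat \<Rightarrow> complex) \<Rightarrow> bool" where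
  "puiseux_embedding cst \<iota> \<longleftrightarrow>
     (\<forall>x. puiseux (\<iota> x)) \<and>
     (\<forall>x y. \<iota> (x + y) = (\<lambda>r. \<iota> x r + \<iota> y r)) \<and>
     (\<forall>x y. \<iota> (x * y) = pmult (\<iota> x) (\<iota> y)) \<and>
     (\<forall>c. \<iota> (cst c) = pmonom c 0)"

text \<open>\<open>qroot B n\<close> is the element \<open>q\<^sup>1\<^sup>/\<^sup>n\<close>.  The embedding \<open>exp_at_0\<close> is the one into
  Puiseux series in \<open>q\<close>; it fixes the meaning of \<open>q\<^sup>1\<^sup>/\<^sup>n\<close>.  Series in powers of
  \<open>q\<^sup>1\<^sup>/\<^sup>n - 1\<close> do not converge in the topology of that field, so expansions at \<open>q = 1\<close> are
  taken with respect to an embedding \<open>exp_at_1\<close> into Puiseux series in \<open>z = q - 1\<close>, for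
  which \<open>q\<^sup>1\<^sup>/\<^sup>n\<close> is the branch of \<open>(1 + z)\<^sup>1\<^sup>/\<^sup>n\<close> with constant term 1.\<close>

record 'k base_field =
  const :: "complex \<Rightarrow> 'k"
  qroot :: "nat \<Rightarrow> 'k"
  exp_at_0 :: "'k \<Rightarrow> rat \<Rightarrow> complex"
  exp_at_1 :: "'k \<Rightarrow> rat \<Rightarrow> complex"

definition qq :: "'k base_field \<Rightarrow> 'k" where
  "qq B = qroot B 1"

definition field_hom :: "('a::field \<Rightarrow> 'b::field) \<Rightarrow> bool" where
  "field_hom f \<longleftrightarrow> (\<forall>x y. f (x + y) = f x + f y) \<and> (\<forall>x y. f (x * y) = f x * f y) \<and> f 1 = 1"

definition is_base_field :: "'k::alg_closed_field base_field \<Rightarrow> bool" where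
  "is_base_field B \<longleftrightarrow>
     field_hom (const B) \<and>
     (\<forall>p. poly (map_poly (const B) p) (qq B) = 0 \<longrightarrow> p = 0) \<and>
     (\<forall>x. \<exists>P. P \<noteq> 0 \<and> (\<forall>n. \<exists>p. coeff P n = poly (map_poly (const B) p) (qq B)) \<and> poly P x = 0) \<and>
     puiseux_embedding (const B) (exp_at_0 B) \<and>
     (\<forall>n\<ge>1. exp_at_0 B (qroot B n) = pmonom 1 (1 / of_nat n)) \<and>
     puiseux_embedding (const B) (exp_at_1 B) \<and>
     (\<forall>n\<ge>1. exp_at_1 B (qroot B n) = puiseux_of_fps (fps_binomial (1 / of_nat n)))"

text \<open>In \<open>K1\<close>, \<open>fps_compose A (fps_binomial (1 / n) - 1)\<close> is the series
  \<open>\<Sum>m. a\<^sub>m (q\<^sup>1\<^sup>/\<^sup>n - 1)\<^sup>m\<close> rewritten in \<open>z\<close>; its constant coefficient is \<open>a\<^sub>0\<close>.\<close>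

definition K1 :: "'k base_field \<Rightarrow> 'k set" where
  "K1 B = {x. \<exists>n\<ge>1. \<exists>A. exp_at_1 B x =
             puiseux_of_fps (fps_compose A (fps_binomial (1 / of_nat n) - 1))}"

definition K1_units :: "'k::field base_field \<Rightarrow> 'k set" where
  "K1_units B = {x \<in> K1 B. \<exists>y\<in>K1 B. x * y = 1}"

definition climit :: "'k base_field \<Rightarrow> 'k \<Rightarrow> complex" where
  "climit B x = exp_at_1 B x 0"


section \<open>Cartan matrices, Weyl groups and Satake diagrams\<close>

text \<open>Elements of the root lattice and of the coroot lattice are given by their coordinates with
  respect to the simple roots, respectively simple coroots.  The entry \<open>C i j\<close> of a Cartan
  matrix is \<open>\<langle>h\<^sub>i, \<alpha>\<^sub>j\<rangle>\<close>; hence the transposed matrix governs the coroots.\<close>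

definition simple :: "'i \<Rightarrow> 'i \<Rightarrow> int" where
  "simple i = (\<lambda>j. if j = i then 1 else 0)"

definition transp_mat :: "('i \<Rightarrow> 'i \<Rightarrow> int) \<Rightarrow> 'i \<Rightarrow> 'i \<Rightarrow> int" where
  "transp_mat C = (\<lambda>i j. C j i)"

definition pairing :: "('i::finite \<Rightarrow> 'i \<Rightarrow> int) \<Rightarrow> ('i \<Rightarrow> int) \<Rightarrow> ('i \<Rightarrow> int) \<Rightarrow> int" where
  "pairing C x \<beta> = (\<Sum>i\<in>UNIV. \<Sum>j\<in>UNIV. x i * C i j * \<beta> j)"

definition finite_type :: "('i::finite \<Rightarrow> 'i \<Rightarrow> int) \<Rightarrow> ('i \<Rightarrow> nat) \<Rightarrow> bool" where
  "finite_type C d \<longleftrightarrow>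
     (\<forall>i. C i i = 2) \<and>
     (\<forall>i j. i \<noteq> j \<longrightarrow> C i j \<le> 0) \<and>
     (\<forall>i j. C i j = 0 \<longleftrightarrow> C j i = 0) \<and>
     (\<forall>i. d i > 0) \<and>
     (\<forall>i j. int (d i) * C i j = int (d j) * C j i) \<and>
     (\<forall>x :: 'i \<Rightarrow> real. (\<exists>i. x i \<noteq> 0) \<longrightarrow>
        (\<Sum>i\<in>UNIV. \<Sum>j\<in>UNIV. real (d i) * of_int (C i j) * x i * x j) > 0)"

definition sreflection :: "('i::finite \<Rightarrow> 'i \<Rightarrow> int) \<Rightarrow> 'i \<Rightarrow> ('i \<Rightarrow> int) \<Rightarrow> 'i \<Rightarrow> int" where
  "sreflection C i \<beta> = (\<lambda>j. if j = i then \<beta> j - pairing C (simple i) \<beta> else \<beta> j)"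

definition weyl_word :: "('i::finite \<Rightarrow> 'i \<Rightarrow> int) \<Rightarrow> 'i list \<Rightarrow> ('i \<Rightarrow> int) \<Rightarrow> 'i \<Rightarrow> int" where
  "weyl_word C ws = foldr (\<lambda>i w. sreflection C i \<circ> w) ws id"

definition reduced_word :: "('i::finite \<Rightarrow> 'i \<Rightarrow> int) \<Rightarrow> 'i list \<Rightarrow> bool" where
  "reduced_word C ws \<longleftrightarrow>
     (\<forall>us. weyl_word C us = weyl_word C ws \<longrightarrow> length ws \<le> length us)"

definition longest_word :: "('i::finite \<Rightarrow> 'i \<Rightarrow> int) \<Rightarrow> 'i set \<Rightarrow> 'i list \<Rightarrow> bool" where
  "longest_word C J ws \<longleftrightarrow> set ws \<subseteq> J \<and> reduced_word C ws \<and>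
     (\<forall>us. set us \<subseteq> J \<longrightarrow> reduced_word C us \<longrightarrow> length us \<le> length ws)"

definition positive_roots :: "('i::finite \<Rightarrow> 'i \<Rightarrow> int) \<Rightarrow> 'i set \<Rightarrow> ('i \<Rightarrow> int) set" where
  "positive_roots C J =
     {\<beta>. (\<exists>ws j. set ws \<subseteq> J \<and> j \<in> J \<and> \<beta> = weyl_word C ws (simple j)) \<and> (\<forall>i. \<beta> i \<ge> 0)}"

definition two_rho :: "('i::finite \<Rightarrow> 'i \<Rightarrow> int) \<Rightarrow> 'i set \<Rightarrow> 'i \<Rightarrow> int" where
  "two_rho C J = (\<lambda>i. \<Sum>\<beta>\<in>positive_roots C J. \<beta> i)"

text \<open>\<open>wword\<close> is a chosen reduced expression of the longest element of the Weyl group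
  of \<open>black\<close>.\<close>

record 'i satake =
  cartan :: "'i \<Rightarrow> 'i \<Rightarrow> int"
  symm :: "'i \<Rightarrow> nat"
  black :: "'i set"
  tau :: "'i \<Rightarrow> 'i"
  wword :: "'i list"

definition wblack :: "'i::finite satake \<Rightarrow> ('i \<Rightarrow> int) \<Rightarrow> 'i \<Rightarrow> int" where
  "wblack D = weyl_word (cartan D) (wword D)"

definition wblack_co :: "'i::finite satake \<Rightarrow> ('i \<Rightarrow> int) \<Rightarrow> 'i \<Rightarrow> int" where
  "wblack_co D = weyl_word (transp_mat (cartan D)) (wword D)"

text \<open>\<open>\<langle>2\<rho>\<^sub>\<bullet>\<^sup>\<or>, \<alpha>\<^sub>i\<rangle>\<close> and \<open>\<langle>h\<^sub>i, w\<^sub>\<bullet>(\<alpha>\<^sub>j)\<rangle>\<close> with \<open>j = \<tau>(i)\<close>.\<close>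

definition two_rho_co_pair :: "'i::finite satake \<Rightarrow> 'i \<Rightarrow> int" where
  "two_rho_co_pair D i =
     pairing (cartan D) (two_rho (transp_mat (cartan D)) (black D)) (simple i)"

definition hw_pair :: "'i::finite satake \<Rightarrow> 'i \<Rightarrow> int" where
  "hw_pair D i = pairing (cartan D) (simple i) (wblack D (simple (tau D i)))"

definition is_satake :: "'i::finite satake \<Rightarrow> bool" where
  "is_satake D \<longleftrightarrow>
     finite_type (cartan D) (symm D) \<and>
     (\<forall>i. tau D (tau D i) = i) \<and>
     (\<forall>i j. cartan D (tau D i) (tau D j) = cartan D i j) \<and>
     (\<forall>i. symm D (tau D i) = symm D i) \<and>
     tau D ` black D = black D \<and>
     longest_word (cartan D) (black D) (wword D) \<and>
     (\<forall>i\<in>black D. wblack D (simple i) = - simple (tau D i)) \<and>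
     (\<forall>i. i \<notin> black D \<and> tau D i = i \<longrightarrow> rat_of_int (two_rho_co_pair D i) / 2 \<in> \<int>)"


section \<open>The symmetric pair and the marked vertices\<close>

record ('i, 'g) lie_data =
  lscale :: "complex \<Rightarrow> 'g \<Rightarrow> 'g"
  bracket :: "'g \<Rightarrow> 'g \<Rightarrow> 'g"
  le :: "'i \<Rightarrow> 'g"
  lf :: "'i \<Rightarrow> 'g"
  lh :: "'i \<Rightarrow> 'g"

definition lie_algebra :: "('i, 'g::ab_group_add) lie_data \<Rightarrow> bool" where
  "lie_algebra G \<longleftrightarrow> vector_space (lscale G) \<and>
     (\<forall>x y z. bracket G (x + y) z = bracket G x z + bracket G y z) \<and>
     (\<forall>x y z. bracket G x (y + z) = bracket G x y + bracket G x z) \<and>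
     (\<forall>c x y. bracket G (lscale G c x) y = lscale G c (bracket G x y)) \<and>
     (\<forall>c x y. bracket G x (lscale G c y) = lscale G c (bracket G x y)) \<and>
     (\<forall>x. bracket G x x = 0) \<and>
     (\<forall>x y z. bracket G x (bracket G y z) + bracket G y (bracket G z x)
              + bracket G z (bracket G x y) = 0)"

definition lie_subalgebra :: "('i, 'g::ab_group_add) lie_data \<Rightarrow> 'g set \<Rightarrow> bool" where
  "lie_subalgebra G H \<longleftrightarrow>
     module.subspace (lscale G) H \<and> (\<forall>x\<in>H. \<forall>y\<in>H. bracket G x y \<in> H)"

text \<open>By Serre's theorem, a Lie algebra generated by \<open>e\<^sub>i, f\<^sub>i\<close> satisfying the relations below is a
  quotient of the complex semisimple Lie algebra with Cartan matrix \<open>C\<close>; linear independence of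
  the \<open>h\<^sub>i\<close> forces the kernel, a sum of simple ideals, to vanish.\<close>

definition semisimple_lie ::
  "('i::finite \<Rightarrow> 'i \<Rightarrow> int) \<Rightarrow> ('i, 'g::ab_group_add) lie_data \<Rightarrow> bool" where
  "semisimple_lie C G \<longleftrightarrow> lie_algebra G \<and>
     (\<forall>i j. bracket G (lh G i) (lh G j) = 0) \<and>
     (\<forall>i j. bracket G (lh G i) (le G j) = lscale G (of_int (C i j)) (le G j)) \<and>
     (\<forall>i j. bracket G (lh G i) (lf G j) = lscale G (of_int (- C i j)) (lf G j)) \<and>
     (\<forall>i j. bracket G (le G i) (lf G j) = (if i = j then lh G i else 0)) \<and>
     (\<forall>i j. i \<noteq> j \<longrightarrow> (bracket G (le G i) ^^ nat (1 - C i j)) (le G j) = 0) \<and>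
     (\<forall>i j. i \<noteq> j \<longrightarrow> (bracket G (lf G i) ^^ nat (1 - C i j)) (lf G j) = 0) \<and>
     (\<forall>c. (\<Sum>i\<in>UNIV. lscale G (c i) (lh G i)) = 0 \<longrightarrow> (\<forall>i. c i = 0)) \<and>
     (\<forall>H. lie_subalgebra G H \<and> range (le G) \<subseteq> H \<and> range (lf G) \<subseteq> H \<longrightarrow> H = UNIV)"

definition cartan_h :: "('i, 'g::ab_group_add) lie_data \<Rightarrow> 'g set" where
  "cartan_h G = module.span (lscale G) (range (lh G))"

definition root_space ::
  "('i::finite \<Rightarrow> 'i \<Rightarrow> int) \<Rightarrow> ('i, 'g::ab_group_add) lie_data \<Rightarrow> ('i \<Rightarrow> int) \<Rightarrow> 'g set" where
  "root_space C G \<beta> =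
     {x. \<forall>i. bracket G (lh G i) x = lscale G (of_int (pairing C (simple i) \<beta>)) x}"

definition positive_root ::
  "('i::finite \<Rightarrow> 'i \<Rightarrow> int) \<Rightarrow> ('i, 'g::ab_group_add) lie_data \<Rightarrow> ('i \<Rightarrow> int) \<Rightarrow> bool" where
  "positive_root C G \<beta> \<longleftrightarrow> (\<forall>i. \<beta> i \<ge> 0) \<and> (\<exists>i. \<beta> i \<noteq> 0) \<and> root_space C G \<beta> \<noteq> {0}"

text \<open>An involution attached to the Satake diagram: the identity on the subalgebra
  of \<open>black\<close>, and \<open>- w\<^sub>\<bullet> \<circ> \<tau>\<close> on the Cartan subalgebra.\<close>

definition satake_involution ::
  "'i::finite satake \<Rightarrow> ('i, 'g::ab_group_add) lie_data \<Rightarrow> ('g \<Rightarrow> 'g) \<Rightarrow> bool" where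
  "satake_involution D G \<theta> \<longleftrightarrow>
     (\<forall>x y. \<theta> (x + y) = \<theta> x + \<theta> y) \<and>
     (\<forall>c x. \<theta> (lscale G c x) = lscale G c (\<theta> x)) \<and>
     (\<forall>x y. \<theta> (bracket G x y) = bracket G (\<theta> x) (\<theta> y)) \<and>
     (\<forall>x. \<theta> (\<theta> x) = x) \<and>
     (\<forall>i\<in>black D. \<theta> (le G i) = le G i \<and> \<theta> (lf G i) = lf G i) \<and>
     (\<forall>i. \<theta> (lh G i) =
        - (\<Sum>j\<in>UNIV. lscale G (of_int (wblack_co D (simple (tau D i)) j)) (lh G j)))"

fun lower_central :: "('i, 'g::ab_group_add) lie_data \<Rightarrow> 'g set \<Rightarrow> nat \<Rightarrow> 'g set" where
  "lower_central G H 0 = H"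
| "lower_central G H (Suc n) =
     module.span (lscale G) {bracket G x y | x y. x \<in> H \<and> y \<in> lower_central G H n}"

definition cartan_subalgebra ::
  "('i, 'g::ab_group_add) lie_data \<Rightarrow> 'g set \<Rightarrow> 'g set \<Rightarrow> bool" where
  "cartan_subalgebra G L H \<longleftrightarrow> H \<subseteq> L \<and> lie_subalgebra G H \<and>
     (\<exists>n. lower_central G H n = {0}) \<and>
     {x \<in> L. \<forall>y\<in>H. bracket G x y \<in> H} = H"

definition marked :: "('i \<Rightarrow> int) set \<Rightarrow> 'i set" where
  "marked \<Gamma> = {i. simple i \<in> \<Gamma>}"

definition letzter_choice ::
  "'i::finite satake \<Rightarrow> ('i, 'g::ab_group_add) lie_data \<Rightarrow> ('g \<Rightarrow> 'g) \<Rightarrow> ('i \<Rightarrow> int) set \<Rightarrow> bool" where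
  "letzter_choice D G \<theta> \<Gamma> \<longleftrightarrow>
     (\<forall>\<gamma>\<in>\<Gamma>. positive_root (cartan D) G \<gamma>) \<and>
     (\<exists>ev fv.
        (\<forall>\<gamma>\<in>\<Gamma>. ev \<gamma> \<in> root_space (cartan D) G \<gamma> \<and> ev \<gamma> \<noteq> 0 \<and>
                 fv \<gamma> \<in> root_space (cartan D) G (- \<gamma>) \<and> fv \<gamma> \<noteq> 0) \<and>
        cartan_subalgebra G {x. \<theta> x = x}
          (module.span (lscale G) ({x \<in> cartan_h G. \<theta> x = x} \<union> {fv \<gamma> + ev \<gamma> | \<gamma>. \<gamma> \<in> \<Gamma>}))) \<and>
     (\<forall>i\<in>marked \<Gamma>. tau D i = i) \<and>
     (\<forall>i\<in>marked \<Gamma>. \<forall>j\<in>marked \<Gamma>. i \<noteq> j \<longrightarrow> cartan D i j = 0) \<and>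
     (\<forall>i\<in>black D. \<forall>j\<in>marked \<Gamma>. cartan D i j = 0)"


section \<open>Associative algebras and presentations\<close>

definition is_algebra :: "('k::field \<Rightarrow> 'u::ring_1 \<Rightarrow> 'u) \<Rightarrow> bool" where
  "is_algebra sc \<longleftrightarrow> vector_space sc \<and>
     (\<forall>c x y. sc c x * y = sc c (x * y)) \<and> (\<forall>c x y. x * sc c y = sc c (x * y))"

definition subalgebra :: "('k::field \<Rightarrow> 'u::ring_1 \<Rightarrow> 'u) \<Rightarrow> 'u set \<Rightarrow> bool" where
  "subalgebra sc A \<longleftrightarrow> module.subspace sc A \<and> 1 \<in> A \<and> (\<forall>x\<in>A. \<forall>y\<in>A. x * y \<in> A)"

definition generated_subalgebra :: "('k::field \<Rightarrow> 'u::ring_1 \<Rightarrow> 'u) \<Rightarrow> 'u set \<Rightarrow> 'u set" where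
  "generated_subalgebra sc S = \<Inter>{A. subalgebra sc A \<and> S \<subseteq> A}"

definition algebra_hom_on ::
  "('k::field \<Rightarrow> 'u::ring_1 \<Rightarrow> 'u) \<Rightarrow> ('k \<Rightarrow> 'v::ring_1 \<Rightarrow> 'v) \<Rightarrow> 'u set \<Rightarrow> ('u \<Rightarrow> 'v) \<Rightarrow> bool" where
  "algebra_hom_on sc sc' A f \<longleftrightarrow>
     (\<forall>x\<in>A. \<forall>y\<in>A. f (x + y) = f x + f y \<and> f (x * y) = f x * f y) \<and>
     (\<forall>c. \<forall>x\<in>A. f (sc c x) = sc' c (f x)) \<and> f 1 = 1"

definition algebra_aut :: "('k::field \<Rightarrow> 'u::ring_1 \<Rightarrow> 'u) \<Rightarrow> ('u \<Rightarrow> 'u) \<Rightarrow> bool" where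
  "algebra_aut sc f \<longleftrightarrow> algebra_hom_on sc sc UNIV f \<and> bij f"

definition algebra_antiaut :: "('k::field \<Rightarrow> 'u::ring_1 \<Rightarrow> 'u) \<Rightarrow> ('u \<Rightarrow> 'u) \<Rightarrow> bool" where
  "algebra_antiaut sc f \<longleftrightarrow>
     (\<forall>x y. f (x + y) = f x + f y \<and> f (x * y) = f y * f x) \<and>
     (\<forall>c x. f (sc c x) = sc c (f x)) \<and> f 1 = 1 \<and> bij f"

inductive_set ideal_generated :: "'a::ring_1 set \<Rightarrow> 'a set" for S where
  zero: "0 \<in> ideal_generated S"
| base: "s \<in> S \<Longrightarrow> s \<in> ideal_generated S"
| add: "x \<in> ideal_generated S \<Longrightarrow> y \<in> ideal_generated S \<Longrightarrow> x + y \<in> ideal_generated S"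
| mult: "x \<in> ideal_generated S \<Longrightarrow> a * x * b \<in> ideal_generated S"

text \<open>The free associative \<open>'k\<close>-algebra on \<open>'g\<close> is the monoid algebra \<open>'g word \<Rightarrow>\<^sub>0 'k\<close> of the
  free monoid.\<close>

datatype 'g word = Word (letters: "'g list")

instantiation word :: (type) monoid_add
begin

definition zero_word :: "'a word" where
  "zero_word = Word []"

definition plus_word :: "'a word \<Rightarrow> 'a word \<Rightarrow> 'a word" where
  "plus_word u v = Word (letters u @ letters v)"

instance
  by standard (simp_all add: zero_word_def plus_word_def)

end

definition free_scale :: "'k::field \<Rightarrow> ('g word \<Rightarrow>\<^sub>0 'k) \<Rightarrow> ('g word \<Rightarrow>\<^sub>0 'k)" where
  "free_scale c x = Poly_Mapping.single 0 c * x"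

definition free_gen :: "'g \<Rightarrow> ('g word \<Rightarrow>\<^sub>0 'k::field)" where
  "free_gen g = Poly_Mapping.single (Word [g]) 1"


section \<open>The quantum group\<close>

definition qint :: "'k::field \<Rightarrow> nat \<Rightarrow> 'k" where
  "qint p n = (p ^ n - inverse p ^ n) / (p - inverse p)"

definition qfact :: "'k::field \<Rightarrow> nat \<Rightarrow> 'k" where
  "qfact p n = (\<Prod>m=1..n. qint p m)"

definition divided_power ::
  "('k::field \<Rightarrow> 'u::ring_1 \<Rightarrow> 'u) \<Rightarrow> 'k \<Rightarrow> 'u \<Rightarrow> nat \<Rightarrow> 'u" where
  "divided_power sc p x n = sc (inverse (qfact p n)) (x ^ n)"

definition qi :: "'i satake \<Rightarrow> 'k::field base_field \<Rightarrow> 'i \<Rightarrow> 'k" where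
  "qi D B i = qq B ^ symm D i"

definition serre ::
  "('k::field \<Rightarrow> 'u::ring_1 \<Rightarrow> 'u) \<Rightarrow> 'k \<Rightarrow> int \<Rightarrow> 'u \<Rightarrow> 'u \<Rightarrow> 'u" where
  "serre sc p a x y =
     (\<Sum>r\<le>nat (1 - a). (- 1) ^ r *
        (divided_power sc p x (nat (1 - a) - r) * y * divided_power sc p x r))"

definition quantum_relators ::
  "'i::finite satake \<Rightarrow> 'k::field base_field \<Rightarrow> ('k \<Rightarrow> 'u::ring_1 \<Rightarrow> 'u) \<Rightarrow>
   ('i \<Rightarrow> 'u) \<Rightarrow> ('i \<Rightarrow> 'u) \<Rightarrow> ('i \<Rightarrow> 'u) \<Rightarrow> ('i \<Rightarrow> 'u) \<Rightarrow> 'u set" where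
  "quantum_relators D B sc E F K K' =
     {K i * K' i - 1 | i. True} \<union> {K' i * K i - 1 | i. True} \<union>
     {K i * K j - K j * K i | i j. True} \<union>
     {K i * E j - sc (qi D B i powi cartan D i j) (E j * K i) | i j. True} \<union>
     {K i * F j - sc (qi D B i powi (- cartan D i j)) (F j * K i) | i j. True} \<union>
     {E i * F i - F i * E i - sc (inverse (qi D B i - inverse (qi D B i))) (K i - K' i) | i. True} \<union>
     {E i * F j - F j * E i | i j. i \<noteq> j} \<union>
     {serre sc (qi D B i) (cartan D i j) (E i) (E j) | i j. i \<noteq> j} \<union>
     {serre sc (qi D B i) (cartan D i j) (F i) (F j) | i j. i \<noteq> j}"

datatype 'i qgen = GE 'i | GF 'i | GK 'i | GKinv 'i

record ('i, 'k, 'u) quantum_group =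
  usc :: "'k \<Rightarrow> 'u \<Rightarrow> 'u"
  qE :: "'i \<Rightarrow> 'u"
  qF :: "'i \<Rightarrow> 'u"
  qK :: "'i \<Rightarrow> 'u"
  qKinv :: "'i \<Rightarrow> 'u"
  lusztig :: "'i \<Rightarrow> 'u \<Rightarrow> 'u"
  antipode :: "'u \<Rightarrow> 'u"
  omega :: "'u \<Rightarrow> 'u"
  utau :: "'u \<Rightarrow> 'u"

definition presented_by_quantum_relators ::
  "'i::finite satake \<Rightarrow> 'k::field base_field \<Rightarrow> ('i, 'k, 'u::ring_1) quantum_group \<Rightarrow> bool" where
  "presented_by_quantum_relators D B U \<longleftrightarrow>
     (\<exists>\<pi> :: ('i qgen word \<Rightarrow>\<^sub>0 'k) \<Rightarrow> 'u.
        algebra_hom_on free_scale (usc U) UNIV \<pi> \<and> surj \<pi> \<and>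
        (\<forall>i. \<pi> (free_gen (GE i)) = qE U i \<and> \<pi> (free_gen (GF i)) = qF U i \<and>
             \<pi> (free_gen (GK i)) = qK U i \<and> \<pi> (free_gen (GKinv i)) = qKinv U i) \<and>
        {x. \<pi> x = 0} = ideal_generated
          (quantum_relators D B free_scale
             (\<lambda>i. free_gen (GE i)) (\<lambda>i. free_gen (GF i))
             (\<lambda>i. free_gen (GK i)) (\<lambda>i. free_gen (GKinv i))))"

definition unit_power :: "'u::ring_1 \<Rightarrow> 'u \<Rightarrow> int \<Rightarrow> 'u" where
  "unit_power x x' n = (if n \<ge> 0 then x ^ nat n else x' ^ nat (- n))"

text \<open>The value on \<open>K\<^sub>j\<close> is \<open>K\<^bsub>s\<^sub>i(\<alpha>\<^sub>j)\<^esub>\<close>, as \<open>s\<^sub>i(\<alpha>\<^sub>j) = \<alpha>\<^sub>j - a\<^sub>i\<^sub>j \<alpha>\<^sub>i\<close>.\<close>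

definition is_lusztig_aut ::
  "'i satake \<Rightarrow> 'k::field base_field \<Rightarrow> ('i, 'k, 'u::ring_1) quantum_group \<Rightarrow> 'i \<Rightarrow> bool" where
  "is_lusztig_aut D B U i \<longleftrightarrow>
     (let T = lusztig U i; dp = divided_power (usc U) (qi D B i) in
      algebra_aut (usc U) T \<and>
      T (qE U i) = - (qF U i * qK U i) \<and>
      T (qF U i) = - (qKinv U i * qE U i) \<and>
      (\<forall>j. j \<noteq> i \<longrightarrow> T (qE U j) =
         (\<Sum>r\<le>nat (- cartan D i j). usc U ((- 1) ^ r * inverse (qi D B i) ^ r)
            (dp (qE U i) (nat (- cartan D i j) - r) * qE U j * dp (qE U i) r))) \<and>
      (\<forall>j. j \<noteq> i \<longrightarrow> T (qF U j) =
         (\<Sum>r\<le>nat (- cartan D i j). usc U ((- 1) ^ r * qi D B i ^ r)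
            (dp (qF U i) r * qF U j * dp (qF U i) (nat (- cartan D i j) - r)))) \<and>
      (\<forall>j. T (qK U j) = qK U j * unit_power (qK U i) (qKinv U i) (- cartan D i j)))"

definition is_quantum_group ::
  "'i::finite satake \<Rightarrow> 'k::field base_field \<Rightarrow> ('i, 'k, 'u::ring_1) quantum_group \<Rightarrow> bool" where
  "is_quantum_group D B U \<longleftrightarrow>
     is_algebra (usc U) \<and> presented_by_quantum_relators D B U \<and>
     (\<forall>i. is_lusztig_aut D B U i) \<and>
     algebra_antiaut (usc U) (antipode U) \<and>
     (\<forall>i. antipode U (qE U i) = - (qKinv U i * qE U i) \<and>
          antipode U (qF U i) = - (qF U i * qK U i) \<and>
          antipode U (qK U i) = qKinv U i) \<and>
     algebra_aut (usc U) (omega U) \<and>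
     (\<forall>i. omega U (qE U i) = qF U i \<and> omega U (qF U i) = qE U i \<and>
          omega U (qK U i) = qKinv U i) \<and>
     algebra_aut (usc U) (utau U) \<and>
     (\<forall>i. utau U (qE U i) = qE U (tau D i) \<and> utau U (qF U i) = qF U (tau D i) \<and>
          utau U (qK U i) = qK U (tau D i))"

definition lusztig_wblack ::
  "'i satake \<Rightarrow> ('i, 'k, 'u) quantum_group \<Rightarrow> 'u \<Rightarrow> 'u" where
  "lusztig_wblack D U = foldr (\<lambda>i T. lusztig U i \<circ> T) (wword D) id"


section \<open>The \<open>\<imath>\<close>quantum group\<close>

definition is_parameter ::
  "'i::finite satake \<Rightarrow> 'k::field base_field \<Rightarrow> ('i \<Rightarrow> 'k) \<Rightarrow> bool" where
  "is_parameter D B \<sigma> \<longleftrightarrow> (\<forall>i. i \<notin> black D \<longrightarrow>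
     \<sigma> i \<in> K1_units B \<and>
     (hw_pair D i = 0 \<longrightarrow> \<sigma> i = \<sigma> (tau D i)) \<and>
     climit B (\<sigma> (tau D i)) = (- 1) powi two_rho_co_pair D i * climit B (\<sigma> i))"

definition iB ::
  "'i satake \<Rightarrow> ('i, 'k, 'u::ring_1) quantum_group \<Rightarrow> ('i \<Rightarrow> 'k) \<Rightarrow> 'i \<Rightarrow> 'u" where
  "iB D U \<sigma> i = (if i \<in> black D then qF U i
     else qF U i + usc U (\<sigma> i) (lusztig_wblack D U (qE U (tau D i)) * qKinv U i))"

definition ik :: "'i satake \<Rightarrow> ('i, 'k, 'u::ring_1) quantum_group \<Rightarrow> 'i \<Rightarrow> 'u" where
  "ik D U i = (if i \<in> black D then qK U i else qK U i * qKinv U (tau D i))"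

definition ikinv :: "'i satake \<Rightarrow> ('i, 'k, 'u::ring_1) quantum_group \<Rightarrow> 'i \<Rightarrow> 'u" where
  "ikinv D U i = (if i \<in> black D then qKinv U i else qK U (tau D i) * qKinv U i)"

definition iquantum ::
  "'i satake \<Rightarrow> ('i, 'k::field, 'u::ring_1) quantum_group \<Rightarrow> ('i \<Rightarrow> 'k) \<Rightarrow> 'u set" where
  "iquantum D U \<sigma> = generated_subalgebra (usc U)
     (qE U ` black D \<union> range (ik D U) \<union> range (ikinv D U) \<union> range (iB D U \<sigma>))"

definition itorus ::
  "'i satake \<Rightarrow> ('i, 'k::field, 'u::ring_1) quantum_group \<Rightarrow> ('i \<Rightarrow> 'k) \<Rightarrow> 'i set \<Rightarrow> 'u set" where
  "itorus D U \<sigma> X = generated_subalgebra (usc U)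
     (range (ik D U) \<union> range (ikinv D U) \<union> iB D U \<sigma> ` X)"

text \<open>The element \<open>(x; n)\<^sub>p = (p\<^sup>n x - 1) / (p - 1)\<close>.\<close>

definition qshift :: "('k::field \<Rightarrow> 'u::ring_1 \<Rightarrow> 'u) \<Rightarrow> 'u \<Rightarrow> int \<Rightarrow> 'k \<Rightarrow> 'u" where
  "qshift sc x n p = sc (inverse (p - 1)) (sc (p powi n) x - 1)"


section \<open>The anti-automorphism\<close>

definition dual_parameter ::
  "'i::finite satake \<Rightarrow> 'k::field base_field \<Rightarrow> ('i \<Rightarrow> 'k) \<Rightarrow> 'i \<Rightarrow> 'k" where
  "dual_parameter D B \<sigma> i = inverse (\<sigma> i) *
     qi D B i powi (- (2 * pairing (cartan D) (simple i) (two_rho (cartan D) (black D))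
                       + hw_pair D i) + 2)"

text \<open>The normalisation \<open>climit B (\<zeta> i) = 1\<close> selects the sign of \<open>\<zeta> i\<close>: the other conditions
  determine \<open>\<zeta> i\<close> only up to sign, and if its classical limit were \<open>-1\<close>, the twist by \<open>\<zeta>\<close>
  would move the eigenvalues of \<open>(k\<^sub>i; 0)\<close> out of \<open>K1 B\<close>.\<close>

definition twist_parameters ::
  "'i::finite satake \<Rightarrow> 'k::field base_field \<Rightarrow> ('i \<Rightarrow> 'k) \<Rightarrow> ('i \<Rightarrow> 'k) \<Rightarrow> ('i \<Rightarrow> 'k) \<Rightarrow> bool" where
  "twist_parameters D B \<sigma> \<eta> \<zeta> \<longleftrightarrow>
     (\<forall>i. \<eta> i \<in> K1_units B \<and> \<zeta> i \<in> K1_units B) \<and>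
     (\<forall>i\<in>black D. \<eta> i = 1) \<and>
     (\<forall>i. \<zeta> i * \<zeta> (tau D i) = 1) \<and>
     (\<forall>i. \<not> (i \<notin> black D \<and> tau D i \<noteq> i \<and> hw_pair D i \<noteq> 0) \<longrightarrow> \<zeta> i = 1) \<and>
     (\<forall>i. i \<notin> black D \<longrightarrow> \<eta> (tau D i) = \<eta> i \<and>
          dual_parameter D B \<sigma> i * \<zeta> i * \<eta> i * \<eta> (tau D i) = \<sigma> i) \<and>
     (\<forall>i. climit B (\<zeta> i) = 1)"

definition is_twist_iso ::
  "'i satake \<Rightarrow> ('i, 'k::field, 'u::ring_1) quantum_group \<Rightarrow> ('i \<Rightarrow> 'k) \<Rightarrow> ('i \<Rightarrow> 'k) \<Rightarrow>
   ('i \<Rightarrow> 'k) \<Rightarrow> ('i \<Rightarrow> 'k) \<Rightarrow> ('u \<Rightarrow> 'u) \<Rightarrow> bool" where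
  "is_twist_iso D U \<sigma>' \<sigma> \<eta> \<zeta> \<phi> \<longleftrightarrow>
     algebra_hom_on (usc U) (usc U) (iquantum D U \<sigma>') \<phi> \<and>
     bij_betw \<phi> (iquantum D U \<sigma>') (iquantum D U \<sigma>) \<and>
     (\<forall>i\<in>black D. \<phi> (qE U i) = qE U i) \<and>
     (\<forall>i. \<phi> (iB D U \<sigma>' i) = usc U (inverse (\<eta> i)) (iB D U \<sigma> i)) \<and>
     (\<forall>i. \<phi> (ik D U i) = usc U (inverse (\<zeta> i)) (ik D U i))"

text \<open>As a composition of automorphisms with \<open>S\<close>, \<open>pre_antipode\<close> is an anti-automorphism of the
  whole quantum group; it restricts to an anti-isomorphism between two subalgebras as soon as
  it is a bijection between them.\<close>

definition pre_antipode :: "'i satake \<Rightarrow> ('i, 'k, 'u) quantum_group \<Rightarrow> 'u \<Rightarrow> 'u" where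
  "pre_antipode D U = lusztig_wblack D U \<circ> utau U \<circ> omega U \<circ> antipode U"

definition iantipode ::
  "'i satake \<Rightarrow> ('i, 'k, 'u) quantum_group \<Rightarrow> ('u \<Rightarrow> 'u) \<Rightarrow> 'u \<Rightarrow> 'u" where
  "iantipode D U \<phi> = \<phi> \<circ> pre_antipode D U"


section \<open>Classical weight modules and restricted duals\<close>

text \<open>A module lives on a subspace \<open>mcarrier\<close> of an ambient vector space, so that duals are
  modules of the same kind.\<close>

record ('k, 'u, 'm) umodule =
  mcarrier :: "'m set"
  mscale :: "'k \<Rightarrow> 'm \<Rightarrow> 'm"
  mact :: "'u \<Rightarrow> 'm \<Rightarrow> 'm"

definition is_module ::
  "('k::field \<Rightarrow> 'u::ring_1 \<Rightarrow> 'u) \<Rightarrow> 'u set \<Rightarrow> ('k, 'u, 'm::ab_group_add) umodule \<Rightarrow> bool" where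
  "is_module sc A M \<longleftrightarrow>
     vector_space (mscale M) \<and> module.subspace (mscale M) (mcarrier M) \<and>
     (\<forall>x\<in>A. \<forall>m\<in>mcarrier M. mact M x m \<in> mcarrier M) \<and>
     (\<forall>x\<in>A. \<forall>m\<in>mcarrier M. \<forall>m'\<in>mcarrier M. mact M x (m + m') = mact M x m + mact M x m') \<and>
     (\<forall>x\<in>A. \<forall>c. \<forall>m\<in>mcarrier M. mact M x (mscale M c m) = mscale M c (mact M x m)) \<and>
     (\<forall>x\<in>A. \<forall>y\<in>A. \<forall>m\<in>mcarrier M. mact M (x + y) m = mact M x m + mact M y m) \<and>
     (\<forall>x\<in>A. \<forall>c. \<forall>m\<in>mcarrier M. mact M (sc c x) m = mscale M c (mact M x m)) \<and>
     (\<forall>x\<in>A. \<forall>y\<in>A. \<forall>m\<in>mcarrier M. mact M (x * y) m = mact M x (mact M y m)) \<and>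
     (\<forall>m\<in>mcarrier M. mact M 1 m = m)"

definition eigenspace ::
  "'u set \<Rightarrow> ('k, 'u, 'm) umodule \<Rightarrow> ('u \<Rightarrow> 'k) \<Rightarrow> 'm set" where
  "eigenspace A M \<chi> = {m \<in> mcarrier M. \<forall>x\<in>A. mact M x m = mscale M (\<chi> x) m}"

text \<open>A (commutative) algebra acts semisimply if the module is the direct sum of its simultaneous
  eigenspaces; directness is automatic.\<close>

definition acts_semisimply ::
  "'u set \<Rightarrow> ('k::field, 'u, 'm::ab_group_add) umodule \<Rightarrow> bool" where
  "acts_semisimply A M \<longleftrightarrow>
     module.span (mscale M) (\<Union>\<chi>. eigenspace A M \<chi>) = mcarrier M"

definition eigenvalue :: "('k, 'u, 'm::zero) umodule \<Rightarrow> 'u \<Rightarrow> 'k \<Rightarrow> bool" where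
  "eigenvalue M x c \<longleftrightarrow> (\<exists>m\<in>mcarrier M. m \<noteq> 0 \<and> mact M x m = mscale M c m)"

definition classical_weight_module ::
  "'i satake \<Rightarrow> 'k::field base_field \<Rightarrow> ('i, 'k, 'u::ring_1) quantum_group \<Rightarrow> ('i \<Rightarrow> 'k) \<Rightarrow>
   'i set \<Rightarrow> ('k, 'u, 'm::ab_group_add) umodule \<Rightarrow> bool" where
  "classical_weight_module D B U \<sigma> X M \<longleftrightarrow>
     is_module (usc U) (iquantum D U \<sigma>) M \<and>
     acts_semisimply (itorus D U \<sigma> X) M \<and>
     (\<forall>i c. i \<notin> X \<and> eigenvalue M (qshift (usc U) (ik D U i) 0 (qi D B i)) c \<longrightarrow> c \<in> K1 B) \<and>
     (\<forall>j c. j \<in> X \<and> eigenvalue M (iB D U \<sigma> j) c \<longrightarrow> c \<in> K1 B)"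

definition finite_dimensional :: "('k::field \<Rightarrow> 'm::ab_group_add \<Rightarrow> 'm) \<Rightarrow> 'm set \<Rightarrow> bool" where
  "finite_dimensional sc V \<longleftrightarrow> (\<exists>S. finite S \<and> S \<subseteq> V \<and> V \<subseteq> module.span sc S)"

definition in_C' ::
  "'i satake \<Rightarrow> 'k::field base_field \<Rightarrow> ('i, 'k, 'u::ring_1) quantum_group \<Rightarrow> ('i \<Rightarrow> 'k) \<Rightarrow>
   'i set \<Rightarrow> ('k, 'u, 'm::ab_group_add) umodule \<Rightarrow> bool" where
  "in_C' D B U \<sigma> X M \<longleftrightarrow> classical_weight_module D B U \<sigma> X M \<and>
     (\<forall>\<chi>. finite_dimensional (mscale M) (eigenspace (itorus D U \<sigma> X) M \<chi>))"

definition weight_space ::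
  "'i satake \<Rightarrow> 'k::field base_field \<Rightarrow> ('i, 'k, 'u::ring_1) quantum_group \<Rightarrow> ('i \<Rightarrow> 'k) \<Rightarrow>
   'i set \<Rightarrow> ('k, 'u, 'm::ab_group_add) umodule \<Rightarrow> ('i \<Rightarrow> 'k) \<Rightarrow> 'm set" where
  "weight_space D B U \<sigma> X M a = {m \<in> mcarrier M.
     (\<forall>i. i \<notin> X \<longrightarrow> mact M (qshift (usc U) (ik D U i) 0 (qi D B i)) m = mscale M (a i) m) \<and>
     (\<forall>j\<in>X. mact M (iB D U \<sigma> j) m = mscale M (a j) m)}"

text \<open>\<open>\<Oplus>\<^sub>a Hom(M\<^sub>a, K)\<close> is realised as the space of linear functionals on \<open>M = \<Oplus>\<^sub>a M\<^sub>a\<close> that vanish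
  on all but finitely many \<open>M\<^sub>a\<close>; functionals are extended by \<open>0\<close> outside the carrier.\<close>

definition restricted_dual ::
  "'i satake \<Rightarrow> 'k::field base_field \<Rightarrow> ('i, 'k, 'u::ring_1) quantum_group \<Rightarrow> ('i \<Rightarrow> 'k) \<Rightarrow>
   'i set \<Rightarrow> ('u \<Rightarrow> 'u) \<Rightarrow> ('k, 'u, 'm::ab_group_add) umodule \<Rightarrow> ('k, 'u, 'm \<Rightarrow> 'k) umodule" where
  "restricted_dual D B U \<sigma> X \<phi> M =
     \<lparr>mcarrier = {f.
         (\<forall>m\<in>mcarrier M. \<forall>m'\<in>mcarrier M. f (m + m') = f m + f m') \<and>
         (\<forall>c. \<forall>m\<in>mcarrier M. f (mscale M c m) = c * f m) \<and>
         (\<forall>m. m \<notin> mcarrier M \<longrightarrow> f m = 0) \<and>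
         finite {a. (\<forall>i. a i \<in> K1 B) \<and> (\<exists>m\<in>weight_space D B U \<sigma> X M a. f m \<noteq> 0)}},
      mscale = (\<lambda>c f m. c * f m),
      mact = (\<lambda>x f m. if m \<in> mcarrier M then f (mact M (iantipode D U \<phi> x) m) else 0)\<rparr>"

end

theory Submission
  imports Defs
begin

text \<open>Write \<open>T\<close> for a generator \<open>(k\<^sub>i; 0)\<close> or \<open>B\<^sub>j\<close> of the torus.  The anti-automorphism
  sends \<open>k\<^sub>i\<close> to \<open>\<zeta>\<^sub>i k\<^sub>i\<^sup>-\<^sup>1\<close>, because \<open>T\<^bsub>w\<^sub>\<bullet>\<^esub> \<tau>\<close> inverts \<open>k\<^sub>i\<close> (\<open>tw_k\<close>), and it sends \<open>B\<^sub>j\<close> to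
  \<open>\<plusminus>B\<^sub>j\<close> for marked \<open>j\<close> (\<open>S_B\<close>, \<open>sgn_X_cases\<close>).  So a linear functional on \<open>M\<close> that vanishes on all
  weight spaces except \<open>M\<^sub>b\<close> is a weight vector of \<open>M\<^sup>\<or>\<close>, whose weight is obtained from \<open>b\<close> by the
  involution \<open>b \<mapsto> b\<^sup>*\<close> called \<open>star\<close> below.  This involution preserves \<open>K1\<close>-valued weights: if
  \<open>b\<^sub>i\<close> is regular at \<open>q = 1\<close>, then \<open>1 + (q\<^sub>i - 1) b\<^sub>i\<close> has classical limit 1 and can be inverted
  (\<open>K1_weight_inverse\<close>).  Hence \<open>(M\<^sup>\<or>)\<^sub>a\<close> is the dual space of \<open>M\<close> at \<open>a\<^sup>*\<close>, which is finite-dimensional,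
  and applying this twice gives the equality of dimensions.

  This presupposes that the space of functionals supported on finitely many weight spaces is
  stable under \<open>U\<^sup>\<imath>\<close>: for \<open>x \<in> U\<^sup>\<imath>\<close> and a weight \<open>b\<close>, only finitely many weight spaces \<open>M\<^sub>a\<close> may be
  mapped by \<open>x\<close> to vectors with a component in \<open>M\<^sub>b\<close>.  The set of \<open>x\<close> with this property for all \<open>b\<close>
  is a subalgebra, so only generators matter.  Suppose that an operator composed of left and right
  multiplications by \<open>T\<close> kills \<open>x\<close>.  Replacing left multiplication by the number by which \<open>T\<close> acts
  on \<open>M\<^sub>b\<close> turns the operator into a polynomial, its symbol, of which the number by which \<open>T\<close> acts on
  \<open>M\<^sub>a\<close> must be a root; if the symbol is nonzero, then finitely many values remain
  (\<open>finite_supp_pure_generator\<close>).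

  For \<open>T = (k\<^sub>i; 0)\<close> such operators exist since the generators of \<open>U\<^sup>\<imath>\<close> are weight vectors for \<open>k\<^sub>i\<close>.
  For \<open>T = B\<^sub>j = F\<^sub>j + \<varsigma>\<^sub>j E\<^sub>j K\<^sub>j\<^sup>-\<^sup>1\<close> the main case is the generator
  \<open>B\<^sub>i = F\<^sub>i + \<varsigma>\<^sub>i T\<^bsub>w\<^sub>\<bullet>\<^esub>(E\<^bsub>\<tau>(i)\<^esub>) K\<^sub>i\<^sup>-\<^sup>1\<close>.  Each of its two summands is an extremal vector for the adjoint
  action of the quantum \<open>sl\<^sub>2\<close> belonging to \<open>j\<close>, and the quantum Serre relation says that the string
  through it ends.  On this string, right multiplication by \<open>B\<^sub>j\<close> is a tridiagonal matrix with entries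
  in the left multiplications by \<open>B\<^sub>j\<close> (\<open>torsion_string\<close>), and the characteristic polynomial of this
  matrix is the operator that is needed (\<open>torsion_three_term\<close>).\<close>

section \<open>Power series expansions at \<open>q = 1\<close>\<close>

lemma puiseux_of_fps_of_nat [simp]: "puiseux_of_fps A (of_nat k) = fps_nth A k"
  by (simp add: puiseux_of_fps_def)

lemma puiseux_of_fps_inject: "puiseux_of_fps A = puiseux_of_fps A' \<longleftrightarrow> A = A'"
  by (metis fps_ext puiseux_of_fps_of_nat)

lemma puiseux_of_fps_zero_iff: "puiseux_of_fps A s \<noteq> 0 \<Longrightarrow> \<exists>k. s = of_nat k"
  by (auto simp: puiseux_of_fps_def Nats_def split: if_splits)

lemma puiseux_puiseux_of_fps: "puiseux (puiseux_of_fps A)"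
proof -
  have "0 \<le> r \<and> rat_of_nat 1 * r \<in> \<int>" if "puiseux_of_fps A r \<noteq> 0" for r
    using puiseux_of_fps_zero_iff[OF that] by auto
  then show ?thesis unfolding puiseux_def by (meson order_refl)
qed

lemma pmult_puiseux_of_fps:
  assumes "\<And>k. k > m \<Longrightarrow> g (r - of_nat k) = 0"
  shows "pmult (puiseux_of_fps A) g r = (\<Sum>k\<le>m. fps_nth A k * g (r - of_nat k))"
proof -
  let ?S = "{s. puiseux_of_fps A s \<noteq> 0 \<and> g (r - s) \<noteq> 0}"
  have sub: "?S \<subseteq> of_nat ` {..m}"
  proof
    fix s assume s: "s \<in> ?S"
    then obtain k where k: "s = of_nat k" using puiseux_of_fps_zero_iff by blast
    with s assms[of k] have "k \<le> m" by (cases "k \<le> m") auto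
    with k show "s \<in> of_nat ` {..m}" by blast
  qed
  have "pmult (puiseux_of_fps A) g r =
      (\<Sum>s\<in>of_nat ` {..m}. puiseux_of_fps A s * g (r - s))"
    unfolding pmult_def using sub by (intro sum.mono_neutral_left) auto
  also have "\<dots> = (\<Sum>k\<le>m. fps_nth A k * g (r - of_nat k))"
    by (subst sum.reindex) (auto simp: inj_on_def)
  finally show ?thesis .
qed

text \<open>Since exponents are bounded below, multiplying by a power series involves finite sums only.\<close>

lemma puiseux_support_bounded:
  assumes "puiseux g"
  obtains m where "\<And>k. k > m \<Longrightarrow> g (r - of_nat k) = 0"
proof -
  obtain N where N: "\<And>r. g r \<noteq> 0 \<Longrightarrow> N \<le> r" using assms unfolding puiseux_def by blast
  obtain m where m: "r - N < of_nat m" using reals_Archimedean2[of "of_rat (r - N)"]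
    by (metis of_rat_less of_rat_of_nat_eq)
  have "g (r - of_nat k) = 0" if "k > m" for k
  proof (rule ccontr)
    assume "g (r - of_nat k) \<noteq> 0"
    with N have "N \<le> r - of_nat k" by blast
    moreover have "(of_nat m :: rat) < of_nat k" using that by simp
    ultimately show False using m by linarith
  qed
  then show ?thesis using that by blast
qed

lemma pmult_puiseux_of_fps_mult:
  "pmult (puiseux_of_fps A) (puiseux_of_fps A') = puiseux_of_fps (A * A')"
proof
  fix r
  show "pmult (puiseux_of_fps A) (puiseux_of_fps A') r = puiseux_of_fps (A * A') r"
  proof (cases "\<exists>n. r = of_nat n")
    case True
    then obtain n where n: "r = of_nat n" by blast
    have z: "puiseux_of_fps A' (r - of_nat k) = 0" if "k > n" for k
    proof (rule ccontr)
      assume "\<not> ?thesis"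
      then obtain j where "r - of_nat k = of_nat j" using puiseux_of_fps_zero_iff by blast
      then have "(of_nat n :: rat) = of_nat (j + k)" using n by simp
      then show False using that by (simp only: of_nat_eq_iff)
    qed
    have "pmult (puiseux_of_fps A) (puiseux_of_fps A') r
        = (\<Sum>k\<le>n. fps_nth A k * puiseux_of_fps A' (r - of_nat k))"
      by (rule pmult_puiseux_of_fps) (rule z)
    also have "\<dots> = (\<Sum>k\<le>n. fps_nth A k * fps_nth A' (n - k))"
      by (intro sum.cong refl) (simp add: n flip: of_nat_diff)
    finally show ?thesis by (simp add: n fps_mult_nth atMost_atLeast0)
  next
    case False
    have z: "puiseux_of_fps A' (r - of_nat k) = 0" for k
    proof (rule ccontr)
      assume "\<not> ?thesis"
      then obtain j where "r - of_nat k = of_nat j" using puiseux_of_fps_zero_iff by blast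
      then have "r = of_nat (j + k)" by simp
      then show False using False by blast
    qed
    then have "pmult (puiseux_of_fps A) (puiseux_of_fps A') r = 0"
      using pmult_puiseux_of_fps[of 0 "puiseux_of_fps A'" r A] z[of 0] by simp
    then show ?thesis using False puiseux_of_fps_zero_iff by metis
  qed
qed

text \<open>Exponents of a Puiseux series are bounded below with bounded denominators, so two different
  series have a lowest exponent at which they differ; multiplication by the leading term of
  \<open>A\<close> makes that difference visible in the product.\<close>

lemma pmult_puiseux_of_fps_cancel:
  assumes "A \<noteq> 0" "puiseux g" "puiseux h"
    and eq: "pmult (puiseux_of_fps A) g = pmult (puiseux_of_fps A) h"
  shows "g = h"
proof (rule ccontr)
  assume "g \<noteq> h"
  obtain n N where n: "n \<ge> 1" "\<And>r. g r \<noteq> 0 \<Longrightarrow> N \<le> r \<and> rat_of_nat n * r \<in> \<int>"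
    using assms(2) unfolding puiseux_def by blast
  obtain n' N' where n': "n' \<ge> 1" "\<And>r. h r \<noteq> 0 \<Longrightarrow> N' \<le> r \<and> rat_of_nat n' * r \<in> \<int>"
    using assms(3) unfolding puiseux_def by blast
  define M where "M = min N N'"
  define e where "e r = rat_of_nat (n * n') * (r - M)" for r
  have e_mono: "r < s \<longleftrightarrow> e r < e s" for r s using n(1) n'(1) by (simp add: e_def)
  have D: "M \<le> r \<and> rat_of_nat (n * n') * r \<in> \<int>" if d: "g r \<noteq> h r" for r
  proof (cases "g r = 0")
    case False
    then have "rat_of_nat n' * (rat_of_nat n * r) \<in> \<int>"
      using n(2)[OF False] by (intro Ints_mult[OF Ints_of_nat, of "rat_of_nat n * r"]) auto
    then show ?thesis using n(2)[OF False] by (auto simp: M_def ac_simps)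
  next
    case True
    then have hr: "h r \<noteq> 0" using d by simp
    then have "rat_of_nat n * (rat_of_nat n' * r) \<in> \<int>"
      using n'(2)[OF hr] by (intro Ints_mult[OF Ints_of_nat, of "rat_of_nat n' * r"]) auto
    then show ?thesis using n'(2)[OF hr] by (auto simp: M_def ac_simps)
  qed
  define c where "c = rat_of_nat (n * n') * M"
  obtain r0 where r0: "g r0 \<noteq> h r0" using \<open>g \<noteq> h\<close> by blast
  obtain r where r: "g r \<noteq> h r" and rmin: "\<And>s. g s \<noteq> h s \<Longrightarrow> nat \<lfloor>e r\<rfloor> \<le> nat \<lfloor>e s\<rfloor>"
    using ex_has_least_nat[of "\<lambda>r. g r \<noteq> h r" r0 "\<lambda>r. nat \<lfloor>e r\<rfloor>"] r0 by blast
  have least: "g s = h s" if s: "s < r" for s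
  proof (rule ccontr)
    assume d: "g s \<noteq> h s"
    obtain a b where a: "rat_of_nat (n * n') * s = of_int a" and b: "rat_of_nat (n * n') * r = of_int b"
      using D[OF d] D[OF r] Ints_cases by metis
    have "e s < e r" using e_mono s by simp
    then have "a < b" unfolding e_def right_diff_distrib a b by simp
    have ge: "e s \<ge> 0" using D[OF d] by (simp add: e_def)
    have "\<lfloor>e s\<rfloor> < \<lfloor>e r\<rfloor>"
      unfolding e_def right_diff_distrib a b using \<open>a < b\<close> by linarith
    moreover have "0 \<le> \<lfloor>e s\<rfloor>" using ge by simp
    ultimately have "nat \<lfloor>e s\<rfloor> < nat \<lfloor>e r\<rfloor>" by linarith
    then show False using rmin[OF d] by linarith
  qed
  define k where "k = subdegree A"
  obtain m1 where m1: "\<And>j. j > m1 \<Longrightarrow> g (r + of_nat k - of_nat j) = 0"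
    using puiseux_support_bounded[OF assms(2)] by blast
  obtain m2 where m2: "\<And>j. j > m2 \<Longrightarrow> h (r + of_nat k - of_nat j) = 0"
    using puiseux_support_bounded[OF assms(3)] by blast
  define m where "m = max k (max m1 m2)"
  have "(\<Sum>j\<le>m. fps_nth A j * g (r + of_nat k - of_nat j))
      = (\<Sum>j\<le>m. fps_nth A j * h (r + of_nat k - of_nat j))"
  proof -
    have "pmult (puiseux_of_fps A) f (r + of_nat k)
        = (\<Sum>j\<le>m. fps_nth A j * f (r + of_nat k - of_nat j))"
      if "\<And>j. j > max m1 m2 \<Longrightarrow> f (r + of_nat k - of_nat j) = 0" for f
      by (rule pmult_puiseux_of_fps) (use that in \<open>simp add: m_def\<close>)
    from this[of g] this[of h] show ?thesis unfolding eq using m1 m2 by simp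
  qed
  then have "(\<Sum>j\<le>m. fps_nth A j * g (r + of_nat k - of_nat j))
      - (\<Sum>j\<le>m. fps_nth A j * h (r + of_nat k - of_nat j)) = 0" by (simp only: diff_self)
  then have "0 = (\<Sum>j\<le>m. fps_nth A j * (g (r + of_nat k - of_nat j) - h (r + of_nat k - of_nat j)))"
    by (simp only: right_diff_distrib sum_subtractf)
  also have "\<dots> = (\<Sum>j\<in>{k}. fps_nth A j * (g (r + of_nat k - of_nat j) - h (r + of_nat k - of_nat j)))"
  proof (rule sum.mono_neutral_right)
    show "\<forall>j\<in>{..m} - {k}. fps_nth A j *
        (g (r + of_nat k - of_nat j) - h (r + of_nat k - of_nat j)) = 0"
    proof
      fix j assume "j \<in> {..m} - {k}"
      then consider "j < k" | "j > k" by (cases j k rule: linorder_cases) auto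
      then show "fps_nth A j * (g (r + of_nat k - of_nat j) - h (r + of_nat k - of_nat j)) = 0"
      proof cases
        case 1
        then have "fps_nth A j = 0" unfolding k_def by (rule nth_less_subdegree_zero)
        then show ?thesis by simp
      next
        case 2
        then have "(of_nat k :: rat) < of_nat j" by simp
        then show ?thesis using least[of "r + of_nat k - of_nat j"] by simp
      qed
    qed
  qed (auto simp: m_def)
  finally have "g r = h r" using assms(1) by (simp add: k_def)
  then show False using r by simp
qed

definition expansion :: "'k base_field \<Rightarrow> 'k \<Rightarrow> complex fps \<Rightarrow> bool" where
  "expansion B x A \<longleftrightarrow> exp_at_1 B x = puiseux_of_fps A"

text \<open>Since \<open>(1 + z)\<^sup>1\<^sup>/\<^sup>n - 1\<close> has no constant term, a power series in it is a power series in
  \<open>z\<close>; conversely \<open>n = 1\<close> gives all power series in \<open>z\<close>.\<close>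

lemma K1_iff_expansion: "x \<in> K1 B \<longleftrightarrow> (\<exists>A. expansion B x A)"
proof
  assume "x \<in> K1 B" then show "\<exists>A. expansion B x A" by (auto simp: K1_def expansion_def)
next
  assume "\<exists>A. expansion B x A"
  then obtain A where A: "exp_at_1 B x = puiseux_of_fps A" by (auto simp: expansion_def)
  have "fps_binomial (1 / of_nat 1) - 1 = (fps_X :: complex fps)"
    by (simp add: fps_binomial_1)
  then have "A = fps_compose A (fps_binomial (1 / of_nat 1) - 1)" by simp
  with A show "x \<in> K1 B" unfolding K1_def by (metis (mono_tags, lifting) mem_Collect_eq order_refl)
qed

lemma climit_expansion: "expansion B x A \<Longrightarrow> climit B x = fps_nth A 0"
  using puiseux_of_fps_of_nat[of A 0] by (simp add: expansion_def climit_def del: puiseux_of_fps_of_nat)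

context
  fixes B :: "'k::alg_closed_field base_field"
  assumes B: "is_base_field B"
begin

lemma exp_at_1_embedding: "puiseux_embedding (const B) (exp_at_1 B)"
  using B by (simp add: is_base_field_def)

lemma expansion_add: "expansion B x A \<Longrightarrow> expansion B y A' \<Longrightarrow> expansion B (x + y) (A + A')"
  using exp_at_1_embedding by (auto simp: puiseux_embedding_def expansion_def puiseux_of_fps_def fun_eq_iff)

lemma expansion_mult: "expansion B x A \<Longrightarrow> expansion B y A' \<Longrightarrow> expansion B (x * y) (A * A')"
  using exp_at_1_embedding by (simp add: puiseux_embedding_def expansion_def pmult_puiseux_of_fps_mult)

lemma const_hom: "const B (c * d) = const B c * const B d" "const B (c + d) = const B c + const B d"
    "const B 1 = 1"
  using B by (simp_all add: is_base_field_def field_hom_def)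

lemma expansion_const: "expansion B (const B c) (fps_const c)"
proof -
  have "pmonom c 0 = puiseux_of_fps (fps_const c)"
  proof
    fix r
    show "pmonom c 0 r = puiseux_of_fps (fps_const c) r"
    proof (cases "\<exists>k. r = of_nat k")
      case True then show ?thesis using puiseux_of_fps_of_nat[of "fps_const c" 0]
        by (auto simp: pmonom_def simp del: puiseux_of_fps_of_nat) (simp_all)
    next
      case False
      then have "puiseux_of_fps (fps_const c) r = 0" using puiseux_of_fps_zero_iff by blast
      moreover have "r \<noteq> 0" using False of_nat_0[symmetric] by blast
      ultimately show ?thesis by (simp add: pmonom_def)
    qed
  qed
  then show ?thesis using exp_at_1_embedding by (simp add: puiseux_embedding_def expansion_def)
qed

lemma expansion_1: "expansion B 1 1"
  using expansion_const[of 1] const_hom(3) by simp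

lemma expansion_minus:
  assumes "expansion B x A" shows "expansion B (- x) (- A)"
proof -
  have "const B 0 + const B 0 = const B 0" using const_hom(2)[of 0 0] by simp
  then have "const B 0 = 0" by (simp only: add_cancel_left_left)
  then have "const B (- 1) = - 1" using const_hom(2)[of "-1" 1] const_hom(3)
    by (simp add: eq_neg_iff_add_eq_0)
  moreover have "(fps_const (-1) :: complex fps) = - 1"
    by (metis fps_const_1_eq_1 fps_const_neg)
  ultimately show ?thesis using expansion_mult[OF expansion_const[of "-1"] assms]
    by (metis mult_minus1)
qed

lemma expansion_diff: "expansion B x A \<Longrightarrow> expansion B y A' \<Longrightarrow> expansion B (x - y) (A - A')"
  using expansion_add[OF _ expansion_minus, of x A y A'] by simp

lemma expansion_qq_power: "expansion B (qq B ^ n) ((1 + fps_X) ^ n)"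
proof (induction n)
  case 0 then show ?case by (simp add: expansion_1)
next
  case (Suc n)
  have "exp_at_1 B (qroot B 1) = puiseux_of_fps (fps_binomial (1 / of_nat 1))"
    using B unfolding is_base_field_def by blast
  then have "expansion B (qq B) (1 + fps_X)"
    by (simp add: expansion_def qq_def fps_binomial_1)
  from expansion_mult[OF this Suc] show ?case by simp
qed

lemma expansion_nonzero: "expansion B x A \<Longrightarrow> A \<noteq> 0 \<Longrightarrow> x \<noteq> 0"
proof
  assume "expansion B x A" "A \<noteq> 0" "x = 0"
  moreover have "expansion B 0 0" using expansion_diff[OF expansion_1 expansion_1] by simp
  ultimately show False by (auto simp: expansion_def puiseux_of_fps_inject)
qed

text \<open>Quotients are computed in the field of Puiseux series, where \<open>y\<close> can be cancelled; so divisibility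
  of expansions as power series is enough to stay inside \<open>K1\<close>.\<close>

lemma expansion_divide:
  assumes "expansion B x (A * C)" "expansion B y A" "A \<noteq> 0"
  shows "expansion B (x / y) C"
proof -
  have y: "y \<noteq> 0" using expansion_nonzero assms by blast
  have "pmult (puiseux_of_fps A) (exp_at_1 B (x / y)) = exp_at_1 B (y * (x / y))"
    using exp_at_1_embedding assms(2) by (simp add: puiseux_embedding_def expansion_def del: times_divide_eq_right)
  also have "\<dots> = pmult (puiseux_of_fps A) (puiseux_of_fps C)"
    using assms(1) y by (simp add: expansion_def pmult_puiseux_of_fps_mult)
  finally have "exp_at_1 B (x / y) = puiseux_of_fps C"
    using pmult_puiseux_of_fps_cancel[OF assms(3) _ puiseux_puiseux_of_fps] exp_at_1_embedding
    by (auto simp: puiseux_embedding_def)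
  then show ?thesis by (simp add: expansion_def)
qed

lemma fps_one_plus_X_power_nth: "fps_nth ((1 + fps_X :: complex fps) ^ n) 0 = 1"
    "fps_nth ((1 + fps_X :: complex fps) ^ n) 1 = of_nat n"
  by (induction n) (simp_all add: fps_power_zeroth algebra_simps)

text \<open>The coefficient of \<open>z\<close> in \<open>(1 + z)\<^sup>n\<close> is \<open>n\<close>; hence \<open>q\<close> is not a root of unity, and no quantum
  factorial vanishes.\<close>

lemma qq_power_neq_1: "n > 0 \<Longrightarrow> qq B ^ n \<noteq> 1"
proof
  assume "n > 0" "qq B ^ n = 1"
  then have "puiseux_of_fps ((1 + fps_X) ^ n) = puiseux_of_fps 1"
    using expansion_qq_power[of n] expansion_1 by (simp add: expansion_def)
  then have "(1 + fps_X :: complex fps) ^ n = 1" by (simp only: puiseux_of_fps_inject)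
  then have "fps_nth ((1 + fps_X :: complex fps) ^ n) 1 = 0" by (simp only: fps_one_nth) simp
  then show False unfolding fps_one_plus_X_power_nth(2) using \<open>n > 0\<close> by simp
qed

lemma qq_neq_0: "qq B \<noteq> 0"
  using expansion_qq_power[of 1] expansion_nonzero[of "qq B ^ 1"] fps_one_plus_X_power_nth(1)[of 1]
  by (metis fps_nonzero_nth power_one_right zero_neq_one)

lemma K1_minus: "x \<in> K1 B \<Longrightarrow> - x \<in> K1 B"
  using expansion_minus by (auto simp: K1_iff_expansion)

text \<open>If \<open>k = 1 + (q\<^sup>d - 1) x\<close> with \<open>x\<close> regular at \<open>q = 1\<close>, then \<open>k\<close> has classical limit 1, so it is
  invertible, and so is the classical limit of \<open>z / k\<close>; hence \<open>z / k - 1\<close> is divisible by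
  \<open>q\<^sup>d - 1\<close>, which vanishes to first order.\<close>

lemma K1_shifted_nonzero:
  assumes "x \<in> K1 B" shows "1 + (qq B ^ d - 1) * x \<noteq> 0"
proof -
  obtain A where "expansion B x A" using assms unfolding K1_iff_expansion ..
  then have "expansion B (1 + (qq B ^ d - 1) * x) (1 + ((1 + fps_X) ^ d - 1) * A)"
    by (intro expansion_add expansion_1 expansion_mult expansion_diff expansion_qq_power)
  moreover have "1 + ((1 + fps_X) ^ d - 1) * A \<noteq> (0 :: complex fps)"
  proof
    assume "1 + ((1 + fps_X) ^ d - 1) * A = 0"
    then have "fps_nth (1 + ((1 + fps_X) ^ d - 1) * A) 0 = 0" by simp
    then show False by (simp add: fps_power_zeroth)
  qed
  ultimately show ?thesis by (rule expansion_nonzero)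
qed

lemma K1_weight_inverse:
  assumes x: "x \<in> K1 B" and z: "z \<in> K1 B" "climit B z = 1" and d: "d > 0"
  shows "(z / (1 + (qq B ^ d - 1) * x) - 1) / (qq B ^ d - 1) \<in> K1 B"
proof -
  obtain A where A: "expansion B x A" using x unfolding K1_iff_expansion ..
  obtain Z where Z: "expansion B z Z" using z(1) unfolding K1_iff_expansion ..
  have Z0: "fps_nth Z 0 = 1" using climit_expansion[OF Z] z(2) by simp
  define Q where "Q = ((1 + fps_X) ^ d - 1 :: complex fps)"
  have Q: "expansion B (qq B ^ d - 1) Q"
    unfolding Q_def by (intro expansion_diff expansion_qq_power expansion_1)
  have Q0: "fps_nth Q 0 = 0" "fps_nth Q 1 \<noteq> 0"
    using d fps_one_plus_X_power_nth[of d] by (simp_all add: Q_def)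
  have X_dvd: "fps_X dvd F" if "fps_nth F 0 = 0" for F :: "complex fps"
  proof
    show "F = fps_X * fps_shift 1 F"
      by (rule fps_ext) (use that in \<open>simp add: Suc_le_eq\<close>)
  qed
  define N where "N = Z - (1 + Q * A)"
  have N0: "fps_nth N 0 = 0" using Z0 Q0 by (simp add: N_def)
  obtain Q' where Q': "Q = fps_X * Q'"
    using X_dvd[OF Q0(1)] by (rule dvdE)
  obtain N' where N': "N = fps_X * N'"
    using X_dvd[OF N0] by (rule dvdE)
  define V where "V = Q' * (1 + Q * A)"
  have "fps_nth V 0 \<noteq> 0" using Q0 Q' by (simp add: V_def)
  then have V: "V * inverse V = 1" by (simp add: inverse_mult_eq_1')
  let ?k = "1 + (qq B ^ d - 1) * x"
  have kE: "expansion B ?k (1 + Q * A)"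
    by (intro expansion_add expansion_1 expansion_mult Q A)
  have "expansion B (z - ?k) N" unfolding N_def by (intro expansion_diff Z kE)
  moreover have "N = (Q * (1 + Q * A)) * (N' * inverse V)"
  proof -
    have "(Q * (1 + Q * A)) * (N' * inverse V) = fps_X * N' * (V * inverse V)"
      by (simp add: V_def Q' ac_simps)
    then show ?thesis by (metis N' V mult.right_neutral)
  qed
  moreover have "expansion B ((qq B ^ d - 1) * ?k) (Q * (1 + Q * A))"
    by (intro expansion_mult Q kE)
  moreover have "Q * (1 + Q * A) \<noteq> 0"
  proof -
    have "fps_nth (1 + Q * A) 0 = 1" using Q0 by simp
    then have "1 + Q * A \<noteq> 0" by (auto simp: fps_eq_iff)
    moreover have "Q \<noteq> 0" using Q0(2) by auto
    ultimately show ?thesis by simp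
  qed
  ultimately have "expansion B ((z - ?k) / ((qq B ^ d - 1) * ?k)) (N' * inverse V)"
    using expansion_divide by metis
  moreover have "(z - ?k) / ((qq B ^ d - 1) * ?k) = (z / ?k - 1) / (qq B ^ d - 1)"
    using K1_shifted_nonzero[OF x, of d] by (simp add: diff_divide_distrib)
  ultimately show ?thesis using K1_iff_expansion by metis
qed

end

section \<open>Operators generated by left and right multiplication\<close>

text \<open>The symbol of an operator on an algebra: left multiplication by \<open>T\<close> becomes the scalar \<open>b\<close>,
  right multiplication by \<open>T\<close> becomes the variable.\<close>

inductive symbol ::
  "('k::field \<Rightarrow> 'u::ring_1 \<Rightarrow> 'u) \<Rightarrow> 'u \<Rightarrow> 'k \<Rightarrow> ('u \<Rightarrow> 'u) \<Rightarrow> 'k poly \<Rightarrow> bool"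
  for sc T b where
  ident: "symbol sc T b (\<lambda>x. x) 1"
| left: "symbol sc T b \<Phi> p \<Longrightarrow> symbol sc T b (\<lambda>x. T * \<Phi> x) (smult b p)"
| right: "symbol sc T b \<Phi> p \<Longrightarrow> symbol sc T b (\<lambda>x. \<Phi> x * T) (pCons 0 p)"
| add: "symbol sc T b \<Phi> p \<Longrightarrow> symbol sc T b \<Psi> p' \<Longrightarrow>
    symbol sc T b (\<lambda>x. \<Phi> x + \<Psi> x) (p + p')"
| scale: "symbol sc T b \<Phi> p \<Longrightarrow> symbol sc T b (\<lambda>x. sc c (\<Phi> x)) (smult c p)"

text \<open>Being annihilated by an operator with nonzero symbol means that \<open>x\<close> generates, modulo left
  multiplication by \<open>T - b\<close>, a torsion module over the polynomials in right multiplication by \<open>T\<close>.\<close>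

definition torsion :: "('k::field \<Rightarrow> 'u::ring_1 \<Rightarrow> 'u) \<Rightarrow> 'u \<Rightarrow> 'k \<Rightarrow> 'u \<Rightarrow> bool" where
  "torsion sc T b x \<longleftrightarrow> (\<exists>\<Phi> p. symbol sc T b \<Phi> p \<and> p \<noteq> 0 \<and> \<Phi> x = 0)"

locale algebra =
  fixes sc :: "'k::field \<Rightarrow> 'u::ring_1 \<Rightarrow> 'u"
  assumes is_algebra: "is_algebra sc"
begin

sublocale vector_space sc
  using is_algebra by (simp add: is_algebra_def)

lemma scale_mult_left [simp]: "sc c x * y = sc c (x * y)"
  and scale_mult_right [simp]: "x * sc c y = sc c (x * y)"
  using is_algebra by (simp_all add: is_algebra_def)

lemma symbol_linear:
  assumes "symbol sc T b \<Phi> p"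
  shows "\<Phi> (x + y) = \<Phi> x + \<Phi> y \<and> \<Phi> (sc c x) = sc c (\<Phi> x)"
  using assms
  by (induction) (simp_all add: scale_right_distrib distrib_left distrib_right mult.commute)

lemma symbol_zero: "symbol sc T b \<Phi> p \<Longrightarrow> \<Phi> 0 = 0"
  using symbol_linear[of T b \<Phi> p 0 0 0] by simp

lemma symbol_left_right:
  assumes "symbol sc T b \<Phi> p"
  shows "\<Phi> (T * x) = T * \<Phi> x \<and> \<Phi> (x * T) = \<Phi> x * T"
  using assms by (induction) (simp_all add: distrib_left distrib_right mult.assoc)

lemma symbol_commute:
  assumes "symbol sc T b \<Phi> p" "symbol sc T b \<Psi> p'"
  shows "\<Phi> (\<Psi> x) = \<Psi> (\<Phi> x)"
  using assms(1)
  by (induction) (use assms(2) in \<open>simp_all add: symbol_left_right[OF assms(2)] symbol_linear[OF assms(2)]\<close>)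

lemma symbol_compose:
  assumes "symbol sc T b \<Phi> p" "symbol sc T b \<Psi> p'"
  shows "symbol sc T b (\<lambda>x. \<Phi> (\<Psi> x)) (p * p')"
  using assms(1)
proof (induction)
  case ident then show ?case using assms(2) by simp
next
  case (left \<Phi> p) then show ?case using symbol.left[OF left.IH] by simp
next
  case (right \<Phi> p) then show ?case using symbol.right[OF right.IH] by simp
next
  case (add \<Phi> p \<Phi>' p'') then show ?case using symbol.add[OF add.IH] by (simp add: distrib_right)
next
  case (scale \<Phi> p c) then show ?case using symbol.scale[OF scale.IH, of c] by simp
qed

text \<open>Operators commute and symbols multiply, so the composite of two annihilators annihilates
  the sum.\<close>

lemma torsion_add:
  assumes "torsion sc T b x" "torsion sc T b y" shows "torsion sc T b (x + y)"
proof -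
  obtain \<Phi> p \<Psi> p' where *: "symbol sc T b \<Phi> p" "p \<noteq> 0" "\<Phi> x = 0"
      "symbol sc T b \<Psi> p'" "p' \<noteq> 0" "\<Psi> y = 0"
    using assms unfolding torsion_def by blast
  have "\<Phi> (\<Psi> (x + y)) = \<Psi> (\<Phi> x) + \<Phi> (\<Psi> y)"
    using symbol_commute[OF *(1,4)] symbol_linear[OF *(1)] symbol_linear[OF *(4)] by metis
  then have "\<Phi> (\<Psi> (x + y)) = 0" using * symbol_zero[OF *(1)] symbol_zero[OF *(4)] by simp
  then show ?thesis unfolding torsion_def using symbol_compose[OF *(1,4)] *(2,5)
    by (intro exI[of _ "\<lambda>x. \<Phi> (\<Psi> x)"] exI[of _ "p * p'"]) simp
qed

lemma torsion_scale: "torsion sc T b x \<Longrightarrow> torsion sc T b (sc c x)"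
  unfolding torsion_def using symbol_linear by (metis scale_zero_right)

text \<open>Modulo left multiplication by \<open>T - b\<close>, the relations express right multiplication by \<open>T\<close> on
  the \<open>v r\<close> by a tridiagonal matrix: applying to \<open>v 0\<close> the operator given by the \<open>r\<close>-th
  polynomial of the corresponding three-term recursion, monic of degree \<open>r\<close>, yields \<open>v r\<close>.\<close>

lemma torsion_three_term:
  assumes rec: "\<And>r. v r * T = sc (l r) (T * v r) + v (Suc r) + sc (c r) (v (r - 1))"
    and "v N = 0"
  shows "torsion sc T b (v 0)"
proof -
  have "\<exists>\<Phi> p. symbol sc T b \<Phi> p \<and> degree p = r \<and> p \<noteq> 0 \<and> \<Phi> (v 0) = v r" for r
  proof (induction r rule: less_induct)
    case (less r)
    show ?case
    proof (cases r)
      case 0 then show ?thesis using symbol.ident[of sc T b] by (intro exI[of _ "\<lambda>x. x"] exI[of _ 1]) simp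
    next
      case (Suc s)
      obtain \<Phi> p where p: "symbol sc T b \<Phi> p" "degree p = s" "p \<noteq> 0" "\<Phi> (v 0) = v s"
        using less[of s] Suc by auto
      obtain \<Psi> p' where p': "symbol sc T b \<Psi> p'" "degree p' = s - 1" "p' \<noteq> 0" "\<Psi> (v 0) = v (s - 1)"
        using less[of "s - 1"] Suc less_Suc_eq_le[of "s - 1" s] diff_le_self[of s 1] by blast
      \<comment> \<open>Solving the relation for \<open>v (Suc s)\<close>.\<close>
      define P where "P = pCons 0 p + (smult (- l s) (smult b p) + smult (- c s) p')"
      have "degree (smult (- l s) (smult b p) + smult (- c s) p') < degree (pCons 0 p)"
        using p(2,3) p'(2) by (intro degree_add_less) auto
      then have "degree P = r" using p(2,3) Suc by (simp add: P_def degree_add_eq_left)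
      moreover have "P \<noteq> 0" using \<open>degree P = r\<close> Suc by auto
      moreover have "symbol sc T b
          (\<lambda>x. \<Phi> x * T + (sc (- l s) (T * \<Phi> x) + sc (- c s) (\<Psi> x))) P"
        unfolding P_def using p(1) p'(1) by (intro symbol.intros)
      moreover have "v s * T + (sc (- l s) (T * v s) + sc (- c s) (v (s - 1))) = v r"
        using rec[of s] Suc by simp
      ultimately show ?thesis using p(4) p'(4) by metis
    qed
  qed
  from this[of N] show ?thesis using \<open>v N = 0\<close> unfolding torsion_def by metis
qed

lemma torsion_affine:
  assumes "x * T = sc c (T * x) + sc c' x" shows "torsion sc T b x"
proof (rule torsion_three_term[where v = "\<lambda>r. if r = 0 then x else 0" and l = "\<lambda>_. c"
      and c = "\<lambda>r. if r = 0 then c' else 0" and N = 1, simplified])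
qed (use assms in auto)

text \<open>The defining property of the symbol: a functional for which left multiplication by \<open>T\<close> is \<open>b\<close>
  and right multiplication by \<open>T\<close> is \<open>t\<close> sees an operator as the value of its symbol at \<open>t\<close>.\<close>

lemma symbol_functional:
  assumes "symbol sc T b \<Phi> p" and A: "subalgebra sc A" "T \<in> A"
    and F_add: "\<And>x y. x \<in> A \<Longrightarrow> y \<in> A \<Longrightarrow> F (x + y) = F x + F y"
    and F_scale: "\<And>c x. x \<in> A \<Longrightarrow> F (sc c x) = c * F x"
    and F_left: "\<And>x. x \<in> A \<Longrightarrow> F (T * x) = b * F x"
    and F_right: "\<And>x. x \<in> A \<Longrightarrow> F (x * T) = t * F x"
    and "x \<in> A"
  shows "\<Phi> x \<in> A \<and> F (\<Phi> x) = poly p t * F x"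
proof -
  have subspace: "subspace A" using A(1) by (simp add: subalgebra_def)
  show ?thesis using assms(1)
  proof (induction)
    case ident then show ?case using \<open>x \<in> A\<close> by simp
  next
    case (left \<Phi> p) then show ?case using A F_left by (simp add: subalgebra_def)
  next
    case (right \<Phi> p) then show ?case using A F_right by (simp add: subalgebra_def)
  next
    case (add \<Phi> p \<Psi> p') then show ?case using F_add subspace by (simp add: subspace_add distrib_right)
  next
    case (scale \<Phi> p c) then show ?case using F_scale subspace by (simp add: subspace_scale)
  qed
qed

end

section \<open>Strings for quantum \<open>sl\<^sub>2\<close>\<close>

definition qbinom :: "'k::field \<Rightarrow> nat \<Rightarrow> nat \<Rightarrow> 'k" where
  "qbinom p N r = (if r \<le> N then qfact p N / (qfact p r * qfact p (N - r)) else 0)"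

lemma qint_nonzero:
  assumes "p \<noteq> 0" "\<And>n. n > 0 \<Longrightarrow> p ^ n \<noteq> 1" "n > 0"
  shows "qint (p::'k::field) n \<noteq> 0"
proof
  assume "qint p n = 0"
  moreover have "p - inverse p \<noteq> 0"
    using assms(1) assms(2)[of 2] by (auto simp: field_simps power2_eq_square)
  ultimately have "p ^ n = inverse p ^ n" by (simp add: qint_def)
  then have "p ^ n * p ^ n = 1" using assms(1) by (simp add: field_simps)
  then have "p ^ (n + n) = 1" by (simp add: power_add)
  then show False using assms(2)[of "n + n"] assms(3) by simp
qed

lemma qfact_nonzero:
  assumes "p \<noteq> 0" "\<And>n. n > 0 \<Longrightarrow> p ^ n \<noteq> 1"
  shows "qfact (p::'k::field) n \<noteq> 0"
  using qint_nonzero[OF assms] by (simp add: qfact_def)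

lemma qfact_Suc: "qfact p (Suc n) = qint p (Suc n) * qfact p n"
  by (simp add: qfact_def)

lemma qint_add:
  assumes "(p::'k::field) \<noteq> 0"
  shows "qint p (m + n) = p ^ m * qint p n + inverse p ^ n * qint p m"
  using assms by (simp add: qint_def add_divide_distrib [symmetric] diff_divide_distrib [symmetric] power_add algebra_simps)

text \<open>This is \<open>[k + (r + 1)] = p\<^sup>r\<^sup>+\<^sup>1 [k] + p\<^sup>-\<^sup>k [r + 1]\<close>, multiplied by factorials.\<close>

lemma qbinom_Pascal:
  assumes p: "(p::'k::field) \<noteq> 0" "\<And>n. n > 0 \<Longrightarrow> p ^ n \<noteq> 1" and "Suc r \<le> N"
  shows "qbinom p (Suc N) (Suc r)
       = p ^ Suc r * qbinom p N (Suc r) + inverse p ^ (N - r) * qbinom p N r"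
proof -
  obtain k where k: "N = Suc r + k" using assms(3) le_Suc_ex by blast
  have 1: "N - r = Suc k" "N - Suc r = k" "Suc N - Suc r = Suc k" using k by auto
  have nz: "qfact p n \<noteq> 0" for n by (rule qfact_nonzero[OF p])
  have nz': "qint p (Suc n) \<noteq> 0" for n by (rule qint_nonzero[OF p]) auto
  have "qint p (Suc N) = p ^ Suc r * qint p (Suc k) + inverse p ^ Suc k * qint p (Suc r)"
    using qint_add[OF p(1), of "Suc r" "Suc k"] by (simp add: k)
  then have "qbinom p (Suc N) (Suc r) =
     (p ^ Suc r * qint p (Suc k) + inverse p ^ Suc k * qint p (Suc r)) * qfact p N
       / (qint p (Suc r) * qfact p r * (qint p (Suc k) * qfact p k))"
    using assms(3) by (simp add: qbinom_def 1 qfact_Suc)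
  also have "\<dots> = p ^ Suc r * (qfact p N / (qint p (Suc r) * qfact p r * qfact p k))
      + inverse p ^ Suc k * (qfact p N / (qfact p r * (qint p (Suc k) * qfact p k)))"
    using nz[of r] nz[of k] nz'[of r] nz'[of k] by (simp add: divide_simps) (simp add: algebra_simps)
  finally show ?thesis using assms(3) by (simp add: qbinom_def 1 qfact_Suc)
qed

lemma qbinom_0: "p \<noteq> 0 \<Longrightarrow> (\<And>n. n > 0 \<Longrightarrow> p ^ n \<noteq> 1) \<Longrightarrow> qbinom (p::'k::field) N 0 = 1"
  and qbinom_self: "p \<noteq> 0 \<Longrightarrow> (\<And>n. n > 0 \<Longrightarrow> p ^ n \<noteq> 1) \<Longrightarrow> qbinom (p::'k::field) N N = 1"
  using qfact_nonzero[of p] by (simp_all add: qbinom_def) (simp_all add: qfact_def)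

context algebra begin

text \<open>The q-binomial theorem: if \<open>L\<close> and \<open>R\<close> commute, the product of the factors \<open>R - p\<^sup>n\<^sup>-\<^sup>2\<^sup>s L\<close>
  for \<open>s < N\<close> has q-binomial coefficients up to powers of \<open>p\<close>.\<close>

lemma iterated_qcommutator:
  assumes p: "p \<noteq> 0" "\<And>n. n > 0 \<Longrightarrow> p ^ n \<noteq> (1::'k)"
    and R_add: "\<And>x y. R (x + y) = R x + R y" and R_scale: "\<And>c x. R (sc c x) = sc c (R x)"
    and L_add: "\<And>x y. L (x + y) = L x + L y" and L_scale: "\<And>c x. L (sc c x) = sc c (L x)"
    and comm: "\<And>x. L (R x) = R (L x)"
    and v: "\<And>r. v (Suc r) = R (v r) - sc (p powi (n - 2 * int r)) (L (v r))"
  shows "v N = (\<Sum>r\<le>N. sc ((-1) ^ r * p powi (int r * (n + 1 - int N)) * qbinom p N r)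
                  ((R ^^ (N - r)) ((L ^^ r) (v 0))))"
proof (induction N)
  case 0 then show ?case by (simp add: qbinom_0[OF p])
next
  case (Suc N)
  define w where "w r = (R ^^ (Suc N - r)) ((L ^^ r) (v 0))" for r
  define g where "g N r = (-1) ^ r * p powi (int r * (n + 1 - int N)) * qbinom p N r" for N r
  have R_sum: "R (\<Sum>r\<in>S. f r) = (\<Sum>r\<in>S. R (f r))" for S :: "nat set" and f
    using R_scale[of 0 0] by (induction S rule: infinite_finite_induct) (simp_all add: R_add)
  have L_sum: "L (\<Sum>r\<in>S. f r) = (\<Sum>r\<in>S. L (f r))" for S :: "nat set" and f
    using L_scale[of 0 0] by (induction S rule: infinite_finite_induct) (simp_all add: L_add)
  have LR: "L ((R ^^ k) x) = (R ^^ k) (L x)" for k x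
    by (induction k) (simp_all add: comm)
  have IH: "v N = (\<Sum>r\<le>N. sc (g N r) ((R ^^ (N - r)) ((L ^^ r) (v 0))))"
    using Suc.IH by (simp add: g_def)
  have R_part: "R (v N) = (\<Sum>r\<le>N. sc (g N r) (w r))"
    unfolding IH R_sum by (intro sum.cong refl) (simp add: R_scale w_def Suc_diff_le)
  have "L (v N) = (\<Sum>r\<le>N. sc (g N r) (w (Suc r)))"
    unfolding IH L_sum by (intro sum.cong refl) (simp add: L_scale w_def LR)
  then have L_part: "sc (p powi (n - 2 * int N)) (L (v N))
      = (\<Sum>r\<le>N. sc (p powi (n - 2 * int N) * g N r) (w (Suc r)))"
    by (simp add: scale_sum_right)
  have g_0: "g M 0 = 1" for M by (simp add: g_def qbinom_0[OF p])
  have g_top: "g (Suc N) (Suc N) = - (p powi (n - 2 * int N) * g N N)"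
    by (simp add: g_def qbinom_self[OF p] flip: power_int_add[OF disjI1[OF p(1)]])
       (simp add: algebra_simps)
  have g_Suc: "g (Suc N) (Suc r) = g N (Suc r) - p powi (n - 2 * int N) * g N r" if "r < N" for r
  proof -
    let ?q = "p powi (int (Suc r) * (n + 1 - int (Suc N)))"
    have 1: "?q * p ^ Suc r = p powi (int (Suc r) * (n + 1 - int N))"
      using p(1) by (simp flip: power_int_of_nat power_int_add[OF disjI1[OF p(1)]] del: power_Suc of_nat_Suc)
        (simp add: algebra_simps)
    have "inverse p ^ (N - r) = p powi (- int (N - r))" by (simp add: power_int_minus power_inverse)
    then have 2: "?q * inverse p ^ (N - r) = p powi (n - 2 * int N) * p powi (int r * (n + 1 - int N))"
      using that by (simp add: of_nat_diff flip: power_int_add[OF disjI1[OF p(1)]] del: power_Suc)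
        (simp add: algebra_simps)
    have "g (Suc N) (Suc r) = (-1) ^ Suc r * (?q * p ^ Suc r * qbinom p N (Suc r)
        + ?q * inverse p ^ (N - r) * qbinom p N r)"
      unfolding g_def using that by (subst qbinom_Pascal[OF p]) (simp_all add: algebra_simps)
    then show ?thesis unfolding 1 2 by (simp add: g_def algebra_simps)
  qed
  have "v (Suc N) = (\<Sum>r\<le>N. sc (g N r) (w r))
      - (\<Sum>r\<le>N. sc (p powi (n - 2 * int N) * g N r) (w (Suc r)))"
    unfolding v[of N] R_part L_part ..
  also have "\<dots> = w 0 + (\<Sum>r<N. sc (g N (Suc r)) (w (Suc r)))
      - ((\<Sum>r<N. sc (p powi (n - 2 * int N) * g N r) (w (Suc r)))
         + sc (p powi (n - 2 * int N) * g N N) (w (Suc N)))"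
    by (subst sum.atMost_shift) (simp add: g_0 flip: lessThan_Suc_atMost)
  also have "\<dots> = w 0 + (\<Sum>r<N. sc (g (Suc N) (Suc r)) (w (Suc r))) + sc (g (Suc N) (Suc N)) (w (Suc N))"
    unfolding g_top by (simp add: g_Suc scale_left_diff_distrib sum_subtractf)
  also have "\<dots> = (\<Sum>r\<le>Suc N. sc (g (Suc N) r) (w r))"
    unfolding sum.atMost_shift[of _ "Suc N"] by (simp add: g_0)
  finally show ?case by (simp add: g_def w_def)
qed

text \<open>For \<open>N = n + 1\<close> the weights \<open>n - 2s\<close> are symmetric about 0 and the additional powers of \<open>p\<close>
  disappear: the iterated commutator is the expression in the quantum Serre relation.\<close>

lemma iterated_qcommutator_eq_0:
  assumes p: "p \<noteq> 0" "\<And>n. n > 0 \<Longrightarrow> p ^ n \<noteq> (1::'k)"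
    and "\<And>x y. R (x + y) = R x + R y" "\<And>c x. R (sc c x) = sc c (R x)"
    and "\<And>x y. L (x + y) = L x + L y" "\<And>c x. L (sc c x) = sc c (L x)"
    and "\<And>x. L (R x) = R (L x)"
    and "\<And>r. v (Suc r) = R (v r) - sc (p powi (int n - 2 * int r)) (L (v r))"
    and serre: "(\<Sum>r\<le>Suc n. sc ((-1) ^ r / (qfact p r * qfact p (Suc n - r)))
                  ((R ^^ (Suc n - r)) ((L ^^ r) (v 0)))) = 0"
  shows "v (Suc n) = 0"
proof -
  have "v (Suc n) = (\<Sum>r\<le>Suc n. sc ((-1) ^ r * p powi (int r * (int n + 1 - int (Suc n))) * qbinom p (Suc n) r)
                  ((R ^^ (Suc n - r)) ((L ^^ r) (v 0))))"
    by (rule iterated_qcommutator[OF assms(1-8)])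
  also have "\<dots> = sc (qfact p (Suc n)) (\<Sum>r\<le>Suc n. sc ((-1) ^ r / (qfact p r * qfact p (Suc n - r)))
                  ((R ^^ (Suc n - r)) ((L ^^ r) (v 0))))"
    unfolding scale_sum_right by (intro sum.cong refl) (simp add: qbinom_def)
  finally show ?thesis using serre by simp
qed

text \<open>The vectors \<open>v r\<close> form a string for the adjoint action of quantum \<open>sl\<^sub>2\<close>: \<open>X\<close> lowers,
  \<open>Y\<close> raises, and \<open>v r\<close> has weight \<open>n - 2r\<close>.  Right multiplication by \<open>X + Y\<close> differs from left
  multiplication, twisted by \<open>K\<close>, by the sum of the two adjoint actions.\<close>

lemma torsion_string:
  assumes p: "p \<noteq> 0"
    and K: "K * K' = 1" "K' * K = 1"
    and KX: "K * X = sc (p powi (-2)) (X * K)" and KY: "K * Y = sc (p powi 2) (Y * K)"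
    and YX: "Y * X = sc (p powi 2) (X * Y) + sc c (1 - K' * K')"
    and Kv: "K * v 0 = sc (p powi n) (v 0 * K)"
    and vY: "v 0 * Y = sc (p powi n) (Y * v 0)"
    and v: "\<And>r. v (Suc r) = v r * X - sc (p powi (n - 2 * int r)) (X * v r)"
    and "v N = 0"
  shows "torsion sc (X + Y) b (v 0)"
proof -
  define m where "m r = n - 2 * int r" for r
  have add: "p powi (a + a') = p powi a * p powi a'" for a a'
    using p by (simp add: power_int_add)
  have vS: "v (Suc r) = v r * X - sc (p powi m r) (X * v r)" for r
    using v by (simp add: m_def)
  have Kvr: "K * v r = sc (p powi m r) (v r * K)" for r
  proof (induction r)
    case 0 then show ?case using Kv by (simp add: m_def)
  next
    case (Suc r)
    have mS: "p powi m (Suc r) = p powi m r * p powi (-2)"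
      by (simp add: m_def algebra_simps flip: add)
    have 1: "K * (v r * X) = sc (p powi m (Suc r)) (v r * X * K)"
    proof -
      have "K * (v r * X) = sc (p powi m r) (v r * (K * X))"
        using Suc by (simp flip: mult.assoc)
      also have "\<dots> = sc (p powi m (Suc r)) (v r * X * K)"
        unfolding KX by (simp add: mult.assoc mS)
      finally show ?thesis .
    qed
    have 2: "K * (X * v r) = sc (p powi m (Suc r)) (X * v r * K)"
    proof -
      have "K * (X * v r) = sc (p powi (-2)) (X * (K * v r))"
        using KX by (simp flip: mult.assoc)
      also have "\<dots> = sc (p powi m (Suc r)) (X * v r * K)"
        unfolding Suc by (simp add: mult.assoc mS mult.commute)
      finally show ?thesis .
    qed
    show ?case unfolding vS[of r] right_diff_distrib left_diff_distrib scale_mult_right scale_mult_left 1 2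
      by (simp add: scale_right_diff_distrib mult.commute)
  qed
  have K'vr: "K' * v r = sc (p powi (- m r)) (v r * K')" for r
  proof -
    have "v r = sc (p powi (- m r)) (K * v r * K')"
      unfolding Kvr using p by (simp add: mult.assoc K flip: add)
    then have "K' * v r = sc (p powi (- m r)) (K' * (K * (v r * K')))"
      by (metis mult.assoc scale_mult_right)
    also have "\<dots> = sc (p powi (- m r)) (v r * K')" by (simp add: K flip: mult.assoc)
    finally show ?thesis .
  qed
  have XY: "X * Y = sc (p powi (-2)) (Y * X) - sc (p powi (-2) * c) (1 - K' * K')"
  proof -
    have "p powi (-2) * p powi 2 = 1" by (simp only: add[symmetric]) simp
    then show ?thesis unfolding YX by (simp only: scale_right_distrib scale_scale) simp
  qed
  \<comment> \<open>The scalars by which \<open>Y\<close> moves \<open>v r\<close> back to \<open>v (r - 1)\<close>; the recursion is the one in the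
    proof that \<open>[E, F\<^sup>r]\<close> acts on a highest weight vector by a scalar times \<open>F\<^sup>r\<^sup>-\<^sup>1\<close>.\<close>
  define d where "d = rec_nat 0 (\<lambda>r dr. p powi (-2) * (dr + c * (p powi (2 * m r) - 1)))"
  have d_Suc: "d (Suc r) = p powi (-2) * (d r + c * (p powi (2 * m r) - 1))" for r by (simp add: d_def)
  have vYr: "v r * Y = sc (p powi m r) (Y * v r) + sc (d r) (v (r - 1))" for r
  proof (induction r)
    case 0 then show ?case using vY by (simp add: d_def m_def)
  next
    case (Suc r)
    let ?a = "p powi m r" and ?i = "p powi (-2)"
    \<comment> \<open>The contribution of \<open>v (r - 1)\<close> is moved back up to \<open>v r\<close> by \<open>X\<close>; for \<open>r = 0\<close> it vanishes
      because \<open>d 0 = 0\<close>.\<close>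
    have lower: "sc (d r) (v (r - 1) * X) - sc (d r * ?a * p powi 2) (X * v (r - 1)) = sc (d r) (v r)"
    proof (cases r)
      case 0 then show ?thesis by (simp add: d_def)
    next
      case (Suc s)
      have "?a * p powi 2 = p powi m s" by (simp only: m_def add[symmetric]) (simp add: Suc)
      then show ?thesis using Suc vS[of s] by (simp add: scale_right_diff_distrib mult.assoc)
    qed
    have K2: "K' * K' * v r = sc (p powi (- 2 * m r)) (v r * (K' * K'))"
    proof -
      have "K' * K' * v r = K' * (K' * v r)" by (simp only: mult.assoc)
      also have "\<dots> = sc (p powi (- m r)) (K' * v r * K')"
        by (subst K'vr[of r]) (simp only: scale_mult_right mult.assoc)
      also have "\<dots> = sc (p powi (- m r) * p powi (- m r)) (v r * (K' * K'))"
        by (simp only: K'vr[of r] scale_mult_left scale_scale) (simp only: mult.assoc)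
      also have "p powi (- m r) * p powi (- m r) = p powi (- 2 * m r)" by (simp only: add[symmetric]) simp
      finally show ?thesis .
    qed
    \<comment> \<open>\<open>K\<^sup>-\<^sup>2\<close> has the same effect on both sides of \<open>v r\<close> up to the factor that cancels here; so the
      result is a multiple of \<open>v r\<close> without \<open>K\<close>.\<close>
    have mid: "sc (?a * ?a) ((1 - K' * K') * v r) - v r * (1 - K' * K') = sc (p powi (2 * m r) - 1) (v r)"
    proof -
      have "?a * ?a * p powi (- 2 * m r) = 1" "?a * ?a = p powi (2 * m r)" by (simp_all only: add[symmetric]) simp_all
      then show ?thesis unfolding left_diff_distrib right_diff_distrib K2
        by (simp add: scale_left_diff_distrib scale_right_diff_distrib)
    qed
    have vXY: "v r * X * Y = sc (?i * ?a) (Y * v r * X) + sc (?i * d r) (v (r - 1) * X)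
        - sc (?i * c) (v r * (1 - K' * K'))"
    proof -
      have "v r * X * Y = sc ?i (v r * Y * X) - sc (?i * c) (v r * (1 - K' * K'))"
        unfolding mult.assoc XY by (simp add: right_diff_distrib scale_right_diff_distrib)
      then show ?thesis unfolding Suc
        by (simp add: distrib_right scale_right_distrib mult.assoc)
    qed
    have XvY: "X * v r * Y = sc (?i * ?a) (Y * X * v r) - sc (?a * ?i * c) ((1 - K' * K') * v r)
        + sc (d r) (X * v (r - 1))"
    proof -
      have "X * v r * Y = sc ?a (X * Y * v r) + sc (d r) (X * v (r - 1))"
        unfolding mult.assoc Suc by (simp add: distrib_left)
      then show ?thesis unfolding XY
        by (simp add: left_diff_distrib scale_right_diff_distrib ac_simps)
    qed
    have i2: "?i * p powi 2 = 1" by (simp only: add[symmetric]) simp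
    have "v (Suc r) * Y = sc (?i * ?a) (Y * v r * X) - sc (?i * ?a * ?a) (Y * X * v r)
      + sc ?i (sc (d r) (v (r - 1) * X) - sc (d r * ?a * p powi 2) (X * v (r - 1)))
      + sc (?i * c) (sc (?a * ?a) ((1 - K' * K') * v r) - v r * (1 - K' * K'))"
    proof -
      have e: "sc (?a * d r) z = sc ?i (sc (d r * ?a * p powi 2) z)" for z
        using i2 by (simp add: ac_simps)
      show ?thesis
        unfolding vS[of r] left_diff_distrib scale_mult_left vXY XvY scale_right_diff_distrib
          scale_right_distrib scale_scale e
        by (simp add: algebra_simps)
    qed
    also have "\<dots> = sc (?i * ?a) (Y * v (Suc r)) + sc (d (Suc r)) (v r)"
      unfolding lower mid d_Suc vS[of r]
      by (simp add: scale_right_diff_distrib right_diff_distrib scale_left_distrib mult.assoc distrib_left)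
    also have "?i * ?a = p powi m (Suc r)"
      by (simp only: m_def add[symmetric]) (simp add: algebra_simps)
    finally show ?case by simp
  qed
  show ?thesis
  proof (rule torsion_three_term[where l = "\<lambda>r. p powi m r" and c = d and N = N])
    fix r
    show "v r * (X + Y) = sc (p powi m r) ((X + Y) * v r) + v (Suc r) + sc (d r) (v (r - 1))"
      unfolding distrib_left vYr vS[of r] by (simp add: distrib_right scale_right_distrib)
  qed fact
qed

end

section \<open>Duality for weight modules\<close>

lemma vector_space_functions: "vector_space (\<lambda>c (f :: 'm \<Rightarrow> 'k::field) m. c * f m)"
  by unfold_locales (auto simp: fun_eq_iff algebra_simps)

lemma sum_fun_apply: "(\<Sum>a\<in>F. g a) x = (\<Sum>a\<in>F. g a x)"
  by (induction F rule: infinite_finite_induct) simp_all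

lemma subalgebra_generated:
  assumes "is_algebra sc"
  shows "subalgebra sc (generated_subalgebra sc G)"
proof -
  interpret algebra sc by unfold_locales fact
  show ?thesis unfolding subalgebra_def generated_subalgebra_def
    by (auto intro!: subspace_Inter)
qed

lemma generated_subalgebra_base: "x \<in> G \<Longrightarrow> x \<in> generated_subalgebra sc G"
  by (auto simp: generated_subalgebra_def)

lemma generated_subalgebra_minimal: "subalgebra sc A \<Longrightarrow> G \<subseteq> A \<Longrightarrow> generated_subalgebra sc G \<subseteq> A"
  by (auto simp: generated_subalgebra_def)

text \<open>The situation abstracted from \<open>\<imath>\<close>quantum groups: an algebra generated by \<open>G\<close> with an
  anti-endomorphism \<open>S\<close>, elements \<open>t i\<close> whose eigenvalues are to lie in \<open>P\<close>, and an involution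
  \<open>star i\<close> of \<open>P\<close>.  The assumption \<open>S_t\<close> says, without mentioning modules, that \<open>S (t i)\<close> acts by
  \<open>star i c\<close> wherever \<open>t i\<close> acts by \<open>c\<close>.\<close>

locale weight_duality = algebra sc for sc :: "'k::field \<Rightarrow> 'u::ring_1 \<Rightarrow> 'u" +
  fixes G :: "'u set" and S :: "'u \<Rightarrow> 'u" and t :: "'i::finite \<Rightarrow> 'u"
    and P :: "'k set" and star :: "'i \<Rightarrow> 'k \<Rightarrow> 'k"
  assumes S_closed: "x \<in> generated_subalgebra sc G \<Longrightarrow> S x \<in> generated_subalgebra sc G"
    and S_add: "x \<in> generated_subalgebra sc G \<Longrightarrow> y \<in> generated_subalgebra sc G \<Longrightarrow> S (x + y) = S x + S y"
    and S_mult: "x \<in> generated_subalgebra sc G \<Longrightarrow> y \<in> generated_subalgebra sc G \<Longrightarrow> S (x * y) = S y * S x"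
    and S_scale: "x \<in> generated_subalgebra sc G \<Longrightarrow> S (sc c x) = sc c (S x)"
    and S_one: "S 1 = 1"
    and t_closed: "t i \<in> generated_subalgebra sc G"
    and star_closed: "c \<in> P \<Longrightarrow> star i c \<in> P"
    and star_star: "c \<in> P \<Longrightarrow> star i (star i c) = c"
    and S_t: "c \<in> P \<Longrightarrow> \<exists>y\<in>generated_subalgebra sc G. S (t i) - sc (star i c) 1 = y * (t i - sc c 1)"
    and gen_torsion: "x \<in> G \<Longrightarrow> torsion sc (t i) b x"
begin

abbreviation "A \<equiv> generated_subalgebra sc G"

lemma A_subalgebra: "subalgebra sc A"
  by (rule subalgebra_generated[OF is_algebra])

lemma A_closed:
  "1 \<in> A" "x \<in> A \<Longrightarrow> y \<in> A \<Longrightarrow> x + y \<in> A" "x \<in> A \<Longrightarrow> y \<in> A \<Longrightarrow> x - y \<in> A"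
  "x \<in> A \<Longrightarrow> y \<in> A \<Longrightarrow> x * y \<in> A" "x \<in> A \<Longrightarrow> sc c x \<in> A"
  using A_subalgebra subspace_add subspace_diff subspace_scale by (auto simp: subalgebra_def)

definition weights :: "('i \<Rightarrow> 'k) set" where
  "weights = {a. \<forall>i. a i \<in> P}"

definition wspace :: "('k, 'u, 'm::ab_group_add) umodule \<Rightarrow> ('i \<Rightarrow> 'k) \<Rightarrow> 'm set" where
  "wspace M a = {m \<in> mcarrier M. \<forall>i. mact M (t i) m = mscale M (a i) m}"

definition weight_module :: "('k, 'u, 'm::ab_group_add) umodule \<Rightarrow> bool" where
  "weight_module M \<longleftrightarrow> is_module sc A M \<and>
     module.span (mscale M) (\<Union>a\<in>weights. wspace M a) = mcarrier M \<and>
     (\<forall>a\<in>weights. finite_dimensional (mscale M) (wspace M a))"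

definition functional :: "('k, 'u, 'm::ab_group_add) umodule \<Rightarrow> ('m \<Rightarrow> 'k) \<Rightarrow> bool" where
  "functional M f \<longleftrightarrow>
     (\<forall>m\<in>mcarrier M. \<forall>m'\<in>mcarrier M. f (m + m') = f m + f m') \<and>
     (\<forall>c. \<forall>m\<in>mcarrier M. f (mscale M c m) = c * f m) \<and>
     (\<forall>m. m \<notin> mcarrier M \<longrightarrow> f m = 0)"

definition supp :: "('k, 'u, 'm::ab_group_add) umodule \<Rightarrow> ('m \<Rightarrow> 'k) \<Rightarrow> ('i \<Rightarrow> 'k) set" where
  "supp M f = {a \<in> weights. \<exists>m\<in>wspace M a. f m \<noteq> 0}"

definition precomp :: "('k, 'u, 'm::ab_group_add) umodule \<Rightarrow> 'u \<Rightarrow> ('m \<Rightarrow> 'k) \<Rightarrow> 'm \<Rightarrow> 'k" where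
  "precomp M x f m = (if m \<in> mcarrier M then f (mact M x m) else 0)"

definition dual :: "('k, 'u, 'm::ab_group_add) umodule \<Rightarrow> ('k, 'u, 'm \<Rightarrow> 'k) umodule" where
  "dual M = \<lparr>mcarrier = {f. functional M f \<and> finite (supp M f)},
     mscale = (\<lambda>c f m. c * f m), mact = (\<lambda>x. precomp M (S x))\<rparr>"

definition pure :: "('k, 'u, 'm::ab_group_add) umodule \<Rightarrow> ('i \<Rightarrow> 'k) \<Rightarrow> ('m \<Rightarrow> 'k) set" where
  "pure M a = {f. functional M f \<and> supp M f \<subseteq> {a}}"

context
  fixes M :: "('k, 'u, 'm::ab_group_add) umodule"
  assumes M: "is_module sc A M"
begin

interpretation V: vector_space "mscale M"
  using M by (simp add: is_module_def)

lemma carrier_subspace: "V.subspace (mcarrier M)"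
  using M by (simp add: is_module_def)

lemma act:
  "x \<in> A \<Longrightarrow> m \<in> mcarrier M \<Longrightarrow> mact M x m \<in> mcarrier M"
  "x \<in> A \<Longrightarrow> m \<in> mcarrier M \<Longrightarrow> m' \<in> mcarrier M \<Longrightarrow> mact M x (m + m') = mact M x m + mact M x m'"
  "x \<in> A \<Longrightarrow> m \<in> mcarrier M \<Longrightarrow> mact M x (mscale M c m) = mscale M c (mact M x m)"
  "x \<in> A \<Longrightarrow> y \<in> A \<Longrightarrow> m \<in> mcarrier M \<Longrightarrow> mact M (x + y) m = mact M x m + mact M y m"
  "x \<in> A \<Longrightarrow> m \<in> mcarrier M \<Longrightarrow> mact M (sc c x) m = mscale M c (mact M x m)"
  "x \<in> A \<Longrightarrow> y \<in> A \<Longrightarrow> m \<in> mcarrier M \<Longrightarrow> mact M (x * y) m = mact M x (mact M y m)"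
  "m \<in> mcarrier M \<Longrightarrow> mact M 1 m = m"
  using M by (simp_all add: is_module_def)

lemma act_diff:
  assumes "x \<in> A" "y \<in> A" "m \<in> mcarrier M"
  shows "mact M (x - y) m = mact M x m - mact M y m"
proof -
  have "mact M (x - y + y) m = mact M (x - y) m + mact M y m"
    using assms by (intro act A_closed)
  then show ?thesis by (simp add: algebra_simps)
qed

lemma act_zero: "x \<in> A \<Longrightarrow> mact M x 0 = 0"
  using act(3)[of x 0 0] V.subspace_0[OF carrier_subspace] by simp

lemma carrier_closed:
  "0 \<in> mcarrier M" "m \<in> mcarrier M \<Longrightarrow> m' \<in> mcarrier M \<Longrightarrow> m + m' \<in> mcarrier M"
  "m \<in> mcarrier M \<Longrightarrow> m' \<in> mcarrier M \<Longrightarrow> m - m' \<in> mcarrier M"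
  "m \<in> mcarrier M \<Longrightarrow> mscale M c m \<in> mcarrier M"
  using carrier_subspace V.subspace_0 V.subspace_add V.subspace_diff V.subspace_scale by auto

lemma wspaceD: "m \<in> wspace M a \<Longrightarrow> m \<in> mcarrier M" "m \<in> wspace M a \<Longrightarrow> mact M (t i) m = mscale M (a i) m"
  by (simp_all add: wspace_def)

lemma wspace_subspace: "V.subspace (wspace M a)"
  by (rule V.subspaceI)
     (auto simp: wspace_def carrier_closed act t_closed act_zero V.scale_right_distrib mult.commute)

text \<open>Lagrange interpolation in the \<open>t i\<close> produces an element that acts as the projection to one of
  finitely many weight spaces, while still acting by some scalar on every other weight space.  In this
  way components of vectors and of functionals are obtained inside the module.\<close>

lemma interpolation:
  assumes "finite F"
  shows "\<exists>e\<in>A. \<exists>s. s a = 1 \<and> (\<forall>b\<in>F. b \<noteq> a \<longrightarrow> s b = 0) \<and>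
           (\<forall>b. \<forall>m\<in>wspace M b. mact M e m = mscale M (s b) m)"
  using assms
proof (induction F)
  case empty
  show ?case by (intro bexI[of _ 1] exI[of _ "\<lambda>_. 1"]) (auto simp: A_closed act wspaceD)
next
  case (insert b F)
  then obtain e s where es: "e \<in> A" "s a = 1" "\<forall>b\<in>F. b \<noteq> a \<longrightarrow> s b = 0"
      "\<forall>b. \<forall>m\<in>wspace M b. mact M e m = mscale M (s b) m" by blast
  show ?case
  proof (cases "b = a")
    case True then show ?thesis using es by blast
  next
    case False
    then obtain i where i: "b i \<noteq> a i" by blast
    define e' where "e' = sc (inverse (a i - b i)) (e * (t i - sc (b i) 1))"
    define s' where "s' d = inverse (a i - b i) * (s d * (d i - b i))" for d
    have e': "e' \<in> A" unfolding e'_def by (intro A_closed es(1) t_closed)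
    have "mact M e' m = mscale M (s' d) m" if m: "m \<in> wspace M d" for d m
    proof -
      have mc: "m \<in> mcarrier M" using m wspaceD by blast
      have "mact M (t i - sc (b i) 1) m = mact M (t i) m - mact M (sc (b i) 1) m"
        by (intro act_diff A_closed t_closed mc)
      also have "\<dots> = mscale M (d i - b i) m"
        using mc wspaceD(2)[OF m] by (simp add: act A_closed V.scale_left_diff_distrib)
      finally have 1: "mact M (t i - sc (b i) 1) m = mscale M (d i - b i) m" .
      have "mact M e' m = mscale M (inverse (a i - b i)) (mact M e (mact M (t i - sc (b i) 1) m))"
        unfolding e'_def using mc es(1) by (simp add: act A_closed t_closed)
      also have "\<dots> = mscale M (s' d) m"
        unfolding 1 using mc es(1,4) m by (simp add: act s'_def mult.commute mult.left_commute)
      finally show ?thesis .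
    qed
    moreover have "s' a = 1" using i es(2) by (simp add: s'_def)
    moreover have "\<forall>d\<in>insert b F. d \<noteq> a \<longrightarrow> s' d = 0" using es(3) by (simp add: s'_def)
    ultimately show ?thesis using e' by blast
  qed
qed

lemma functionalD:
  assumes "functional M f"
  shows "m \<in> mcarrier M \<Longrightarrow> m' \<in> mcarrier M \<Longrightarrow> f (m + m') = f m + f m'"
    "m \<in> mcarrier M \<Longrightarrow> f (mscale M c m) = c * f m" "m \<notin> mcarrier M \<Longrightarrow> f m = 0" "f 0 = 0"
proof -
  show f: "m \<in> mcarrier M \<Longrightarrow> m' \<in> mcarrier M \<Longrightarrow> f (m + m') = f m + f m'"
    "m \<in> mcarrier M \<Longrightarrow> f (mscale M c m) = c * f m" "m \<notin> mcarrier M \<Longrightarrow> f m = 0" for m m' c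
    using assms by (auto simp: functional_def)
  show "f 0 = 0" using f(2)[of 0 0] carrier_closed(1) by simp
qed

lemma functional_precomp: "functional M f \<Longrightarrow> x \<in> A \<Longrightarrow> functional M (precomp M x f)"
  unfolding functional_def[of _ "precomp _ _ _"] precomp_def
  by (auto simp: carrier_closed act functionalD)

lemma functional_sum:
  "(\<And>a. a \<in> F \<Longrightarrow> functional M (g a)) \<Longrightarrow> functional M (\<lambda>m. \<Sum>a\<in>F. g a m)"
  unfolding functional_def by (auto simp: sum.distrib sum_distrib_left)

lemma functional_add: "functional M f \<Longrightarrow> functional M g \<Longrightarrow> functional M (f + g)"
  and functional_scale: "functional M f \<Longrightarrow> functional M (\<lambda>m. c * f m)"
  by (auto simp: functional_def algebra_simps)

lemma supp_add: "supp M (f + g) \<subseteq> supp M f \<union> supp M g"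
  and supp_scale: "supp M (\<lambda>m. c * f m) \<subseteq> supp M f"
  by (auto simp: supp_def)

end

context
  fixes M :: "('k, 'u, 'm::ab_group_add) umodule"
  assumes M: "weight_module M"
begin

interpretation V: vector_space "mscale M"
  using M by (simp add: weight_module_def is_module_def)

lemma is_mod: "is_module sc A M" using M by (simp add: weight_module_def)

lemmas act' = act[OF is_mod]
lemmas carrier_closed' = carrier_closed[OF is_mod]
lemmas functionalD' = functionalD[OF is_mod]

lemma weight_vector_induct [consumes 1, case_names weight zero add scale]:
  assumes "m \<in> mcarrier M"
    and "\<And>a m. a \<in> weights \<Longrightarrow> m \<in> wspace M a \<Longrightarrow> Q m"
    and "Q 0" and "\<And>m m'. m \<in> mcarrier M \<Longrightarrow> m' \<in> mcarrier M \<Longrightarrow> Q m \<Longrightarrow> Q m' \<Longrightarrow> Q (m + m')"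
    and "\<And>c m. m \<in> mcarrier M \<Longrightarrow> Q m \<Longrightarrow> Q (mscale M c m)"
  shows "Q m"
proof -
  have "V.subspace {m \<in> mcarrier M. Q m}"
    by (rule V.subspaceI) (use assms carrier_closed' in auto)
  moreover have "(\<Union>a\<in>weights. wspace M a) \<subseteq> {m \<in> mcarrier M. Q m}"
    using assms(2) wspaceD[OF is_mod] by auto
  ultimately have "V.span (\<Union>a\<in>weights. wspace M a) \<subseteq> {m \<in> mcarrier M. Q m}"
    by (intro V.span_minimal)
  then show ?thesis using assms(1) M by (auto simp: weight_module_def)
qed

lemma functional_eqI:
  assumes "functional M f" "functional M g"
    and "\<And>a m. a \<in> weights \<Longrightarrow> m \<in> wspace M a \<Longrightarrow> f m = g m"
  shows "f = g"
proof
  fix m show "f m = g m"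
  proof (cases "m \<in> mcarrier M")
    case True then show ?thesis
      by (induction rule: weight_vector_induct)
         (use assms functionalD'[OF assms(1)] functionalD'[OF assms(2)] in auto)
  next
    case False then show ?thesis using functionalD'(3)[OF assms(1)] functionalD'(3)[OF assms(2)] by simp
  qed
qed

text \<open>Composing \<open>f\<close> with the interpolating element for \<open>a\<close> gives the component of \<open>f\<close> at \<open>a\<close>: on the
  weight spaces outside the support of \<open>f\<close>, where that element acts by an uncontrolled scalar, \<open>f\<close>
  vanishes anyway.\<close>

lemma functional_decomposition:
  assumes f: "functional M f" "finite (supp M f)"
  obtains g where "\<And>a. a \<in> supp M f \<Longrightarrow> g a \<in> pure M a" "f = (\<lambda>m. \<Sum>a\<in>supp M f. g a m)"
proof -
  have "\<exists>e s. e \<in> A \<and> s a = 1 \<and> (\<forall>b\<in>supp M f. b \<noteq> a \<longrightarrow> s b = 0) \<and>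
      (\<forall>b. \<forall>m\<in>wspace M b. mact M e m = mscale M (s b) m)" for a
    using interpolation[OF is_mod f(2), of a] by blast
  then obtain e s where es: "\<And>a. e a \<in> A" "\<And>a. s a a = (1::'k)"
      "\<And>a b. b \<in> supp M f \<Longrightarrow> b \<noteq> a \<Longrightarrow> s a b = 0"
      "\<And>a b m. m \<in> wspace M b \<Longrightarrow> mact M (e a) m = mscale M (s a b) m"
    by metis
  define g where "g a = precomp M (e a) f" for a
  have g: "functional M (g a)" for a unfolding g_def by (intro functional_precomp[OF is_mod] f es)
  have gm: "g a m = s a b * f m" if "m \<in> wspace M b" for a b m
    using that wspaceD[OF is_mod that] f es(4)[OF that] by (simp add: g_def precomp_def functionalD')
  have f0: "f m = 0" if "m \<in> wspace M b" "b \<in> weights" "b \<notin> supp M f" for m b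
    using that by (auto simp: supp_def)
  have "g a \<in> pure M a" if "a \<in> supp M f" for a
  proof -
    have "supp M (g a) \<subseteq> {a}" using gm es(3) f0 unfolding supp_def[of _ "g a"]
      by (auto, metis mult_eq_0_iff)
    then show ?thesis using g by (simp add: pure_def)
  qed
  moreover have "f = (\<lambda>m. \<Sum>a\<in>supp M f. g a m)"
  proof (rule functional_eqI[OF f(1) functional_sum[OF is_mod g]])
    fix b m assume b: "b \<in> weights" "m \<in> wspace M b"
    have "(\<Sum>a\<in>supp M f. g a m) = (\<Sum>a\<in>supp M f. if b = a then f m else 0)"
      using es(2,3) f0 b by (intro sum.cong refl) (cases "b \<in> supp M f", auto simp: gm[OF b(2)])
    also have "\<dots> = f m" using f(2) f0[OF b(2,1)] by simp
    finally show "f m = (\<Sum>a\<in>supp M f. g a m)" by simp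
  qed
  ultimately show ?thesis using that by blast
qed

lemma pure_eq_0:
  assumes "f \<in> pure M a" "m \<in> wspace M b" "b \<in> weights" "b \<noteq> a" shows "f m = 0"
  using assms by (auto simp: pure_def supp_def)

lemma pure_eigen:
  assumes f: "f \<in> pure M a" and m: "m \<in> mcarrier M"
  shows "f (mact M (t i) m) = a i * f m"
proof -
  have fl: "functional M f" using f by (simp add: pure_def)
  from m show ?thesis
  proof (induction rule: weight_vector_induct)
    case (weight b m)
    then show ?case using wspaceD[OF is_mod weight(2)] pure_eq_0[OF f weight(2,1)]
      by (cases "b = a") (simp_all add: functionalD'[OF fl])
  next
    case zero then show ?case by (simp add: act_zero[OF is_mod t_closed] functionalD'[OF fl])
  next
    case (add m m') then show ?case
      by (simp add: act' t_closed functionalD'[OF fl] distrib_left)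
  next
    case (scale c m) then show ?case
      by (simp add: act' t_closed functionalD'[OF fl])
  qed
qed

text \<open>If \<open>f\<close> is an eigenfunctional of \<open>t i\<close> with eigenvalue \<open>a i\<close> and \<open>x\<close> is annihilated by an
  operator with symbol \<open>p\<close>, then \<open>f \<circ> x\<close> can be nonzero on the weight space of weight \<open>b\<close> only if
  \<open>b i\<close> is a root of \<open>p\<close>.\<close>

lemma finite_supp_pure_generator:
  assumes f: "f \<in> pure M a" and x: "x \<in> G"
  shows "finite (supp M (precomp M x f))"
proof -
  have fl: "functional M f" using f by (simp add: pure_def)
  have xA: "x \<in> A" using x by (rule generated_subalgebra_base)
  have "\<exists>\<Phi> p. symbol sc (t i) (a i) \<Phi> p \<and> p \<noteq> 0 \<and> \<Phi> x = 0" for i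
    using gen_torsion[OF x, of i "a i"] by (simp add: torsion_def)
  then obtain \<Phi> p where p: "\<And>i. symbol sc (t i) (a i) (\<Phi> i) (p i)" "\<And>i. p i \<noteq> 0" "\<And>i. \<Phi> i x = 0"
    by metis
  have "supp M (precomp M x f) \<subseteq> {b. \<forall>i. b i \<in> {c. poly (p i) c = 0}}"
  proof (intro subsetI CollectI allI)
    fix b i assume "b \<in> supp M (precomp M x f)"
    then obtain m where m: "m \<in> wspace M b" "f (mact M x m) \<noteq> 0" "m \<in> mcarrier M"
      by (auto simp: supp_def precomp_def split: if_splits)
    have "\<Phi> i x \<in> A \<and> f (mact M (\<Phi> i x) m) = poly (p i) (b i) * f (mact M x m)"
      by (rule symbol_functional[OF p(1) A_subalgebra t_closed _ _ _ _ xA])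
         (use m(3) wspaceD(2)[OF is_mod m(1)] in
           \<open>simp_all add: act' t_closed functionalD'[OF fl] pure_eigen[OF f]\<close>)
    moreover have "mact M 0 m = 0" using act'(5)[OF A_closed(1) m(3), of 0] by simp
    ultimately show "poly (p i) (b i) = 0" using m(2) p(3)[of i] functionalD'(4)[OF fl] by simp
  qed
  moreover have "finite {b. \<forall>i. b i \<in> {c. poly (p i) c = 0}}"
    using finite_PiE[of UNIV "\<lambda>i. {c. poly (p i) c = 0}"] poly_roots_finite[OF p(2)]
    by (simp add: PiE_UNIV_domain Pi_def)
  ultimately show ?thesis by (rule finite_subset)
qed

text \<open>The elements \<open>x\<close> for which \<open>f \<mapsto> f \<circ> x\<close> preserves finite support form a subalgebra, so it is
  enough to consider generators, and by linearity functionals supported at one weight.\<close>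

lemma finite_supp_precomp:
  assumes "x \<in> A" "functional M f" "finite (supp M f)"
  shows "finite (supp M (precomp M x f))"
proof -
  let ?N = "{x \<in> A. \<forall>f. functional M f \<and> finite (supp M f) \<longrightarrow> finite (supp M (precomp M x f))}"
  have "subalgebra sc ?N"
    unfolding subalgebra_def
  proof (intro conjI subspaceI ballI CollectI allI impI)
    show "0 \<in> A" using subspace_0 A_subalgebra by (simp add: subalgebra_def)
    fix f assume f: "functional M f \<and> finite (supp M f)"
    have "mact M 0 m = 0" if "m \<in> mcarrier M" for m using act'(5)[OF A_closed(1) that, of 0] by simp
    then have "supp M (precomp M 0 f) = {}"
      using functionalD'(4) f by (auto simp: supp_def precomp_def)
    then show "finite (supp M (precomp M 0 f))" by simp
    have "supp M (precomp M 1 f) = supp M f"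
      using wspaceD[OF is_mod] by (auto simp: supp_def precomp_def act')
    then show "finite (supp M (precomp M 1 f))" using f by simp
  next
    fix x y assume xy: "x \<in> ?N" "y \<in> ?N"
    show "x + y \<in> A" "x * y \<in> A" using xy A_closed by auto
    fix f assume f: "functional M f \<and> finite (supp M f)"
    have "precomp M (x + y) f = precomp M x f + precomp M y f"
      using xy f by (auto simp: precomp_def fun_eq_iff act' functionalD')
    then show "finite (supp M (precomp M (x + y) f))"
      using finite_subset[OF supp_add[OF is_mod]] xy f by auto
    have "precomp M (x * y) f = precomp M y (precomp M x f)"
      using xy f by (auto simp: precomp_def fun_eq_iff act' functionalD')
    then show "finite (supp M (precomp M (x * y) f))"
      using xy f functional_precomp[OF is_mod, of f x] by auto
  next
    fix c x assume x: "x \<in> ?N"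
    show "sc c x \<in> A" using x A_closed by auto
    fix f assume f: "functional M f \<and> finite (supp M f)"
    have "precomp M (sc c x) f = (\<lambda>m. c * precomp M x f m)"
      using x f by (auto simp: precomp_def fun_eq_iff act' functionalD')
    then show "finite (supp M (precomp M (sc c x) f))"
      using finite_subset[OF supp_scale[OF is_mod, of c "precomp M x f"]] x f by auto
  qed (use A_closed in auto)
  moreover have "G \<subseteq> ?N"
  proof (intro subsetI CollectI conjI allI impI)
    fix x f assume x: "x \<in> G" and f: "functional M f \<and> finite (supp M f)"
    obtain g where g: "\<And>a. a \<in> supp M f \<Longrightarrow> g a \<in> pure M a" "f = (\<lambda>m. \<Sum>a\<in>supp M f. g a m)"
      using functional_decomposition f by blast
    have "precomp M x f m = (\<Sum>a\<in>supp M f. precomp M x (g a) m)" for m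
      unfolding precomp_def by (subst g(2)) simp
    then have "supp M (precomp M x f) \<subseteq> (\<Union>a\<in>supp M f. supp M (precomp M x (g a)))"
      unfolding supp_def[of _ "precomp M x _"] by (auto, metis (no_types, lifting) sum.neutral)
    then show "finite (supp M (precomp M x f))"
      using f finite_supp_pure_generator[OF g(1) x] by (meson finite_UN finite_subset)
  qed (rule generated_subalgebra_base)
  ultimately have "A \<subseteq> ?N" by (rule generated_subalgebra_minimal)
  then show ?thesis using assms by blast
qed

lemma dual_simps [simp]:
  "mcarrier (dual M) = {f. functional M f \<and> finite (supp M f)}"
  "mscale (dual M) = (\<lambda>c f m. c * f m)" "mact (dual M) x = precomp M (S x)"
  by (simp_all add: dual_def)

interpretation F: vector_space "\<lambda>c (f :: 'm \<Rightarrow> 'k) m. c * f m"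
  by (rule vector_space_functions)

lemma is_module_dual: "is_module sc A (dual M)"
proof -
  have "F.subspace {f. functional M f \<and> finite (supp M f)}"
  proof (rule F.subspaceI)
    show "0 \<in> {f. functional M f \<and> finite (supp M f)}" by (simp add: functional_def supp_def)
  next
    fix f g assume "f \<in> {f. functional M f \<and> finite (supp M f)}" "g \<in> {f. functional M f \<and> finite (supp M f)}"
    then show "f + g \<in> {f. functional M f \<and> finite (supp M f)}"
      using functional_add[OF is_mod] finite_subset[OF supp_add[OF is_mod, of f g]] by simp
  next
    fix c f assume "f \<in> {f. functional M f \<and> finite (supp M f)}"
    then show "(\<lambda>m. c * f m) \<in> {f. functional M f \<and> finite (supp M f)}"
      using functional_scale[OF is_mod] finite_subset[OF supp_scale[OF is_mod, of c f]] by simp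
  qed
  then show ?thesis unfolding is_module_def
    by (auto simp: vector_space_functions functional_precomp[OF is_mod] finite_supp_precomp S_closed
        S_add S_scale S_mult S_one precomp_def fun_eq_iff act' functionalD' A_closed)
qed

text \<open>A nonzero value of \<open>f\<close> on the weight space of \<open>b\<close> forces \<open>star i (b i) = a i\<close>, hence
  \<open>b i = star i (a i)\<close>.\<close>

lemma wspace_dual:
  assumes a: "a \<in> weights"
  shows "wspace (dual M) a = pure M (\<lambda>i. star i (a i))"
proof -
  have S_t_act: "mact M (S (t i)) m = mscale M (star i (b i)) m" if b: "b \<in> weights" "m \<in> wspace M b" for i b m
  proof -
    have mc: "m \<in> mcarrier M" using b wspaceD[OF is_mod] by blast
    obtain y where y: "y \<in> A" "S (t i) - sc (star i (b i)) 1 = y * (t i - sc (b i) 1)"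
      using S_t[of "b i" i] b by (auto simp: weights_def)
    have "mact M (S (t i) - sc (star i (b i)) 1) m = mact M y (mact M (t i - sc (b i) 1) m)"
      unfolding y(2) by (intro act' A_closed t_closed y(1) mc)
    also have "mact M (t i - sc (b i) 1) m = 0"
      using mc wspaceD(2)[OF is_mod b(2)] by (simp add: act_diff[OF is_mod] act' t_closed A_closed)
    finally have "mact M (S (t i)) m - mact M (sc (star i (b i)) 1) m = 0"
      using act_zero[OF is_mod y(1)] act_diff[OF is_mod S_closed[OF t_closed] A_closed(5)[OF A_closed(1)] mc]
      by simp
    then show ?thesis using mc by (simp add: act' A_closed)
  qed
  show ?thesis
  proof (intro equalityI subsetI)
    fix f assume f: "f \<in> wspace (dual M) a"
    then have fl: "functional M f" by (simp add: wspace_def)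
    have "b = (\<lambda>i. star i (a i))" if b: "b \<in> supp M f" for b
    proof
      fix i
      obtain m where m: "m \<in> wspace M b" "f m \<noteq> 0" and bw: "b \<in> weights" using b by (auto simp: supp_def)
      have mc: "m \<in> mcarrier M" using m wspaceD[OF is_mod] by blast
      have "precomp M (S (t i)) f = (\<lambda>m. a i * f m)" using f by (simp add: wspace_def)
      from fun_cong[OF this, of m] have "f (mact M (S (t i)) m) = a i * f m"
        using mc by (simp add: precomp_def)
      then have "star i (b i) * f m = a i * f m"
        using mc by (simp add: S_t_act[OF bw m(1)] functionalD'[OF fl])
      then have "star i (b i) = a i" using m(2) by simp
      then show "b i = star i (a i)" using star_star[of "b i" i] bw by (auto simp: weights_def)
    qed
    then show "f \<in> pure M (\<lambda>i. star i (a i))" using fl by (auto simp: pure_def)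
  next
    fix f assume f: "f \<in> pure M (\<lambda>i. star i (a i))"
    then have fl: "functional M f" and fin: "finite (supp M f)"
      by (auto simp: pure_def intro: finite_subset)
    have "precomp M (S (t i)) f = (\<lambda>m. a i * f m)" for i
    proof (rule functional_eqI)
      show "functional M (precomp M (S (t i)) f)" by (intro functional_precomp[OF is_mod] fl S_closed t_closed)
      show "functional M (\<lambda>m. a i * f m)" by (rule functional_scale[OF is_mod fl])
      fix b m assume b: "b \<in> weights" "m \<in> wspace M b"
      have mc: "m \<in> mcarrier M" using b wspaceD[OF is_mod] by blast
      have "precomp M (S (t i)) f m = star i (b i) * f m"
        using mc by (simp add: precomp_def S_t_act[OF b] functionalD'[OF fl])
      then show "precomp M (S (t i)) f m = a i * f m"
        using pure_eq_0[OF f b(2,1)] star_star[of "a i" i] a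
        by (cases "b = (\<lambda>i. star i (a i))") (auto simp: weights_def)
    qed
    then show "f \<in> wspace (dual M) a" using fl fin by (simp add: wspace_def)
  qed
qed

text \<open>The interpolating element that is 1 at \<open>a\<close> and 0 at the finitely many other weights involved
  fixes \<open>m\<close> and kills it.\<close>

lemma weights_independent:
  assumes m: "m \<in> wspace M a" and span: "m \<in> V.span (\<Union>b\<in>weights - {a}. wspace M b)"
  shows "m = 0"
proof -
  let ?fin = "\<lambda>F. finite F \<and> F \<subseteq> weights - {a}"
  have "V.subspace {m. \<exists>F. ?fin F \<and> m \<in> V.span (\<Union>b\<in>F. wspace M b)}" (is "V.subspace ?X")
  proof (rule V.subspaceI)
    show "0 \<in> ?X" using V.span_zero by (intro CollectI exI[of _ "{}"]) simp
  next
    fix x y assume "x \<in> ?X" "y \<in> ?X"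
    then obtain F F' where F: "?fin F" "x \<in> V.span (\<Union>b\<in>F. wspace M b)"
        and F': "?fin F'" "y \<in> V.span (\<Union>b\<in>F'. wspace M b)" by blast
    have "x \<in> V.span (\<Union>b\<in>F \<union> F'. wspace M b)" "y \<in> V.span (\<Union>b\<in>F \<union> F'. wspace M b)"
      using F(2) F'(2) V.span_mono[of "\<Union>b\<in>F. wspace M b" "\<Union>b\<in>F \<union> F'. wspace M b"]
        V.span_mono[of "\<Union>b\<in>F'. wspace M b" "\<Union>b\<in>F \<union> F'. wspace M b"] by blast+
    then show "x + y \<in> ?X" using F F' V.span_add by (intro CollectI exI[of _ "F \<union> F'"]) auto
  next
    fix c x assume "x \<in> ?X" then show "mscale M c x \<in> ?X" using V.span_scale by blast
  qed
  moreover have "(\<Union>b\<in>weights - {a}. wspace M b) \<subseteq> ?X"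
  proof
    fix x assume "x \<in> (\<Union>b\<in>weights - {a}. wspace M b)"
    then obtain b where "b \<in> weights - {a}" "x \<in> wspace M b" by blast
    then show "x \<in> ?X" using V.span_base by (intro CollectI exI[of _ "{b}"]) auto
  qed
  ultimately have "V.span (\<Union>b\<in>weights - {a}. wspace M b) \<subseteq> ?X" by (intro V.span_minimal)
  from subsetD[OF this span]
  obtain F where F: "?fin F" "m \<in> V.span (\<Union>b\<in>F. wspace M b)" by blast
  obtain e s where e: "e \<in> A" "s a = (1::'k)" "\<forall>b\<in>F. b \<noteq> a \<longrightarrow> s b = 0"
      "\<forall>b. \<forall>m\<in>wspace M b. mact M e m = mscale M (s b) m"
    using interpolation[OF is_mod, of F a] F(1) by blast
  have "V.subspace {m \<in> mcarrier M. mact M e m = 0}"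
    by (rule V.subspaceI) (use e(1) carrier_closed' act' act_zero[OF is_mod] in auto)
  moreover have "(\<Union>b\<in>F. wspace M b) \<subseteq> {m \<in> mcarrier M. mact M e m = 0}"
    using e F(1) wspaceD[OF is_mod] by auto
  ultimately have "V.span (\<Union>b\<in>F. wspace M b) \<subseteq> {m \<in> mcarrier M. mact M e m = 0}"
    by (intro V.span_minimal)
  from subsetD[OF this F(2)] have "mact M e m = 0" by simp
  then show ?thesis using e m by simp
qed

lemma wspace_basis:
  assumes "a \<in> weights"
  obtains Bs where "finite Bs" "Bs \<subseteq> wspace M a" "V.independent Bs" "wspace M a \<subseteq> V.span Bs"
proof -
  obtain Bs where Bs: "Bs \<subseteq> wspace M a" "V.independent Bs" "wspace M a \<subseteq> V.span Bs"
    using V.maximal_independent_subset by metis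
  obtain T where "finite T" "wspace M a \<subseteq> V.span T"
    using M assms by (auto simp: weight_module_def finite_dimensional_def)
  then have "finite Bs" using V.independent_span_bound[of T Bs] Bs by blast
  then show ?thesis using that Bs by blast
qed

text \<open>Extending the dual basis of a weight space by zero on the sum of the other weight spaces.\<close>

lemma dual_vector:
  assumes a: "a \<in> weights" and Bs: "Bs \<subseteq> wspace M a" "V.independent Bs" and v: "v \<in> Bs"
  shows "\<exists>f\<in>pure M a. \<forall>u\<in>Bs. f u = (if u = v then 1 else 0)"
proof -
  let ?W = "\<Union>b\<in>weights - {a}. wspace M b"
  let ?N = "V.span (?W \<union> (Bs - {v}))"
  have "v \<notin> ?N"
  proof
    assume "v \<in> ?N"
    then obtain n u where nu: "v = n + u" "n \<in> V.span ?W" "u \<in> V.span (Bs - {v})"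
      by (auto simp: V.span_Un)
    have "V.span (Bs - {v}) \<subseteq> wspace M a"
      using Bs(1) by (intro V.span_minimal wspace_subspace[OF is_mod]) auto
    then have "v - u \<in> wspace M a"
      using v Bs(1) nu(3) by (intro V.subspace_diff[OF wspace_subspace[OF is_mod]]) auto
    then have "n \<in> wspace M a" using nu(1) by simp
    then have "n = 0" using weights_independent nu(2) by blast
    then show False using nu Bs(2) v unfolding V.dependent_def by auto
  qed
  interpret VP: vector_space_pair "mscale M" "(*) :: 'k \<Rightarrow> 'k \<Rightarrow> 'k"
    by unfold_locales (simp_all add: algebra_simps)
  obtain BN where BN: "BN \<subseteq> ?N" "V.independent BN" "?N \<subseteq> V.span BN"
    using V.maximal_independent_subset by metis
  have vN: "v \<notin> V.span BN" using \<open>v \<notin> ?N\<close> BN(1) V.span_minimal[OF BN(1)] by auto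
  then have "V.independent (insert v BN)" using BN(2) by (rule V.independent_insertI)
  then obtain g where g: "Vector_Spaces.linear (mscale M) (*) g"
      "\<forall>x\<in>insert v BN. g x = (if x = v then 1 else 0)"
    using VP.linear_independent_extend[of _ "\<lambda>x. if x = v then 1 else 0"] by metis
  have "g x = 0" if "x \<in> BN" for x using g(2) that vN V.span_base by (metis insertCI)
  then have g0: "g x = 0" if "x \<in> ?N" for x
    using VP.linear_eq_0_on_span[OF g(1), of BN] BN(3) that by blast
  define f where "f m = (if m \<in> mcarrier M then g m else 0)" for m
  have "functional M f" unfolding functional_def f_def
    using VP.linear_add[OF g(1)] VP.linear_scale[OF g(1)] by (auto simp: carrier_closed')
  moreover have "supp M f \<subseteq> {a}"
  proof
    fix b assume "b \<in> supp M f"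
    then obtain m where "b \<in> weights" "m \<in> wspace M b" "f m \<noteq> 0" by (auto simp: supp_def)
    then show "b \<in> {a}" using g0[of m] V.span_base[of m "?W \<union> (Bs - {v})"] by (auto simp: f_def split: if_splits)
  qed
  moreover have "f u = (if u = v then 1 else 0)" if "u \<in> Bs" for u
    using that Bs(1) wspaceD[OF is_mod] g(2) g0[of u] V.span_base[of u "?W \<union> (Bs - {v})"]
    by (auto simp: f_def)
  ultimately show ?thesis by (auto simp: pure_def)
qed

text \<open>The functionals dual to a basis of the weight space, extended by zero, form a basis.\<close>

lemma dim_pure:
  assumes a: "a \<in> weights"
  shows "finite_dimensional (\<lambda>c f m. c * f m) (pure M a) \<and> F.dim (pure M a) = V.dim (wspace M a)"
proof -
  obtain Bs where Bs: "finite Bs" "Bs \<subseteq> wspace M a" "V.independent Bs" "wspace M a \<subseteq> V.span Bs"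
    using wspace_basis[OF a] .
  obtain d where d: "\<And>v. v \<in> Bs \<Longrightarrow> d v \<in> pure M a" "\<And>u v. u \<in> Bs \<Longrightarrow> v \<in> Bs \<Longrightarrow> d v u = (if u = v then 1 else 0)"
    using dual_vector[OF a Bs(2,3)] by metis
  have inj: "inj_on d Bs" using d(2) by (intro inj_onI) (metis zero_neq_one)
  have "f \<in> F.span (d ` Bs)" if f: "f \<in> pure M a" for f
  proof -
    have fl: "functional M f" using f by (simp add: pure_def)
    have dl: "functional M (d v)" if "v \<in> Bs" for v using d(1)[OF that] by (simp add: pure_def)
    let ?g = "\<lambda>m. \<Sum>v\<in>Bs. f v * d v m"
    have gl: "functional M ?g"
      by (intro functional_sum[OF is_mod] functional_scale[OF is_mod] dl)
    have "m \<in> mcarrier M \<and> f m = ?g m" if m: "m \<in> V.span Bs" for m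
      using m
    proof (induction rule: V.span_induct_alt)
      case base
      then show ?case by (simp add: functionalD'[OF fl] functionalD'[OF dl] carrier_closed')
    next
      case (step c u m)
      have u: "u \<in> mcarrier M" using wspaceD(1)[OF is_mod subsetD[OF Bs(2) step(1)]] .
      have "?g u = (\<Sum>v\<in>Bs. if u = v then f v else 0)"
        using d(2) step(1) by (intro sum.cong) auto
      then have "?g u = f u" using step(1) Bs(1) by simp
      then show ?case
        using u step(2) functionalD'(1,2)[OF fl] functionalD'(1,2)[OF gl] by (simp add: carrier_closed')
    qed
    then have eq: "f m = ?g m" if "m \<in> wspace M a" for m using Bs(4) that by blast
    then have "f = ?g"
    proof (intro functional_eqI fl gl)
      fix b m assume b: "b \<in> weights" "m \<in> wspace M b"
      show "f m = ?g m"
      proof (cases "b = a")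
        case False
        then show ?thesis using pure_eq_0[OF f b(2,1)] pure_eq_0[OF d(1) b(2,1)] by simp
      qed (use eq b in blast)
    qed
    also have "?g = (\<Sum>v\<in>Bs. (\<lambda>m. f v * d v m))" by (simp add: fun_eq_iff sum_fun_apply)
    also have "\<dots> \<in> F.span (d ` Bs)"
      by (intro F.span_sum F.span_scale F.span_base) auto
    finally show ?thesis .
  qed
  then have span: "pure M a \<subseteq> F.span (d ` Bs)" by blast
  have "F.independent (d ` Bs)"
    unfolding F.dependent_finite[OF finite_imageI[OF Bs(1)]]
  proof
    assume "\<exists>h. (\<exists>f\<in>d ` Bs. h f \<noteq> 0) \<and> (\<Sum>f\<in>d ` Bs. (\<lambda>m. h f * f m)) = 0"
    then obtain h v where v: "v \<in> Bs" "h (d v) \<noteq> 0" and "(\<Sum>f\<in>d ` Bs. (\<lambda>m. h f * f m)) v = 0"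
      by auto
    then have "(\<Sum>u\<in>Bs. h (d u) * d u v) = 0"
      by (simp add: sum_fun_apply sum.reindex[OF inj])
    moreover have "(\<Sum>u\<in>Bs. h (d u) * d u v) = (\<Sum>u\<in>Bs. if v = u then h (d u) else 0)"
      using d(2) v(1) by (intro sum.cong) auto
    ultimately show False using v Bs(1) by simp
  qed
  then have "F.dim (pure M a) = card Bs"
    using span d(1) by (intro F.dim_unique[of "d ` Bs"]) (auto simp: card_image[OF inj])
  moreover have "V.dim (wspace M a) = card Bs" using Bs by (intro V.dim_unique) auto
  moreover have "finite_dimensional (\<lambda>c f m. c * f m) (pure M a)"
    unfolding finite_dimensional_def using span d(1) Bs(1) by (intro exI[of _ "d ` Bs"]) auto
  ultimately show ?thesis by simp
qed

lemma star_weights: "a \<in> weights \<Longrightarrow> (\<lambda>i. star i (a i)) \<in> weights"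
  "a \<in> weights \<Longrightarrow> (\<lambda>i. star i (star i (a i))) = a"
  by (auto simp: weights_def star_closed star_star)

lemma weight_module_dual: "weight_module (dual M)"
  unfolding weight_module_def
proof (intro conjI ballI)
  show "is_module sc A (dual M)" by (rule is_module_dual)
  have sub: "F.subspace (mcarrier (dual M))" using is_module_dual by (simp add: is_module_def)
  show "module.span (mscale (dual M)) (\<Union>a\<in>weights. wspace (dual M) a) = mcarrier (dual M)"
  proof
    show "module.span (mscale (dual M)) (\<Union>a\<in>weights. wspace (dual M) a) \<subseteq> mcarrier (dual M)"
      unfolding dual_simps(2) by (rule F.span_minimal[OF _ sub]) (auto simp: wspace_def)
    show "mcarrier (dual M) \<subseteq> module.span (mscale (dual M)) (\<Union>a\<in>weights. wspace (dual M) a)"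
    proof
      fix f assume "f \<in> mcarrier (dual M)"
      then obtain g where g: "\<And>a. a \<in> supp M f \<Longrightarrow> g a \<in> pure M a" "f = (\<lambda>m. \<Sum>a\<in>supp M f. g a m)"
        using functional_decomposition by auto
      have "g a \<in> (\<Union>a\<in>weights. wspace (dual M) a)" if "a \<in> supp M f" for a
      proof -
        have "a \<in> weights" using that by (simp add: supp_def)
        then have "g a \<in> wspace (dual M) (\<lambda>i. star i (a i))"
          using g(1)[OF that] by (simp add: wspace_dual star_weights)
        then show ?thesis using \<open>a \<in> weights\<close> star_weights by blast
      qed
      then have "(\<Sum>a\<in>supp M f. g a) \<in> F.span (\<Union>a\<in>weights. wspace (dual M) a)"
        by (intro F.span_sum F.span_base)
      moreover have "(\<Sum>a\<in>supp M f. g a) = f" by (subst (2) g(2)) (simp add: fun_eq_iff sum_fun_apply)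
      ultimately show "f \<in> module.span (mscale (dual M)) (\<Union>a\<in>weights. wspace (dual M) a)" by simp
    qed
  qed
  fix a assume "a \<in> weights"
  then show "finite_dimensional (mscale (dual M)) (wspace (dual M) a)"
    using dim_pure[OF star_weights(1)] by (simp add: wspace_dual)
qed

lemma dim_wspace_dual:
  "a \<in> weights \<Longrightarrow> vector_space.dim (mscale (dual M)) (wspace (dual M) a)
     = vector_space.dim (mscale M) (wspace M (\<lambda>i. star i (a i)))"
  using dim_pure[OF star_weights(1)] by (simp add: wspace_dual)

end

theorem dim_wspace_dual_dual:
  assumes "weight_module M" "a \<in> weights"
  shows "vector_space.dim (mscale (dual (dual M))) (wspace (dual (dual M)) a)
    = vector_space.dim (mscale M) (wspace M a)"
  using dim_wspace_dual[OF weight_module_dual[OF assms(1)] assms(2)]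
    dim_wspace_dual[OF assms(1) star_weights(1)[OF assms]] star_weights(2)[OF assms] by simp

end

lemma finite_dimensional_subset:
  assumes "vector_space sc" "finite_dimensional sc V" "W \<subseteq> V"
  shows "finite_dimensional sc W"
proof -
  interpret vector_space sc by fact
  obtain S where S: "finite S" "V \<subseteq> span S" using assms(2) by (auto simp: finite_dimensional_def)
  obtain Bs where Bs: "Bs \<subseteq> W" "independent Bs" "W \<subseteq> span Bs"
    using maximal_independent_subset by metis
  then have "finite Bs" using independent_span_bound[OF S(1)] S(2) assms(3) by blast
  then show ?thesis using Bs by (auto simp: finite_dimensional_def)
qed

context weight_duality begin

text \<open>A vector of \<open>M\<close> is killed by a product of factors \<open>t i - d\<close> with \<open>d \<in> P\<close>, one for each weight
  vector in it; on an eigenvector this product acts by the product of the numbers \<open>c - d\<close>.\<close>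

lemma weight_module_eigenvalue:
  fixes M :: "('k, 'u, 'm::ab_group_add) umodule"
  assumes M: "weight_module M" and m: "m \<in> mcarrier M" "m \<noteq> 0" "mact M (t i) m = mscale M c m"
  shows "c \<in> P"
proof -
  have is_mod: "is_module sc A M" using M by (simp add: weight_module_def)
  interpret V: vector_space "mscale M" using is_mod by (simp add: is_module_def)
  note act = act[OF is_mod] act_diff[OF is_mod] and closed = carrier_closed[OF is_mod]
  define y where "y ds = prod_list (map (\<lambda>d. t i - sc d 1) ds)" for ds
  have yA: "y ds \<in> A" for ds by (induction ds) (simp_all add: y_def A_closed t_closed)
  have fA: "t i - sc d 1 \<in> A" for d by (intro A_closed t_closed)
  have y_Cons: "y (d # ds) = (t i - sc d 1) * y ds" for d ds by (simp add: y_def)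
  have f_comm: "(t i - sc e 1) * y ds = y ds * (t i - sc e 1)" for e ds
  proof (induction ds)
    case (Cons d ds)
    have "(t i - sc e 1) * (t i - sc d 1) = (t i - sc d 1) * (t i - sc e 1)"
      by (simp add: algebra_simps scale_right_diff_distrib mult.commute)
    then have "(t i - sc e 1) * ((t i - sc d 1) * y ds) = (t i - sc d 1) * ((t i - sc e 1) * y ds)"
      by (simp only: mult.assoc[symmetric])
    then show ?case using Cons by (simp add: y_def mult.assoc)
  qed (simp add: y_def)
  have y_comm: "y ds * y es = y es * y ds" for ds es
  proof (induction ds)
    case (Cons d ds)
    have "y (d # ds) * y es = (t i - sc d 1) * y es * y ds"
      unfolding y_Cons mult.assoc Cons ..
    then show ?case unfolding f_comm y_Cons mult.assoc .
  qed (simp add: y_def)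
  have y_append: "y (ds @ es) = y ds * y es" for ds es by (simp add: y_def)
  have y0: "mact M (y ds) 0 = 0" for ds by (rule act_zero[OF is_mod yA])
  have y_eigen: "mact M (y ds) m = mscale M (prod_list (map (\<lambda>d. c - d) ds)) m"
    if "m \<in> mcarrier M" "mact M (t i) m = mscale M c m" for ds m c
  proof (induction ds)
    case Nil then show ?case using that by (simp add: y_def act)
  next
    case (Cons d ds)
    have "mact M (t i - sc d 1) m = mscale M (c - d) m"
      using that by (simp add: act A_closed t_closed V.scale_left_diff_distrib)
    then have "mact M ((t i - sc d 1) * y ds) m = mscale M ((c - d) * prod_list (map (\<lambda>d. c - d) ds)) m"
      using Cons that by (simp add: act fA yA mult.commute)
    then show ?case by (simp add: y_def)
  qed
  have "\<exists>ds. set ds \<subseteq> P \<and> mact M (y ds) m = 0"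
    using m(1)
  proof (induction rule: weight_vector_induct[OF M, consumes 1, case_names weight zero add scale])
    case (weight a m)
    then show ?case using y_eigen[of m "a i" "[a i]"] wspaceD[OF is_mod weight(2)]
      by (intro exI[of _ "[a i]"]) (simp add: weights_def)
  next
    case zero then show ?case using y0[of "[]"] by (intro exI[of _ "[]"]) simp
  next
    case (add m m')
    then obtain ds es where *: "set ds \<subseteq> P" "mact M (y ds) m = 0" "set es \<subseteq> P" "mact M (y es) m' = 0"
      by blast
    have "mact M (y (ds @ es)) m = 0"
      unfolding y_append y_comm[of ds es] using *(2) add by (simp add: act yA y0)
    moreover have "mact M (y (ds @ es)) m' = 0"
      unfolding y_append using *(4) add by (simp add: act yA y0)
    ultimately show ?case using * add by (intro exI[of _ "ds @ es"]) (simp add: act yA)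
  next
    case (scale c m)
    then obtain ds where "set ds \<subseteq> P" "mact M (y ds) m = 0" by blast
    then show ?case using scale by (intro exI[of _ ds]) (simp add: act yA)
  qed
  then obtain ds where ds: "set ds \<subseteq> P" "mact M (y ds) m = 0" by blast
  then have "prod_list (map (\<lambda>d. c - d) ds) = 0" using y_eigen[OF m(1,3), of ds] m(2) by simp
  then have "c \<in> set ds" by (auto simp: prod_list_zero_iff)
  then show ?thesis using ds(1) by blast
qed

end


section \<open>The root lattice and the longest element of the black Weyl group\<close>

definition root_form :: "('i::finite \<Rightarrow> 'i \<Rightarrow> int) \<Rightarrow> ('i \<Rightarrow> nat) \<Rightarrow> ('i \<Rightarrow> int) \<Rightarrow> ('i \<Rightarrow> int) \<Rightarrow> int" where
  "root_form C d \<alpha> \<beta> = (\<Sum>i\<in>UNIV. \<Sum>j\<in>UNIV. int (d i) * C i j * \<alpha> i * \<beta> j)"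

lemma pairing_simple: "pairing C (simple i) \<beta> = (\<Sum>j\<in>UNIV. C i j * \<beta> j)"
proof -
  have "pairing C (simple i) \<beta> = (\<Sum>k\<in>UNIV. if k = i then \<Sum>j\<in>UNIV. C i j * \<beta> j else 0)"
    unfolding pairing_def simple_def by (intro sum.cong) auto
  then show ?thesis by simp
qed

lemma pairing_simple_simple: "pairing C (simple i) (simple j) = C i j"
  unfolding pairing_simple by (simp add: simple_def if_distrib cong: if_cong)

lemma sreflection_add: "sreflection C i (\<alpha> + \<beta>) = sreflection C i \<alpha> + sreflection C i \<beta>"
  by (auto simp: sreflection_def pairing_simple fun_eq_iff algebra_simps sum.distrib)

lemma weyl_word_simps [simp]:
  "weyl_word C [] = id" "weyl_word C (i # ws) = sreflection C i \<circ> weyl_word C ws"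
  by (simp_all add: weyl_word_def)

lemma weyl_word_add: "weyl_word C ws (\<alpha> + \<beta>) = weyl_word C ws \<alpha> + weyl_word C ws \<beta>"
proof (induction ws)
  case (Cons i ws)
  then show ?case by (simp only: weyl_word_simps o_apply sreflection_add)
qed (simp only: weyl_word_simps id_apply)

lemma additive_uminus:
  fixes f :: "'a::ab_group_add \<Rightarrow> 'b::ab_group_add"
  assumes "\<And>x y. f (x + y) = f x + f y" shows "f 0 = 0" "f (- x) = - f x" "f (x - y) = f x - f y"
proof -
  show 0: "f 0 = 0" using assms[of 0 0] by simp
  show m: "f (- x) = - f x" for x using assms[of "- x" x] 0 by (simp add: eq_neg_iff_add_eq_0)
  show "f (x - y) = f x - f y" using assms[of x "- y"] m by simp
qed

lemma lattice_induct [case_names zero simple add minus]: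
  fixes \<alpha> :: "'i::finite \<Rightarrow> int"
  assumes zero: "Q 0" and simple: "\<And>i. Q (simple i)"
    and add: "\<And>\<alpha> \<beta>. Q \<alpha> \<Longrightarrow> Q \<beta> \<Longrightarrow> Q (\<alpha> + \<beta>)" and minus: "\<And>\<alpha>. Q \<alpha> \<Longrightarrow> Q (- \<alpha>)"
  shows "Q \<alpha>"
proof -
  have nat: "Q (\<lambda>j. int n * simple i j)" for n i
  proof (induction n)
    case 0 then show ?case using zero by (simp add: zero_fun_def)
  next
    case (Suc n) from add[OF this simple[of i]] show ?case by (simp add: plus_fun_def algebra_simps)
  qed
  have int: "Q (\<lambda>j. c * simple i j)" for c i
  proof (cases "c \<ge> 0")
    case True then show ?thesis using nat[of "nat c" i] by simp
  next
    case False then show ?thesis using minus[OF nat[of "nat (- c)" i]] by (simp add: fun_Compl_def)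
  qed
  have "Q (\<lambda>j. if j \<in> F then \<alpha> j else 0)" for F :: "'i set"
  proof (induction F rule: finite_induct[OF finite])
    case 1 then show ?case using zero by (simp add: zero_fun_def)
  next
    case (2 i F)
    have "(\<lambda>j. if j \<in> insert i F then \<alpha> j else 0) = (\<lambda>j. if j \<in> F then \<alpha> j else 0) + (\<lambda>j. \<alpha> i * simple i j)"
      using 2(2) by (auto simp: fun_eq_iff simple_def)
    then show ?case using add[OF 2(3) int[of "\<alpha> i" i]] by simp
  qed
  from this[of UNIV] show ?thesis by simp
qed

lemma root_form_add:
  "root_form C d (\<alpha> + \<beta>) \<gamma> = root_form C d \<alpha> \<gamma> + root_form C d \<beta> \<gamma>"
  "root_form C d \<gamma> (\<alpha> + \<beta>) = root_form C d \<gamma> \<alpha> + root_form C d \<gamma> \<beta>"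
  by (simp_all add: root_form_def algebra_simps sum.distrib)

lemmas root_form_minus = additive_uminus[of "\<lambda>\<alpha>. root_form C d \<alpha> \<gamma>" for C d \<gamma>, OF root_form_add(1)]
  additive_uminus[of "root_form C d \<gamma>" for C d \<gamma>, OF root_form_add(2)]

lemma sreflection_eq:
  "sreflection C i \<beta> = \<beta> - (\<lambda>j. pairing C (simple i) \<beta> * simple i j)"
  by (auto simp: sreflection_def simple_def)

context
  fixes D :: "'i::finite satake"
  assumes D: "is_satake D"
begin

abbreviation "form \<equiv> root_form (cartan D) (symm D)"

lemma cartan_facts:
  "cartan D i i = 2" "int (symm D i) * cartan D i j = int (symm D j) * cartan D j i"
  "cartan D i j = 0 \<longleftrightarrow> cartan D j i = 0" "symm D i > 0" "i \<noteq> j \<Longrightarrow> cartan D i j \<le> 0"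
proof -
  have f: "finite_type (cartan D) (symm D)" using D by (simp add: is_satake_def)
  show "cartan D i i = 2" "int (symm D i) * cartan D i j = int (symm D j) * cartan D j i"
    "symm D i > 0" "i \<noteq> j \<Longrightarrow> cartan D i j \<le> 0" using f by (simp_all add: finite_type_def)
  show "cartan D i j = 0 \<longleftrightarrow> cartan D j i = 0" using f unfolding finite_type_def by blast
qed

lemma tau_facts:
  "tau D (tau D i) = i" "cartan D (tau D i) (tau D j) = cartan D i j" "symm D (tau D i) = symm D i"
  "tau D i \<in> black D \<longleftrightarrow> i \<in> black D"
proof -
  show tau: "tau D (tau D i) = i" "cartan D (tau D i) (tau D j) = cartan D i j" "symm D (tau D i) = symm D i"
    for i j using D by (simp_all add: is_satake_def)
  have "tau D ` black D = black D" using D by (simp add: is_satake_def)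
  then have "i \<in> black D \<Longrightarrow> tau D i \<in> black D" for i by blast
  then show "tau D i \<in> black D \<longleftrightarrow> i \<in> black D" using tau(1) by metis
qed

lemma form_simple: "form (\<lambda>j. c * simple i j) \<beta> = c * (int (symm D i) * pairing (cartan D) (simple i) \<beta>)"
proof -
  have "form (\<lambda>j. c * simple i j) \<beta>
      = (\<Sum>k\<in>UNIV. if k = i then c * (int (symm D i) * (\<Sum>j\<in>UNIV. cartan D i j * \<beta> j)) else 0)"
    unfolding root_form_def simple_def by (intro sum.cong) (auto simp: sum_distrib_left algebra_simps)
  then show ?thesis by (simp add: pairing_simple)
qed

lemma form_sym: "form \<alpha> \<beta> = form \<beta> \<alpha>"
  unfolding root_form_def
  by (subst sum.swap) (intro sum.cong refl, metis cartan_facts(2) mult.commute mult.left_commute)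

lemma form_sreflection: "form (sreflection (cartan D) i \<alpha>) (sreflection (cartan D) i \<beta>) = form \<alpha> \<beta>"
proof -
  let ?p = "pairing (cartan D) (simple i)"
  have s2: "form \<gamma> (\<lambda>j. c * simple i j) = c * (int (symm D i) * ?p \<gamma>)" for \<gamma> c
    by (subst form_sym) (rule form_simple)
  have p: "?p (\<lambda>j. c * simple i j) = 2 * c" for c
  proof -
    have "?p (\<lambda>j. c * simple i j) = c * ?p (simple i)"
      by (simp add: pairing_simple sum_distrib_left algebra_simps)
    then show ?thesis by (simp add: pairing_simple_simple cartan_facts)
  qed
  show ?thesis
    unfolding sreflection_eq root_form_minus s2 form_simple p by (simp add: algebra_simps)
qed

lemma form_weyl_word: "form (weyl_word (cartan D) ws \<alpha>) (weyl_word (cartan D) ws \<beta>) = form \<alpha> \<beta>"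
  by (induction ws) (simp_all add: form_sreflection)

lemma bij_tau: "bij (tau D)"
  by (rule involuntory_imp_bij) (rule tau_facts)

lemma form_tau: "form (\<alpha> \<circ> tau D) (\<beta> \<circ> tau D) = form \<alpha> \<beta>"
proof -
  have re: "(\<Sum>i\<in>UNIV. f (tau D i)) = (\<Sum>i\<in>UNIV. f i)" for f :: "'i \<Rightarrow> int"
    using sum.reindex_bij_betw[OF bij_tau] .
  have "form (\<alpha> \<circ> tau D) (\<beta> \<circ> tau D) = (\<Sum>i\<in>UNIV. \<Sum>j\<in>UNIV.
      int (symm D (tau D i)) * cartan D (tau D i) (tau D j) * \<alpha> (tau D i) * \<beta> (tau D j))"
    by (simp add: root_form_def tau_facts)
  also have "\<dots> = form \<alpha> \<beta>"
    unfolding root_form_def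
    by (subst re[of "\<lambda>j. int (symm D (tau D _)) * cartan D (tau D _) j * \<alpha> (tau D _) * \<beta> j"])
       (rule re[of "\<lambda>i. \<Sum>j\<in>UNIV. int (symm D i) * cartan D i j * \<alpha> i * \<beta> j"])
  finally show ?thesis .
qed

lemma form_definite: "form \<alpha> \<alpha> = 0 \<Longrightarrow> \<alpha> = 0"
proof (rule ccontr)
  assume 0: "form \<alpha> \<alpha> = 0" and "\<alpha> \<noteq> 0"
  then obtain i where i: "real_of_int (\<alpha> i) \<noteq> 0" by (auto simp: fun_eq_iff)
  have "\<forall>x :: 'i \<Rightarrow> real. (\<exists>i. x i \<noteq> 0) \<longrightarrow>
      (\<Sum>i\<in>UNIV. \<Sum>j\<in>UNIV. real (symm D i) * of_int (cartan D i j) * x i * x j) > 0"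
    using D by (simp add: is_satake_def finite_type_def)
  from this[rule_format, of "\<lambda>i. real_of_int (\<alpha> i)"] have "(\<Sum>i\<in>UNIV. \<Sum>j\<in>UNIV. real (symm D i) * of_int (cartan D i j) * of_int (\<alpha> i) * of_int (\<alpha> j)) > (0::real)"
    using i by blast
  moreover have "(\<Sum>i\<in>UNIV. \<Sum>j\<in>UNIV. real (symm D i) * of_int (cartan D i j) * of_int (\<alpha> i) * of_int (\<alpha> j))
      = real_of_int (form \<alpha> \<alpha>)"
    by (simp add: root_form_def)
  ultimately show False using 0 by simp
qed

lemma wblack_add: "wblack D (\<alpha> + \<beta>) = wblack D \<alpha> + wblack D \<beta>"
  by (simp add: wblack_def weyl_word_add)

lemmas wblack_minus = additive_uminus[of "wblack D", OF wblack_add]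

lemma set_wword: "set (wword D) \<subseteq> black D"
  using D by (simp add: is_satake_def longest_word_def)

lemma wblack_black: "i \<in> black D \<Longrightarrow> wblack D (simple i) = - simple (tau D i)"
  using D by (simp add: is_satake_def)

lemma simple_tau: "simple i \<circ> tau D = simple (tau D i)"
  using tau_facts(1) by (auto simp: simple_def fun_eq_iff)

lemma wblack_diff_support:
  assumes "j \<notin> black D" shows "wblack D \<alpha> j = \<alpha> j"
proof -
  have "weyl_word (cartan D) ws \<alpha> j = \<alpha> j" if "set ws \<subseteq> black D" for ws
    using that assms by (induction ws) (auto simp: sreflection_def)
  then show ?thesis using set_wword by (simp add: wblack_def)
qed

text \<open>By additivity, from the assumption on the simple roots.\<close>

lemma wblack_on_black_lattice:
  assumes "\<And>j. j \<notin> black D \<Longrightarrow> \<alpha> j = 0"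
  shows "wblack D \<alpha> = - (\<alpha> \<circ> tau D)"
proof -
  let ?cut = "\<lambda>\<alpha> j. if j \<in> black D then \<alpha> j else (0::int)"
  have "wblack D (?cut \<alpha>) = - (?cut \<alpha> \<circ> tau D)"
  proof (induction \<alpha> rule: lattice_induct)
    case zero
    have "?cut 0 = 0" by auto
    then show ?case by (simp only: wblack_minus) auto
  next
    case (simple i)
    show ?case
    proof (cases "i \<in> black D")
      case True
      then have "?cut (simple i) = simple i" by (auto simp: simple_def)
      then show ?thesis using wblack_black[OF True] simple_tau by simp
    next
      case False
      then have "?cut (simple i) = 0" by (auto simp: simple_def)
      then show ?thesis by (simp only: wblack_minus) auto
    qed
  next
    case (add \<alpha> \<beta>)
    have "?cut (\<alpha> + \<beta>) = ?cut \<alpha> + ?cut \<beta>" by auto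
    then show ?case using add by (simp only: wblack_add) auto
  next
    case (minus \<alpha>)
    have "?cut (- \<alpha>) = - ?cut \<alpha>" by auto
    then show ?case using minus by (simp only: wblack_minus) auto
  qed
  moreover have "?cut \<alpha> = \<alpha>" using assms by auto
  ultimately show ?thesis by simp
qed

text \<open>Put \<open>u = \<alpha>\<^sub>i - \<alpha>\<^bsub>\<tau>(i)\<^esub>\<close> and \<open>x = w\<^sub>\<bullet> u - u\<close>.  On the sublattice of \<open>black\<close>, which contains \<open>x\<close>,
  \<open>w\<^sub>\<bullet>\<close> acts as \<open>-\<tau>\<close>; since \<open>\<tau> u = - u\<close>, this gives
  \<open>(w\<^sub>\<bullet> u, x) = - (u, \<tau> x) = (u, x)\<close>, so \<open>(x, x) = 0\<close>.\<close>

lemma wblack_fixes_tau_antiinvariant: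
  "wblack D (simple i - simple (tau D i)) = simple i - simple (tau D i)"
proof -
  define u where "u = simple i - simple (tau D i)"
  define x where "x = wblack D u - u"
  have u: "u \<circ> tau D = - u" unfolding u_def using simple_tau[of i] simple_tau[of "tau D i"]
    by (simp add: fun_eq_iff tau_facts)
  have x: "x j = 0" if "j \<notin> black D" for j
    using that by (simp add: x_def wblack_diff_support)
  define y where "y = - (x \<circ> tau D)"
  have "y j = 0" if "j \<notin> black D" for j using that x tau_facts(4) by (simp add: y_def)
  then have "wblack D y = x"
    by (subst wblack_on_black_lattice) (auto simp: y_def fun_eq_iff tau_facts)
  then have "form (wblack D u) x = form u y"
    using form_weyl_word[of "wword D" u y] by (simp add: wblack_def)
  also have "\<dots> = form (u \<circ> tau D) (y \<circ> tau D)" by (simp add: form_tau)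
  also have "y \<circ> tau D = - x" by (auto simp: y_def fun_eq_iff tau_facts)
  finally have "form (wblack D u) x = form u x" by (simp only: u root_form_minus minus_minus)
  then have "form x x = 0" by (simp add: x_def root_form_minus)
  then have "x = 0" by (rule form_definite)
  then show ?thesis by (simp add: x_def u_def)
qed

lemma wblack_orthogonal:
  assumes "\<forall>i\<in>black D. cartan D i j = 0" shows "wblack D (simple j) = simple j"
proof -
  have "weyl_word (cartan D) ws (simple j) = simple j" if "set ws \<subseteq> black D" for ws
    using that by (induction ws) (auto simp: sreflection_def pairing_simple_simple assms)
  then show ?thesis using set_wword by (simp add: wblack_def)
qed

lemma pairing_two_rho_orthogonal:
  assumes "\<forall>i\<in>black D. cartan D i j = 0"
  shows "pairing (cartan D) (simple j) (two_rho (cartan D) (black D)) = 0"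
proof -
  have "\<beta> k = 0" if \<beta>: "\<beta> \<in> positive_roots (cartan D) (black D)" and k: "k \<notin> black D" for \<beta> k
  proof -
    obtain ws j where ws: "set ws \<subseteq> black D" "j \<in> black D" "\<beta> = weyl_word (cartan D) ws (simple j)"
      using \<beta> unfolding positive_roots_def by blast
    have "weyl_word (cartan D) ws (simple j) k = simple j k" using ws(1) k
      by (induction ws) (auto simp: sreflection_def)
    then show ?thesis using ws k by (auto simp: simple_def)
  qed
  then have "two_rho (cartan D) (black D) k = 0" if "k \<notin> black D" for k
    unfolding two_rho_def by (intro sum.neutral ballI) (use that in blast)
  then have "cartan D j k * two_rho (cartan D) (black D) k = 0" for k
    using assms cartan_facts(3) by (cases "k \<in> black D") auto
  then show ?thesis by (simp only: pairing_simple) simp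
qed

end

section \<open>Lattices of invertible commuting elements\<close>

text \<open>The element \<open>K\<^sub>\<alpha>\<close>.  The factors commute in a quantum group, so the choice of an enumeration
  does not matter there; a list is used since the algebra is not commutative.\<close>

definition K_lattice :: "('i::finite, 'k, 'u::ring_1) quantum_group \<Rightarrow> ('i \<Rightarrow> int) \<Rightarrow> 'u" where
  "K_lattice U \<alpha> = prod_list (map (\<lambda>i. unit_power (qK U i) (qKinv U i) (\<alpha> i))
     (SOME xs. distinct xs \<and> set xs = UNIV))"

lemma unit_power_Suc:
  assumes "x * x' = 1" "x' * x = (1::'u::ring_1)"
  shows "unit_power x x' (n + 1) = x * unit_power x x' n"
proof (cases "n \<ge> 0")
  case True then show ?thesis by (simp add: unit_power_def nat_add_distrib)
next
  case False
  then obtain k where k: "n = - int (Suc k)" using negD[of n] by auto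
  have "unit_power x x' (n + 1) = x' ^ k" by (cases k) (simp_all add: unit_power_def k nat_add_distrib)
  then show ?thesis using assms(1) by (simp add: unit_power_def k nat_add_distrib flip: mult.assoc)
qed

lemma unit_power_add:
  assumes "x * x' = 1" "x' * x = (1::'u::ring_1)"
  shows "unit_power x x' (m + n) = unit_power x x' m * unit_power x x' n"
proof (induction m rule: int_induct[where k = 0])
  case base then show ?case by (simp add: unit_power_def)
next
  case (step1 m)
  have "unit_power x x' (m + 1 + n) = x * unit_power x x' (m + n)"
    using unit_power_Suc[OF assms, of "m + n"] by (simp add: ac_simps)
  then show ?case using step1 unit_power_Suc[OF assms, of m] by (simp add: mult.assoc)
next
  case (step2 m)
  have "x * unit_power x x' (m - 1 + n) = unit_power x x' (m + n)"
    using unit_power_Suc[OF assms, of "m - 1 + n"] by (simp add: ac_simps)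
  also have "\<dots> = x * (unit_power x x' (m - 1) * unit_power x x' n)"
    using step2 unit_power_Suc[OF assms, of "m - 1"] by (simp add: mult.assoc)
  finally have "x' * (x * unit_power x x' (m - 1 + n)) = x' * (x * (unit_power x x' (m - 1) * unit_power x x' n))"
    by simp
  then show ?case using assms(2) by (simp flip: mult.assoc)
qed

lemma unit_power_commute:
  assumes "x * y = y * x" "x' * y = y * x'"
  shows "unit_power x x' n * y = y * unit_power x x' n"
proof -
  have "x ^ k * y = y * x ^ k" "x' ^ k * y = y * x' ^ k" for k
    using assms by (induction k) (simp_all add: mult.assoc, metis mult.assoc, metis mult.assoc)
  then show ?thesis by (simp add: unit_power_def)
qed

lemma inverse_commute:
  assumes "x * x' = 1" "x' * x = (1::'u::ring_1)" "x * y = y * x" shows "x' * y = y * x'"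
proof -
  have "x' * y = x' * y * (x * x')" using assms by simp
  also have "\<dots> = x' * (x * y) * x'" unfolding assms(3) by (simp add: mult.assoc)
  also have "\<dots> = y * x'" using assms(2) by (simp flip: mult.assoc)
  finally show ?thesis .
qed

lemma prod_list_mult_commute:
  assumes "\<And>i j. f i * g j = g j * (f i :: 'u::monoid_mult)"
  shows "prod_list (map (\<lambda>i. f i * g i) xs) = prod_list (map f xs) * prod_list (map g xs)"
proof (induction xs)
  case (Cons i xs)
  have "prod_list (map f xs) * g i = g i * prod_list (map f xs)"
  proof (induction xs)
    case (Cons j xs)
    have "f j * (prod_list (map f xs) * g i) = (f j * g i) * prod_list (map f xs)"
      by (simp only: Cons mult.assoc)
    then show ?case by (simp add: assms mult.assoc)
  qed simp
  then have "g i * (prod_list (map f xs) * prod_list (map g xs))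
      = prod_list (map f xs) * (g i * prod_list (map g xs))"
    by (simp only: mult.assoc[symmetric])
  then show ?case using Cons by (simp add: mult.assoc)
qed simp

text \<open>For comparing \<open>f (K\<^sub>\<alpha>)\<close> with \<open>K\<^bsub>s(\<alpha>)\<^esub>\<close> on simple roots only.\<close>

lemma lattice_hom_eq:
  fixes f g :: "('i::finite \<Rightarrow> int) \<Rightarrow> 'u::ring_1"
  assumes f: "f 0 = 1" "\<And>\<alpha> \<beta>. f (\<alpha> + \<beta>) = f \<alpha> * f \<beta>"
    and g: "g 0 = 1" "\<And>\<alpha> \<beta>. g (\<alpha> + \<beta>) = g \<alpha> * g \<beta>"
    and eq: "\<And>i. f (simple i) = g (simple i)"
  shows "f \<alpha> = g \<alpha>"
proof (induction \<alpha> rule: lattice_induct)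
  case (minus \<alpha>)
  have "f (- \<alpha>) * f \<alpha> = 1" "g \<alpha> * g (- \<alpha>) = 1"
    using f(2)[of "- \<alpha>" \<alpha>] g(2)[of \<alpha> "- \<alpha>"] f(1) g(1) by simp_all
  then show ?case using minus by (metis mult.assoc mult_1 mult.right_neutral)
qed (simp_all only: f g eq)


section \<open>Relations in the quantum group\<close>

locale quantum_group_setup =
  fixes D :: "'i::finite satake" and B :: "'k::alg_closed_field base_field"
    and U :: "('i, 'k, 'u::ring_1) quantum_group"
  assumes base: "is_base_field B" and satake: "is_satake D" and quantum: "is_quantum_group D B U"
begin

sublocale algebra "usc U"
  using quantum by unfold_locales (simp add: is_quantum_group_def)

abbreviation "C \<equiv> cartan D"
abbreviation "sc \<equiv> usc U"
abbreviation "E \<equiv> qE U"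
abbreviation "F \<equiv> qF U"
abbreviation "K \<equiv> qK U"
abbreviation "K' \<equiv> qKinv U"
abbreviation "q \<equiv> qi D B"

lemma q_nonzero: "q i \<noteq> 0"
  using qq_neq_0[OF base] by (simp add: qi_def)

lemma q_power_neq_1: "n > 0 \<Longrightarrow> q i ^ n \<noteq> 1"
  using qq_power_neq_1[OF base, of "symm D i * n"] cartan_facts(4)[OF satake, of i]
  by (simp add: qi_def power_mult)

text \<open>Transport of the relators along the presentation.\<close>

lemma relations:
  "K i * K' i = 1" "K' i * K i = 1" "K i * K j = K j * K i"
  "K i * E j = sc (q i powi C i j) (E j * K i)"
  "K i * F j = sc (q i powi (- C i j)) (F j * K i)"
  "E i * F i - F i * E i = sc (inverse (q i - inverse (q i))) (K i - K' i)"
  "i \<noteq> j \<Longrightarrow> E i * F j = F j * E i"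
  "i \<noteq> j \<Longrightarrow> serre sc (q i) (C i j) (E i) (E j) = 0"
  "i \<noteq> j \<Longrightarrow> serre sc (q i) (C i j) (F i) (F j) = 0"
proof -
  obtain \<pi> :: "('i qgen word \<Rightarrow>\<^sub>0 'k) \<Rightarrow> 'u" where \<pi>: "algebra_hom_on free_scale sc UNIV \<pi>"
      "\<forall>i. \<pi> (free_gen (GE i)) = E i \<and> \<pi> (free_gen (GF i)) = F i \<and>
             \<pi> (free_gen (GK i)) = K i \<and> \<pi> (free_gen (GKinv i)) = K' i"
      "{x. \<pi> x = 0} = ideal_generated
          (quantum_relators D B free_scale
             (\<lambda>i. free_gen (GE i)) (\<lambda>i. free_gen (GF i))
             (\<lambda>i. free_gen (GK i)) (\<lambda>i. free_gen (GKinv i)))"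
    using quantum unfolding is_quantum_group_def presented_by_quantum_relators_def by blast
  let ?R = "quantum_relators D B free_scale
             (\<lambda>i. free_gen (GE i)) (\<lambda>i. free_gen (GF i))
             (\<lambda>i. free_gen (GK i)) (\<lambda>i. free_gen (GKinv i))"
  let ?e = "\<lambda>i. free_gen (GE i)" and ?f = "\<lambda>i. free_gen (GF i)"
    and ?k = "\<lambda>i. free_gen (GK i)" and ?ki = "\<lambda>i. free_gen (GKinv i)"
  have R: "\<pi> r = 0" if "r \<in> ?R" for r
    using ideal_generated.base[OF that] \<pi>(3) by blast
  have add: "\<pi> (x + y) = \<pi> x + \<pi> y" and mult: "\<pi> (x * y) = \<pi> x * \<pi> y"
      and scale: "\<pi> (free_scale c x) = sc c (\<pi> x)" and one: "\<pi> 1 = 1" for x y c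
    using \<pi>(1) by (simp_all add: algebra_hom_on_def)
  note minus = additive_uminus[of \<pi>, OF add]
  have power: "\<pi> (x ^ n) = \<pi> x ^ n" for x n by (induction n) (simp_all add: one mult)
  have sum: "\<pi> (\<Sum>r\<in>S. f r) = (\<Sum>r\<in>S. \<pi> (f r))" for S :: "nat set" and f
    by (induction S rule: infinite_finite_induct) (simp_all add: minus add)
  have serre: "\<pi> (serre free_scale p a x y) = serre sc p a (\<pi> x) (\<pi> y)" for p a x y
    by (simp add: serre_def divided_power_def sum mult power scale minus one)
  note image = add mult scale one minus power serre \<pi>(2)[THEN spec, THEN conjunct1]
    \<pi>(2)[THEN spec, THEN conjunct2, THEN conjunct1] \<pi>(2)[THEN spec, THEN conjunct2, THEN conjunct2, THEN conjunct1]
    \<pi>(2)[THEN spec, THEN conjunct2, THEN conjunct2, THEN conjunct2]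
  have "?k i * ?ki i - 1 \<in> ?R" unfolding quantum_relators_def by blast
  from R[OF this] show "K i * K' i = 1" by (simp add: image)
  have "?ki i * ?k i - 1 \<in> ?R" unfolding quantum_relators_def by blast
  from R[OF this] show "K' i * K i = 1" by (simp add: image)
  have "?k i * ?k j - ?k j * ?k i \<in> ?R"
    unfolding quantum_relators_def by blast
  from R[OF this] show "K i * K j = K j * K i" by (simp add: image)
  have "?k i * ?e j - free_scale (q i powi C i j) (?e j * ?k i) \<in> ?R"
    unfolding quantum_relators_def by blast
  from R[OF this] show "K i * E j = sc (q i powi C i j) (E j * K i)" by (simp add: image)
  have "?k i * ?f j - free_scale (q i powi (- C i j)) (?f j * ?k i) \<in> ?R"
    unfolding quantum_relators_def by blast
  from R[OF this] show "K i * F j = sc (q i powi (- C i j)) (F j * K i)" by (simp add: image)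
  have "?e i * ?f i - ?f i * ?e i
      - free_scale (inverse (q i - inverse (q i))) (?k i - ?ki i) \<in> ?R"
    unfolding quantum_relators_def by blast
  from R[OF this] show "E i * F i - F i * E i = sc (inverse (q i - inverse (q i))) (K i - K' i)"
    by (simp add: image)
  assume "i \<noteq> j"
  then have "?e i * ?f j - ?f j * ?e i \<in> ?R"
    unfolding quantum_relators_def by blast
  from R[OF this] show "E i * F j = F j * E i" by (simp add: image)
  have "serre free_scale (q i) (C i j) (?e i) (?e j) \<in> ?R"
    using \<open>i \<noteq> j\<close> unfolding quantum_relators_def by blast
  from R[OF this] show "serre sc (q i) (C i j) (E i) (E j) = 0" by (simp add: image)
  have "serre free_scale (q i) (C i j) (?f i) (?f j) \<in> ?R"
    using \<open>i \<noteq> j\<close> unfolding quantum_relators_def by blast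
  from R[OF this] show "serre sc (q i) (C i j) (F i) (F j) = 0" by (simp add: image)
qed

lemma serre_sum:
  assumes "serre sc p (- int n) x y = 0"
  shows "(\<Sum>r\<le>Suc n. sc ((-1) ^ r / (qfact p r * qfact p (Suc n - r))) (x ^ (Suc n - r) * y * x ^ r)) = 0"
proof -
  have "(- 1) ^ r * z = sc ((-1) ^ r) z" for r z by (cases "even r") simp_all
  then have "serre sc p (- int n) x y
      = (\<Sum>r\<le>Suc n. sc ((-1) ^ r / (qfact p r * qfact p (Suc n - r))) (x ^ (Suc n - r) * y * x ^ r))"
    unfolding serre_def divided_power_def
    by (intro sum.cong) (simp_all add: nat_add_distrib field_simps)
  then show ?thesis using assms by simp
qed

lemma funpow_mult: "((\<lambda>x. y * x) ^^ n) z = y ^ n * z" "((\<lambda>x. x * y) ^^ n) z = z * y ^ n"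
  for y z :: "'a::monoid_mult"
proof -
  show "((\<lambda>x. y * x) ^^ n) z = y ^ n * z" by (induction n) (simp_all add: mult.assoc)
  show "((\<lambda>x. x * y) ^^ n) z = z * y ^ n" by (induction n) (simp_all add: mult.assoc power_commutes)
qed

lemma inverse_commutation:
  assumes "k * k' = 1" "k' * k = 1" "k * v = sc c (v * k)" "c \<noteq> 0"
  shows "k' * v = sc (inverse c) (v * k')"
proof -
  have "v * k' = k' * (k * v) * k'" using assms(2) by (simp flip: mult.assoc)
  also have "\<dots> = sc c (k' * v)" unfolding assms(3) using assms(1) by (simp add: mult.assoc)
  finally show ?thesis using assms(4) by simp
qed

text \<open>The relations that \<open>torsion_string\<close> requires of \<open>X = F\<^sub>j\<close> and \<open>Y = s E\<^sub>j K\<^sub>j\<^sup>-\<^sup>1\<close>.  They are symmetric under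
  exchanging \<open>X\<close> and \<open>Y\<close> and replacing \<open>q\<close> by its inverse, up to the last scalar, so
  strings can start at either end.\<close>

lemma sl2_relations:
  fixes j s defines "Y \<equiv> sc s (E j * K' j)"
  shows "K j * F j = sc (q j powi (-2)) (F j * K j)" "K j * Y = sc (q j powi 2) (Y * K j)"
    "Y * F j = sc (q j powi 2) (F j * Y)
       + sc (s * q j powi 2 * inverse (q j - inverse (q j))) (1 - K' j * K' j)"
proof -
  let ?c = "inverse (q j - inverse (q j))"
  show KF: "K j * F j = sc (q j powi (-2)) (F j * K j)"
    using relations(5)[of j j] cartan_facts(1)[OF satake, of j] by simp
  have "K j * (E j * K' j) = sc (q j powi 2) (E j * K j) * K' j"
    using relations(4)[of j j] cartan_facts(1)[OF satake, of j] by (simp flip: mult.assoc)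
  then show "K j * Y = sc (q j powi 2) (Y * K j)"
    by (simp add: Y_def relations(1,2) mult.assoc mult.commute)
  have KF': "K' j * F j = sc (q j powi 2) (F j * K' j)"
    using inverse_commutation[OF relations(1,2) KF] q_nonzero[of j] by (simp add: power_int_minus)
  have "E j * K' j * F j = sc (q j powi 2) (E j * F j * K' j)"
    unfolding mult.assoc KF' by simp
  also have "E j * F j = F j * E j + sc ?c (K j - K' j)"
    using relations(6)[of j] by (simp add: algebra_simps)
  finally have "E j * K' j * F j = sc (q j powi 2) (F j * (E j * K' j)) + sc (q j powi 2 * ?c) (1 - K' j * K' j)"
    by (simp add: distrib_right left_diff_distrib relations(1) scale_right_distrib mult.assoc)
  then show "Y * F j = sc (q j powi 2) (F j * Y) + sc (s * q j powi 2 * ?c) (1 - K' j * K' j)"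
    unfolding Y_def scale_mult_left
    by (simp add: scale_right_distrib mult.commute mult.left_commute)
qed

text \<open>Such a \<open>v\<close>, for instance \<open>F i\<close>, is killed by the adjoint action of \<open>E j\<close>, and \<open>F j\<close> moves it along
  a string that ends by the Serre relation.\<close>

lemma torsion_commuting_E:
  assumes Ev: "E j * v = v * E j" and Kv: "K j * v = sc (q j powi (int n)) (v * K j)"
    and serre: "serre sc (q j) (- int n) (F j) v = 0"
  shows "torsion sc (F j + sc s (E j * K' j)) b v"
proof -
  note p = q_nonzero[of j] q_power_neq_1[of _ j]
  define w where "w = rec_nat v (\<lambda>r x. x * F j - sc (q j powi (int n - 2 * int r)) (F j * x))"
  have w: "w 0 = v" "w (Suc r) = w r * F j - sc (q j powi (int n - 2 * int r)) (F j * w r)" for r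
    by (simp_all add: w_def)
  have "w (Suc n) = 0"
  proof (rule iterated_qcommutator_eq_0[of "q j" "\<lambda>x. x * F j" "\<lambda>x. F j * x" w n])
    let ?g = "\<lambda>r. sc ((-1) ^ r / (qfact (q j) r * qfact (q j) (Suc n - r))) (F j ^ r * v * F j ^ (Suc n - r))"
    have "(\<Sum>r\<le>Suc n. ?g r) = (\<Sum>r\<le>Suc n. ?g (Suc n - r))"
      using sum.nat_diff_reindex[of ?g "Suc (Suc n)"] by (simp add: lessThan_Suc_atMost)
    also have "\<dots> = sc ((-1) ^ Suc n) (\<Sum>r\<le>Suc n.
        sc ((-1) ^ r / (qfact (q j) r * qfact (q j) (Suc n - r))) (F j ^ (Suc n - r) * v * F j ^ r))"
      unfolding scale_sum_right
    proof (intro sum.cong refl)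
      fix r assume r: "r \<in> {..Suc n}"
      then have "(-1) ^ (Suc n - r) = (-1) ^ Suc n * ((-1) ^ r :: 'k)"
        by (simp add: power_diff)
           (cases "even r"; simp)
      with r show "?g (Suc n - r) = sc ((-1) ^ Suc n)
        (sc ((-1) ^ r / (qfact (q j) r * qfact (q j) (Suc n - r))) (F j ^ (Suc n - r) * v * F j ^ r))"
        by (simp add: mult.commute)
    qed
    finally show "(\<Sum>r\<le>Suc n. sc ((-1) ^ r / (qfact (q j) r * qfact (q j) (Suc n - r)))
        (((\<lambda>x. x * F j) ^^ (Suc n - r)) (((\<lambda>x. F j * x) ^^ r) (w 0)))) = 0"
      using serre_sum[OF serre] by (simp add: funpow_mult w mult.assoc)
  qed (use p w in \<open>simp_all add: distrib_left distrib_right mult.assoc\<close>)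
  moreover have "v * sc s (E j * K' j) = sc (q j powi (int n)) (sc s (E j * K' j) * v)"
  proof -
    have "K' j * v = sc (inverse (q j powi (int n))) (v * K' j)"
      using inverse_commutation[OF relations(1,2) Kv] p(1) by simp
    then have "sc (q j powi (int n)) (E j * K' j * v) = E j * v * K' j"
      using p(1) by (simp add: mult.assoc)
    then have "v * (E j * K' j) = sc (q j powi (int n)) (E j * K' j * v)"
      using Ev by (simp add: mult.assoc[symmetric])
    then show ?thesis by (simp add: mult.commute)
  qed
  ultimately show ?thesis
    using torsion_string[OF p(1) relations(1,2) sl2_relations, where v = w and n = "int n" and N = "Suc n"]
      Kv w by simp
qed

text \<open>The opposite end of a string, with the roles of \<open>E j\<close> and \<open>F j\<close> exchanged and \<open>q\<close> inverted.  The
  factor \<open>k\<close>, in the application \<open>K\<^sub>i\<^sup>-\<^sup>1\<close>, twists the commutators so that \<open>z k\<close> is killed by the adjoint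
  action of \<open>F j\<close>.\<close>

lemma torsion_commuting_F:
  assumes Fv: "F j * z = z * F j" and Kv: "K j * z = sc (q j powi (- int n)) (z * K j)"
    and serre: "serre sc (q j) (- int n) (E j) z = 0"
    and kE: "k * E j = sc (q j powi (int n)) (E j * k)" and kF: "k * F j = sc (q j powi (- int n)) (F j * k)"
    and kK: "k * K j = K j * k"
  shows "torsion sc (F j + sc s (E j * K' j)) b (z * k)"
proof -
  note p = q_nonzero[of j] q_power_neq_1[of _ j]
  let ?p = "inverse (q j)"
  have powi: "?p powi a = q j powi (- a)" for a by (simp add: power_int_minus power_int_inverse)
  have add: "q j powi (a + a') = q j powi a * q j powi a'" for a a'
    using p(1) by (simp add: power_int_add)
  have kK': "k * K' j = K' j * k"
    using inverse_commute[OF relations(1,2) kK[symmetric]] by simp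
  define w where "w = rec_nat z (\<lambda>r x. E j * x - sc (q j powi (int n - 2 * int r)) (x * E j))"
  have w: "w 0 = z" "w (Suc r) = E j * w r - sc (q j powi (int n - 2 * int r)) (w r * E j)" for r
    by (simp_all add: w_def)
  have w0: "w (Suc n) = 0"
  proof (rule iterated_qcommutator_eq_0[of "q j" "\<lambda>x. E j * x" "\<lambda>x. x * E j" w n])
    show "(\<Sum>r\<le>Suc n. sc ((-1) ^ r / (qfact (q j) r * qfact (q j) (Suc n - r)))
        (((\<lambda>x. E j * x) ^^ (Suc n - r)) (((\<lambda>x. x * E j) ^^ r) (w 0)))) = 0"
      using serre_sum[OF serre] by (simp add: funpow_mult w mult.assoc)
  qed (use p w in \<open>simp_all add: distrib_left distrib_right mult.assoc\<close>)
  \<comment> \<open>The string through \<open>z k\<close>: moving \<open>k\<close> and the factors \<open>K\<^sub>j\<^sup>-\<^sup>1\<close> to the right turns its members into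
    the iterated commutators \<open>w r\<close> with \<open>E j\<close>.\<close>
  define v where "v r = sc ((- s) ^ r) (w r * k * K' j ^ r)" for r
  have KE: "K j * E j = sc (q j powi 2) (E j * K j)"
    using relations(4)[of j j] cartan_facts(1)[OF satake, of j] by simp
  have K'E: "K' j * E j = sc (q j powi (-2)) (E j * K' j)"
    using inverse_commutation[OF relations(1,2) KE] p(1) by (simp add: power_int_minus)
  have K'E_pow: "K' j ^ r * E j = sc (q j powi (- 2 * int r)) (E j * K' j ^ r)" for r
  proof (induction r)
    case (Suc r)
    have "K' j ^ Suc r * E j = sc (q j powi (- 2 * int r)) (K' j * E j * K' j ^ r)"
      using Suc by (simp add: mult.assoc)
    also have "\<dots> = sc (q j powi (- 2 * int r) * q j powi (-2)) (E j * K' j ^ Suc r)"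
      unfolding K'E by (simp add: mult.assoc)
    also have "q j powi (- 2 * int r) * q j powi (-2) = q j powi (- 2 * int (Suc r))"
      by (simp only: add[symmetric]) (simp add: algebra_simps)
    finally show ?case .
  qed simp
  have Kw: "K j * w r = sc (q j powi (2 * int r - int n)) (w r * K j)" for r
  proof (induction r)
    case 0 then show ?case using Kv by (simp add: w)
  next
    case (Suc r)
    have e: "q j powi (2 * int (Suc r) - int n) = q j powi 2 * q j powi (2 * int r - int n)"
      by (simp only: add[symmetric]) (simp add: algebra_simps)
    have 1: "K j * (E j * w r) = sc (q j powi (2 * int (Suc r) - int n)) (E j * w r * K j)"
    proof -
      have "K j * (E j * w r) = sc (q j powi 2) (E j * (K j * w r))"
        using KE by (simp flip: mult.assoc)
      then show ?thesis unfolding Suc e by (simp add: mult.assoc)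
    qed
    have 2: "K j * (w r * E j) = sc (q j powi (2 * int (Suc r) - int n)) (w r * E j * K j)"
    proof -
      have "K j * (w r * E j) = sc (q j powi (2 * int r - int n)) (w r * (K j * E j))"
        using Suc by (simp flip: mult.assoc)
      then show ?thesis unfolding KE e by (simp add: mult.assoc mult.commute)
    qed
    show ?case unfolding w(2) right_diff_distrib scale_mult_right 1 2
      by (simp add: left_diff_distrib scale_right_diff_distrib mult.commute)
  qed
  have K'w: "K' j * w r = sc (q j powi (int n - 2 * int r)) (w r * K' j)" for r
    using inverse_commutation[OF relations(1,2) Kw] p(1)
    by (simp add: power_int_minus[symmetric])
  have K'k: "K' j * k * K' j ^ r = k * K' j ^ Suc r" for r using kK' by (simp add: mult.assoc[symmetric])
  have Kk: "K j * k = k * K j" using kK by simp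
  have step: "v (Suc r) = v r * sc s (E j * K' j)
      - sc (?p powi (int n - 2 * int r)) (sc s (E j * K' j) * v r)" for r
  proof -
    let ?a = "q j powi (int n - 2 * int r)"
    have "k * K' j ^ r * E j = sc (q j powi (- 2 * int r)) (k * E j * K' j ^ r)"
      unfolding mult.assoc K'E_pow by simp
    also have "\<dots> = sc (q j powi (- 2 * int r) * q j powi (int n)) (E j * k * K' j ^ r)"
      unfolding kE by (simp add: mult.assoc)
    also have "q j powi (- 2 * int r) * q j powi (int n) = ?a"
      by (simp only: add[symmetric]) (simp add: algebra_simps)
    finally have "k * K' j ^ r * E j = sc ?a (E j * k * K' j ^ r)" .
    moreover have "w r * k * K' j ^ r * (E j * K' j) = w r * (k * K' j ^ r * E j) * K' j"
      by (simp only: mult.assoc)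
    ultimately have 1: "w r * k * K' j ^ r * (E j * K' j) = sc ?a (w r * E j * k * K' j ^ Suc r)"
      by (simp add: mult.assoc power_commutes)
    have "E j * K' j * (w r * k * K' j ^ r) = E j * (K' j * w r) * k * K' j ^ r"
      by (simp add: mult.assoc)
    also have "\<dots> = sc ?a (E j * w r * (K' j * k * K' j ^ r))"
      unfolding K'w by (simp add: mult.assoc)
    finally have 2: "E j * K' j * (w r * k * K' j ^ r) = sc ?a (E j * w r * k * K' j ^ Suc r)"
      unfolding K'k by (simp add: mult.assoc)
    have 3: "?p powi (int n - 2 * int r) * ?a = 1"
      unfolding powi by (simp only: add[symmetric]) simp
    have "v r * sc s (E j * K' j) - sc (?p powi (int n - 2 * int r)) (sc s (E j * K' j) * v r)
      = sc ((- s) ^ r * s * ?a) (w r * E j * k * K' j ^ Suc r)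
        - sc ((- s) ^ r * s * (?p powi (int n - 2 * int r) * ?a)) (E j * w r * k * K' j ^ Suc r)"
      unfolding v_def scale_mult_left scale_mult_right 1 2 by (simp add: ac_simps)
    also have "\<dots> = sc ((- s) ^ Suc r) ((E j * w r - sc ?a (w r * E j)) * k * K' j ^ Suc r)"
      unfolding 3 by (simp add: left_diff_distrib scale_right_diff_distrib ac_simps)
    finally show ?thesis unfolding v_def w(2) by simp
  qed
  have "torsion sc (sc s (E j * K' j) + F j) b (v 0)"
  proof (rule torsion_string[of ?p "K j" "K' j" _ _ "- s * inverse (q j - inverse (q j))" v "int n" "Suc n"])
    note rel = sl2_relations(1)[of j] sl2_relations(2,3)[where j = j and s = s]
    show "K j * sc s (E j * K' j) = sc (?p powi (- 2)) (sc s (E j * K' j) * K j)"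
      using rel(2) by (simp only: powi minus_minus)
    show "K j * F j = sc (?p powi 2) (F j * K j)" using rel(1) by (simp only: powi)
    have 1: "?p powi 2 * q j powi 2 = 1" unfolding powi by (simp only: add[symmetric]) simp
    have "sc (?p powi 2) (sc s (E j * K' j) * F j) = F j * sc s (E j * K' j)
       + sc (s * inverse (q j - inverse (q j))) (1 - K' j * K' j)"
    proof -
      have e: "?p powi 2 * (s * q j powi 2 * d) = s * d" for d
        using 1 by (metis mult.assoc mult.left_commute mult_1)
      then show ?thesis unfolding rel(3) scale_right_distrib scale_scale 1 e by (simp only: scale_one)
    qed
    then show "F j * sc s (E j * K' j) = sc (?p powi 2) (sc s (E j * K' j) * F j)
        + sc (- s * inverse (q j - inverse (q j))) (1 - K' j * K' j)"
      by simp
    have "K j * (z * k) = sc (?p powi int n) (z * (K j * k))"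
      unfolding powi mult.assoc[symmetric] Kv by simp
    then show "K j * v 0 = sc (?p powi int n) (v 0 * K j)"
      unfolding Kk by (simp only: v_def w power_0 scale_one mult_1_right mult.assoc)
    have "F j * z * k = z * (F j * k)" using Fv by (simp add: mult.assoc)
    moreover have "z * k * F j = sc (?p powi int n) (z * (F j * k))"
      unfolding powi mult.assoc kF by simp
    ultimately have "sc (?p powi int n) (F j * z * k) = z * k * F j" by simp
    then show "v 0 * F j = sc (?p powi int n) (F j * v 0)" by (simp add: v_def w mult.assoc)
    show "v (Suc n) = 0" by (simp add: v_def w0)
  qed (use p step relations in auto)
  then show ?thesis by (simp add: v_def w add.commute)
qed

end

section \<open>The automorphism \<open>T\<^bsub>w\<^sub>\<bullet>\<^esub> \<tau>\<close>\<close>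

lemma algebra_hom_onD:
  assumes "algebra_hom_on sc sc' UNIV f"
  shows "f (x + y) = f x + f y" "f (x * y) = f x * f y" "f (sc c x) = sc' c (f x)" "f 1 = 1"
    "f 0 = 0" "f (- x) = - f x" "f (x - y) = f x - f y"
proof -
  show 1: "f (x + y) = f x + f y" "f (x * y) = f x * f y" "f (sc c x) = sc' c (f x)" "f 1 = 1" for x y c
    using assms by (simp_all add: algebra_hom_on_def)
  show "f 0 = 0" "f (- x) = - f x" "f (x - y) = f x - f y"
    using additive_uminus[of f] 1 by simp_all
qed

lemma algebra_hom_on_comp:
  "algebra_hom_on sc sc' UNIV f \<Longrightarrow> algebra_hom_on sc' sc'' UNIV g \<Longrightarrow> algebra_hom_on sc sc'' UNIV (g \<circ> f)"
  by (simp add: algebra_hom_on_def)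

lemma hom_inverse:
  assumes "algebra_hom_on sc sc' UNIV f" "x * x' = 1" "x' * x = 1" "f x * y' = 1" "y' * f x = 1"
  shows "f x' = y'"
proof -
  have "f x' = f x' * (f x * y')" using assms by simp
  also have "\<dots> = f (x' * x) * y'" using algebra_hom_onD(2)[OF assms(1)] by (simp add: mult.assoc)
  finally show ?thesis using assms algebra_hom_onD(4)[OF assms(1)] by simp
qed

context quantum_group_setup begin

lemma K_commute:
  "K i * K j = K j * K i" "K' i * K j = K j * K' i" "K i * K' j = K' j * K i" "K' i * K' j = K' j * K' i"
proof -
  show 1: "K i * K j = K j * K i" for i j by (rule relations)
  show 2: "K' i * K j = K j * K' i" for i j by (rule inverse_commute[OF relations(1,2) 1])
  show 3: "K i * K' j = K' j * K i" for i j using 2 by simp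
  show "K' i * K' j = K' j * K' i" by (rule inverse_commute[OF relations(1,2) 3])
qed

lemma K_lattice_hom: "K_lattice U 0 = 1" "K_lattice U (\<alpha> + \<beta>) = K_lattice U \<alpha> * K_lattice U \<beta>"
proof -
  show "K_lattice U 0 = 1"
    by (simp add: K_lattice_def unit_power_def map_replicate_const flip: replicate_length_same)
  show "K_lattice U (\<alpha> + \<beta>) = K_lattice U \<alpha> * K_lattice U \<beta>"
    unfolding K_lattice_def plus_fun_apply unit_power_add[OF relations(1,2)]
    by (rule prod_list_mult_commute) (intro unit_power_commute unit_power_commute[symmetric] K_commute)
qed

lemma K_lattice_simple: "K_lattice U (simple i) = K i" "K_lattice U (- simple i) = K' i"
proof -
  obtain xs :: "'i list" where xs: "distinct xs" "set xs = UNIV"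
    using finite_distinct_list[OF finite] by blast
  let ?xs = "SOME xs :: 'i list. distinct xs \<and> set xs = UNIV"
  have *: "distinct ?xs \<and> set ?xs = UNIV" by (rule someI[of _ xs]) (use xs in blast)
  have "distinct xs \<Longrightarrow> prod_list (map (\<lambda>j. unit_power (K j) (K' j) (simple i j)) xs)
      = (if i \<in> set xs then K i else 1)" for xs
    by (induction xs) (auto simp: simple_def unit_power_def)
  from this[of ?xs] show 1: "K_lattice U (simple i) = K i" using * by (simp add: K_lattice_def)
  have "K_lattice U (- simple i) * K i = 1"
    using K_lattice_hom(2)[of "- simple i" "simple i"] K_lattice_hom(1) 1 by simp
  then have "K_lattice U (- simple i) * (K i * K' i) = K' i" by (simp flip: mult.assoc)
  then show "K_lattice U (- simple i) = K' i" by (simp add: relations)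
qed

lemma lusztig_hom: "algebra_hom_on sc sc UNIV (lusztig U i)"
  using quantum by (simp add: is_quantum_group_def is_lusztig_aut_def algebra_aut_def Let_def)

lemma lusztig_K: "lusztig U i (K j) = K j * unit_power (K i) (K' i) (- C i j)"
  using quantum unfolding is_quantum_group_def is_lusztig_aut_def Let_def by blast

lemma K_lattice_multiple: "K_lattice U (\<lambda>j. c * simple i j) = unit_power (K i) (K' i) c"
proof (induction c rule: int_induct[where k = 0])
  case base
  have "(\<lambda>j. 0 * simple i j) = 0" by auto
  then show ?case by (simp add: K_lattice_hom unit_power_def)
next
  case (step1 c)
  have "(\<lambda>j. (c + 1) * simple i j) = simple i + (\<lambda>j. c * simple i j)" by (auto simp: algebra_simps)
  then show ?case using step1
    by (simp only: K_lattice_hom K_lattice_simple unit_power_Suc[OF relations(1,2)])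
next
  case (step2 c)
  have "(\<lambda>j. (c - 1) * simple i j) = - simple i + (\<lambda>j. c * simple i j)" by (auto simp: algebra_simps)
  then have "K_lattice U (\<lambda>j. (c - 1) * simple i j) = K' i * unit_power (K i) (K' i) c"
    using step2 by (simp only: K_lattice_hom K_lattice_simple)
  also have "\<dots> = K' i * K i * unit_power (K i) (K' i) (c - 1)"
    using unit_power_Suc[OF relations(1,2), of i "c - 1"] by (simp add: mult.assoc)
  finally show ?case by (simp add: relations)
qed

lemma lusztig_K_lattice: "lusztig U i (K_lattice U \<alpha>) = K_lattice U (sreflection C i \<alpha>)"
proof (rule lattice_hom_eq[of "\<lambda>\<alpha>. lusztig U i (K_lattice U \<alpha>)" "\<lambda>\<alpha>. K_lattice U (sreflection C i \<alpha>)"])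
  note hom = algebra_hom_onD[OF lusztig_hom]
  show "lusztig U i (K_lattice U 0) = 1" by (simp only: K_lattice_hom hom)
  show "K_lattice U (sreflection C i 0) = 1"
    by (simp only: additive_uminus[of "sreflection C i", OF sreflection_add] K_lattice_hom)
  show "lusztig U i (K_lattice U (\<alpha> + \<beta>)) = lusztig U i (K_lattice U \<alpha>) * lusztig U i (K_lattice U \<beta>)" for \<alpha> \<beta>
    by (simp only: K_lattice_hom hom)
  show "K_lattice U (sreflection C i (\<alpha> + \<beta>)) = K_lattice U (sreflection C i \<alpha>) * K_lattice U (sreflection C i \<beta>)"
    for \<alpha> \<beta> by (simp only: K_lattice_hom sreflection_add)
  fix j
  have "sreflection C i (simple j) = simple j + (\<lambda>k. (- C i j) * simple i k)"
    unfolding sreflection_eq pairing_simple_simple by auto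
  then show "lusztig U i (K_lattice U (simple j)) = K_lattice U (sreflection C i (simple j))"
    by (simp only: K_lattice_simple lusztig_K K_lattice_hom K_lattice_multiple)
qed

lemma lusztig_wblack_hom: "algebra_hom_on sc sc UNIV (lusztig_wblack D U)"
proof -
  have "algebra_hom_on sc sc UNIV (foldr (\<lambda>i T. lusztig U i \<circ> T) ws id)" for ws
  proof (induction ws)
    case Nil then show ?case by (simp add: algebra_hom_on_def)
  next
    case (Cons i ws)
    then show ?case using algebra_hom_on_comp[OF Cons lusztig_hom, of i] by (simp add: o_def)
  qed
  then show ?thesis by (simp add: lusztig_wblack_def)
qed

lemma lusztig_wblack_K_lattice: "lusztig_wblack D U (K_lattice U \<alpha>) = K_lattice U (wblack D \<alpha>)"
proof -
  have "foldr (\<lambda>i T. lusztig U i \<circ> T) ws id (K_lattice U \<alpha>) = K_lattice U (weyl_word C ws \<alpha>)" for ws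
    by (induction ws) (simp_all add: lusztig_K_lattice)
  then show ?thesis by (simp add: lusztig_wblack_def wblack_def)
qed

text \<open>All reflections in the reduced word belong to vertices that are not joined to \<open>j\<close>.\<close>

lemma lusztig_wblack_orthogonal:
  assumes "\<forall>i\<in>black D. C i j = 0"
  shows "lusztig_wblack D U (E j) = E j" "lusztig_wblack D U (F j) = F j" "lusztig_wblack D U (K j) = K j"
proof -
  have "lusztig U i (E j) = E j \<and> lusztig U i (F j) = F j" if "i \<in> black D" for i
  proof -
    have 0: "C i j = 0" using assms that by blast
    then have ji: "j \<noteq> i" using cartan_facts(1)[OF satake, of i] by auto
    have "lusztig U i (E j) = (\<Sum>r\<le>nat (- C i j). sc ((- 1) ^ r * inverse (q i) ^ r)
            (divided_power sc (q i) (E i) (nat (- C i j) - r) * E j * divided_power sc (q i) (E i) r))"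
      and "lusztig U i (F j) = (\<Sum>r\<le>nat (- C i j). sc ((- 1) ^ r * q i ^ r)
            (divided_power sc (q i) (F i) r * F j * divided_power sc (q i) (F i) (nat (- C i j) - r)))"
      using quantum ji unfolding is_quantum_group_def is_lusztig_aut_def Let_def by blast+
    then show ?thesis by (simp add: 0 divided_power_def qfact_def)
  qed
  then have "set ws \<subseteq> black D \<Longrightarrow> foldr (\<lambda>i T. lusztig U i \<circ> T) ws id (E j) = E j \<and>
      foldr (\<lambda>i T. lusztig U i \<circ> T) ws id (F j) = F j" for ws
    by (induction ws) auto
  then show "lusztig_wblack D U (E j) = E j" "lusztig_wblack D U (F j) = F j"
    using set_wword[OF satake] by (simp_all add: lusztig_wblack_def)
  show "lusztig_wblack D U (K j) = K j"
    using lusztig_wblack_K_lattice[of "simple j"] wblack_orthogonal[OF satake assms]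
    by (simp add: K_lattice_simple)
qed

lemma utau_hom: "algebra_hom_on sc sc UNIV (utau U)"
  and utau_gen: "utau U (E i) = E (tau D i)" "utau U (F i) = F (tau D i)" "utau U (K i) = K (tau D i)"
  and omega_hom: "algebra_hom_on sc sc UNIV (omega U)"
  and omega_gen: "omega U (E i) = F i" "omega U (F i) = E i" "omega U (K i) = K' i"
  using quantum by (simp_all add: is_quantum_group_def algebra_aut_def)

lemma antipode_antihom:
  "antipode U (x + y) = antipode U x + antipode U y" "antipode U (x * y) = antipode U y * antipode U x"
  "antipode U (sc c x) = sc c (antipode U x)" "antipode U 1 = 1"
  and antipode_gen: "antipode U (E i) = - (K' i * E i)" "antipode U (F i) = - (F i * K i)" "antipode U (K i) = K' i"
  using quantum by (simp_all add: is_quantum_group_def algebra_antiaut_def)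

text \<open>The automorphism \<open>T\<^bsub>w\<^sub>\<bullet>\<^esub> \<tau>\<close>.  It relates the two summands of \<open>B\<^sub>i\<close>, since
  \<open>T\<^bsub>w\<^sub>\<bullet>\<^esub>(E\<^bsub>\<tau>(i)\<^esub>)\<close> is the image of \<open>E\<^sub>i\<close>, and it occurs in the anti-automorphism.\<close>

definition tw :: "'u \<Rightarrow> 'u" where
  "tw = lusztig_wblack D U \<circ> utau U"

lemma tw_hom: "algebra_hom_on sc sc UNIV tw"
  unfolding tw_def by (rule algebra_hom_on_comp[OF utau_hom lusztig_wblack_hom])

lemmas tw_simps = algebra_hom_onD[OF tw_hom]

lemma tw_K_lattice: "tw (K_lattice U \<alpha>) = K_lattice U (wblack D (\<alpha> \<circ> tau D))"
proof -
  have "utau U (K_lattice U \<alpha>) = K_lattice U (\<alpha> \<circ> tau D)"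
  proof (rule lattice_hom_eq[of "\<lambda>\<alpha>. utau U (K_lattice U \<alpha>)" "\<lambda>\<alpha>. K_lattice U (\<alpha> \<circ> tau D)"])
    note hom = algebra_hom_onD[OF utau_hom]
    show "utau U (K_lattice U 0) = 1" by (simp only: K_lattice_hom hom)
    have "(0 :: 'i \<Rightarrow> int) \<circ> tau D = 0" by auto
    then show "K_lattice U (0 \<circ> tau D) = 1" by (simp only: K_lattice_hom)
    show "utau U (K_lattice U (\<alpha> + \<beta>)) = utau U (K_lattice U \<alpha>) * utau U (K_lattice U \<beta>)" for \<alpha> \<beta>
      by (simp only: K_lattice_hom hom)
    show "K_lattice U ((\<alpha> + \<beta>) \<circ> tau D) = K_lattice U (\<alpha> \<circ> tau D) * K_lattice U (\<beta> \<circ> tau D)" for \<alpha> \<beta>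
    proof -
      have "(\<alpha> + \<beta>) \<circ> tau D = (\<alpha> \<circ> tau D) + (\<beta> \<circ> tau D)" by auto
      then show ?thesis by (simp only: K_lattice_hom)
    qed
    show "utau U (K_lattice U (simple i)) = K_lattice U (simple i \<circ> tau D)" for i
      by (simp only: simple_tau[OF satake] K_lattice_simple utau_gen)
  qed
  then show ?thesis by (simp add: tw_def lusztig_wblack_K_lattice)
qed

abbreviation "k \<equiv> ik D U"
abbreviation "k' \<equiv> ikinv D U"

lemma k_inverse: "k i * k' i = 1" "k' i * k i = 1"
proof -
  let ?j = "tau D i"
  have "K i * K' ?j * (K ?j * K' i) = K i * (K' ?j * K ?j) * K' i" by (simp only: mult.assoc)
  moreover have "K ?j * K' i * (K i * K' ?j) = K ?j * (K' i * K i) * K' ?j" by (simp only: mult.assoc)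
  ultimately show "k i * k' i = 1" "k' i * k i = 1"
    by (simp_all add: ik_def ikinv_def relations)
qed

lemma k_lattice:
  "k i = K_lattice U (if i \<in> black D then simple i else simple i - simple (tau D i))"
  "k' i = K_lattice U (- (if i \<in> black D then simple i else simple i - simple (tau D i)))"
proof -
  have "simple i - simple (tau D i) = simple i + - simple (tau D i)"
    "- (simple i - simple (tau D i)) = simple (tau D i) + - simple i" by (auto simp: algebra_simps)
  then show "k i = K_lattice U (if i \<in> black D then simple i else simple i - simple (tau D i))"
    "k' i = K_lattice U (- (if i \<in> black D then simple i else simple i - simple (tau D i)))"
    by (simp_all only: ik_def ikinv_def K_lattice_hom K_lattice_simple if_distrib[of "K_lattice U"] split: if_split)
       simp_all
qed

text \<open>On the lattice this is \<open>w\<^sub>\<bullet> \<tau> \<beta> = - \<beta>\<close>, where \<open>\<beta>\<close> is \<open>\<alpha>\<^sub>i\<close> for black \<open>i\<close> and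
  \<open>\<alpha>\<^sub>i - \<alpha>\<^bsub>\<tau>(i)\<^esub>\<close> for white \<open>i\<close>.\<close>

lemma tw_k: "tw (k i) = k' i"
proof (cases "i \<in> black D")
  case True
  then have "wblack D (simple i \<circ> tau D) = - simple i"
    using wblack_black[OF satake, of "tau D i"] by (simp add: simple_tau[OF satake] tau_facts[OF satake])
  then show ?thesis using True by (simp add: k_lattice tw_K_lattice)
next
  case False
  let ?u = "simple i - simple (tau D i)"
  have "?u \<circ> tau D = - ?u" using simple_tau[OF satake, of i] simple_tau[OF satake, of "tau D i"]
    by (auto simp: fun_eq_iff tau_facts[OF satake])
  then have "wblack D (?u \<circ> tau D) = - ?u"
    using wblack_fixes_tau_antiinvariant[OF satake, of i] wblack_minus(2)[OF satake, of ?u] by simp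
  then show ?thesis unfolding k_lattice tw_K_lattice using False by simp
qed

lemma K_lattice_commute: "K_lattice U \<alpha> * K_lattice U \<beta> = K_lattice U \<beta> * K_lattice U \<alpha>"
  unfolding K_lattice_hom(2)[symmetric] by (simp only: add.commute)

lemma k_commute: "k i * k j = k j * k i" "k i * k' j = k' j * k i" "k i * K' j = K' j * k i"
  using K_lattice_commute[of _ "- simple j"]
  by (simp_all only: k_lattice K_lattice_commute K_lattice_simple)

lemma K'_weight:
  "K' i * E j = sc (inverse (q i powi C i j)) (E j * K' i)"
  "K' i * F j = sc (q i powi C i j) (F j * K' i)"
  using inverse_commutation[OF relations(1,2,4), of i j]
    inverse_commutation[OF relations(1,2,5), of i j] q_nonzero[of i]
  by (simp_all add: power_int_minus)

lemma k_weight: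
  obtains c where "c \<noteq> 0" "k l * E i = sc c (E i * k l)" "k l * F i = sc (inverse c) (F i * k l)"
proof (cases "l \<in> black D")
  case True
  show ?thesis
    using that[of "q l powi C l i"] True relations(4,5)[of l i] q_nonzero[of l]
    by (simp add: ik_def power_int_minus)
next
  case False
  let ?m = "tau D l"
  let ?a = "q l powi C l i" and ?b = "q ?m powi C ?m i"
  have "K l * K' ?m * E i = sc (?a * inverse ?b) (E i * (K l * K' ?m))"
  proof -
    have "K l * K' ?m * E i = sc (inverse ?b) (K l * E i * K' ?m)"
      by (simp add: mult.assoc K'_weight)
    then show ?thesis unfolding relations(4) by (simp add: mult.assoc mult.commute)
  qed
  moreover have "K l * K' ?m * F i = sc (inverse (?a * inverse ?b)) (F i * (K l * K' ?m))"
  proof -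
    have "K l * K' ?m * F i = sc ?b (K l * F i * K' ?m)"
      by (simp add: mult.assoc K'_weight)
    then show ?thesis unfolding relations(5) by (simp add: mult.assoc mult.commute power_int_minus)
  qed
  ultimately show ?thesis using that[of "?a * inverse ?b"] False q_nonzero by (simp add: ik_def)
qed

lemma iB_white: "i \<notin> black D \<Longrightarrow> iB D U \<sigma> i = F i + sc (\<sigma> i) (tw (E i) * K' i)"
  by (simp add: iB_def tw_def utau_gen)

text \<open>The automorphism \<open>tw\<close> inverts \<open>k l\<close>, so \<open>tw (E i)\<close> has the same \<open>k l\<close>-weight as \<open>F i\<close>.\<close>

lemma iB_k_weight:
  obtains c where "c \<noteq> 0" "k l * iB D U \<sigma> i = sc c (iB D U \<sigma> i * k l)"
proof -
  obtain c where c: "c \<noteq> 0" "k l * E i = sc c (E i * k l)" "k l * F i = sc (inverse c) (F i * k l)"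
    by (rule k_weight)
  show ?thesis
  proof (cases "i \<in> black D")
    case True then show ?thesis using that[of "inverse c"] c by (simp add: iB_def)
  next
    case False
    have "k' l * tw (E i) = sc c (tw (E i) * k' l)"
      using arg_cong[OF c(2), of tw] by (simp add: tw_simps tw_k)
    then have 1: "k l * tw (E i) = sc (inverse c) (tw (E i) * k l)"
      using inverse_commutation[OF k_inverse(2,1)] c(1) by blast
    have 2: "k l * K' i = K' i * k l" by (rule k_commute)
    have "k l * (tw (E i) * K' i) = sc (inverse c) (tw (E i) * K' i * k l)"
    proof -
      have "k l * (tw (E i) * K' i) = sc (inverse c) (tw (E i) * (k l * K' i))"
        using 1 by (simp flip: mult.assoc)
      then show ?thesis unfolding 2 by (simp add: mult.assoc)
    qed
    then have "k l * iB D U \<sigma> i = sc (inverse c) (iB D U \<sigma> i * k l)"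
      unfolding iB_white[OF False] distrib_left distrib_right scale_right_distrib
      using c(3) by (simp add: mult.commute)
    then show ?thesis using that[of "inverse c"] c(1) by simp
  qed
qed

end


section \<open>The torus and the generators of the \<open>\<imath>\<close>quantum group\<close>

text \<open>The set \<open>X\<close> stands for the marked vertices, with the two of their properties that make
  \<open>T\<^bsub>w\<^sub>\<bullet>\<^esub> \<tau>\<close> fix the quantum \<open>sl\<^sub>2\<close> of each of them.\<close>

locale iquantum_setup = quantum_group_setup D B U
  for D :: "'i::finite satake" and B :: "'k::alg_closed_field base_field"
    and U :: "('i, 'k, 'u::ring_1) quantum_group" +
  fixes \<sigma> :: "'i \<Rightarrow> 'k" and X :: "'i set"
  assumes X_tau: "i \<in> X \<Longrightarrow> tau D i = i"
    and X_orthogonal: "i \<in> black D \<Longrightarrow> j \<in> X \<Longrightarrow> cartan D i j = 0"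
begin

text \<open>The elements whose eigenvalues define the weight spaces.\<close>

definition tgen :: "'i \<Rightarrow> 'u" where
  "tgen i = (if i \<in> X then iB D U \<sigma> i else qshift sc (k i) 0 (q i))"

definition igens :: "'u set" where
  "igens = E ` black D \<union> range k \<union> range k' \<union> range (iB D U \<sigma>)"

lemma iquantum_eq: "iquantum D U \<sigma> = generated_subalgebra sc igens"
  by (simp add: iquantum_def igens_def)

lemma X_white: "j \<in> X \<Longrightarrow> j \<notin> black D"
  using X_orthogonal[of j j] cartan_facts(1)[OF satake, of j] by auto

lemma tw_X:
  assumes "j \<in> X" shows "tw (E j) = E j" "tw (F j) = F j" "tw (K j) = K j" "tw (K' j) = K' j"
proof -
  show 1: "tw (E j) = E j" "tw (F j) = F j" "tw (K j) = K j"
    using lusztig_wblack_orthogonal[of j] X_orthogonal assms X_tau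
    by (simp_all add: tw_def utau_gen)
  show "tw (K' j) = K' j"
    by (rule hom_inverse[OF tw_hom relations(1,2)]) (simp_all add: 1 relations)
qed

lemma iB_X: "j \<in> X \<Longrightarrow> iB D U \<sigma>' j = F j + sc (\<sigma>' j) (E j * K' j)"
  using iB_white X_white tw_X by simp

text \<open>Shifting and rescaling \<open>k i\<close> turns the weight relation into an affine one.\<close>

lemma torsion_qshift:
  assumes "k i * x = sc c (x * k i)" "c \<noteq> 0"
  shows "torsion sc (qshift sc (k i) 0 (q i)) b x"
proof (rule torsion_affine)
  let ?d = "inverse (q i - 1)"
  have "x * k i = sc (inverse c) (k i * x)" using assms by simp
  then have "x * qshift sc (k i) 0 (q i) = sc ?d (sc (inverse c) (k i * x) - x)"
    by (simp add: qshift_def right_diff_distrib)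
  also have "\<dots> = sc (inverse c) (qshift sc (k i) 0 (q i) * x) + sc ((inverse c - 1) * ?d) x"
    by (simp add: qshift_def left_diff_distrib scale_right_diff_distrib scale_left_diff_distrib mult.commute)
  finally show "x * qshift sc (k i) 0 (q i)
      = sc (inverse c) (qshift sc (k i) 0 (q i) * x) + sc ((inverse c - 1) * ?d) x" .
qed

lemma q_symmetric: "q i powi C i j = q j powi C j i"
proof -
  have "q i powi C i j = qq B powi (int (symm D i) * C i j)" for i j
    by (simp add: qi_def power_int_mult)
  then show ?thesis using cartan_facts(2)[OF satake] by simp
qed

lemma torsion_F:
  assumes "j \<in> X" "i \<noteq> j"
  shows "torsion sc (iB D U \<sigma> j) b (F i)"
proof -
  define n where "n = nat (- C j i)"
  have n: "C j i = - int n" unfolding n_def using cartan_facts(5)[OF satake, of j i] assms by simp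
  show ?thesis unfolding iB_X[OF assms(1)]
  proof (rule torsion_commuting_E)
    show "E j * F i = F i * E j" using relations assms by metis
    show "K j * F i = sc (q j powi int n) (F i * K j)" using relations(5)[of j i] n by simp
    show "serre sc (q j) (- int n) (F j) (F i) = 0" using relations(9)[of j i] n assms by simp
  qed
qed

text \<open>As \<open>tw\<close> fixes \<open>E j\<close>, \<open>F j\<close> and \<open>K j\<close>, the element \<open>tw (E i)\<close> inherits the relations of \<open>E i\<close> with
  them.\<close>

lemma torsion_tw_E:
  assumes "j \<in> X" "i \<noteq> j"
  shows "torsion sc (iB D U \<sigma> j) b (tw (E i) * K' i)"
proof -
  define n where "n = nat (- C j i)"
  have n: "C j i = - int n" using cartan_facts(5)[OF satake, of j i] assms by (simp add: n_def)
  have power: "tw (x ^ m) = tw x ^ m" for x m by (induction m) (simp_all add: tw_simps)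
  have sum: "tw (\<Sum>r\<in>A. f r) = (\<Sum>r\<in>A. tw (f r))" for A :: "nat set" and f
    by (induction A rule: infinite_finite_induct) (simp_all add: tw_simps)
  have tw_serre: "tw (serre sc p a x y) = serre sc p a (tw x) (tw y)" for p a x y
    by (simp add: serre_def divided_power_def sum tw_simps power)
  show ?thesis unfolding iB_X[OF assms(1)]
  proof (rule torsion_commuting_F)
    have "F j * E i = E i * F j" using relations(7)[of i j] assms by simp
    from arg_cong[OF this, of tw] show "F j * tw (E i) = tw (E i) * F j"
      by (simp add: tw_simps tw_X assms)
    have "K j * E i = sc (q j powi (- int n)) (E i * K j)" using relations(4)[of j i] n by simp
    from arg_cong[OF this, of tw] show "K j * tw (E i) = sc (q j powi (- int n)) (tw (E i) * K j)"
      by (simp add: tw_simps tw_X assms)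
    have "serre sc (q j) (- int n) (E j) (E i) = 0" using relations(8)[of j i] n assms by simp
    from arg_cong[OF this, of tw] show "serre sc (q j) (- int n) (E j) (tw (E i)) = 0"
      by (simp add: tw_serre tw_simps tw_X assms)
    show "K' i * E j = sc (q j powi int n) (E j * K' i)"
      using K'_weight(1)[of i j] unfolding q_symmetric[of i j] n by (simp add: power_int_minus)
    show "K' i * F j = sc (q j powi (- int n)) (F j * K' i)"
      using K'_weight(2)[of i j] unfolding q_symmetric[of i j] n by simp
    show "K' i * K j = K j * K' i" by (rule K_commute)
  qed
qed

lemma torsion_self: "torsion sc T b T"
  by (rule torsion_affine[of _ _ 1 0]) simp

text \<open>A generator of the torus and a generator of \<open>U\<^sup>\<imath>\<close> commute up to a scalar unless they are \<open>B\<^sub>j\<close> and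
  \<open>B\<^sub>i\<close>; only that case needs strings.\<close>

lemma igens_torsion:
  assumes "x \<in> igens" shows "torsion sc (tgen i) b x"
proof -
  have commuting: "torsion sc T b x" if "T * x = sc c (x * T)" "c \<noteq> 0" for T x c
    by (rule torsion_affine[of _ _ "inverse c" 0]) (use that in simp)
  show ?thesis
  proof (cases "i \<in> X")
    case False
    have "\<exists>c. c \<noteq> 0 \<and> k i * x = sc c (x * k i)"
    proof -
      consider l where "x = E l" | l where "x = k l" | l where "x = k' l" | l where "x = iB D U \<sigma> l"
        using assms unfolding igens_def by blast
      then show ?thesis
      proof cases
        case 1 then show ?thesis using k_weight[of i l] by metis
      next
        case 2 then show ?thesis using k_commute by (intro exI[of _ 1]) simp
      next
        case 3 then show ?thesis using k_commute by (intro exI[of _ 1]) simp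
      next
        case 4 then show ?thesis using iB_k_weight[of i \<sigma> l] by metis
      qed
    qed
    then show ?thesis using torsion_qshift False by (auto simp: tgen_def)
  next
    case True
    consider l where "l \<in> black D" "x = E l" | l where "x = k l" | l where "x = k' l" | l where "x = iB D U \<sigma> l"
      using assms unfolding igens_def by blast
    then have "torsion sc (iB D U \<sigma> i) b x"
    proof cases
      case 1
      have 0: "C l i = 0" "C i l = 0" and li: "l \<noteq> i"
        using X_orthogonal[OF 1(1) True] cartan_facts(3)[OF satake] X_white[OF True] 1(1) by auto
      have "E l * E i = E i * E l"
      proof -
        have "q l \<noteq> inverse (q l)"
          using q_power_neq_1[of 2 l] q_nonzero[of l] by (auto simp: power2_eq_square field_simps)
        then show ?thesis
          using relations(8)[OF li] 0 by (simp add: serre_def divided_power_def qfact_def qint_def)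
      qed
      moreover have "K' i * E l = E l * K' i" using K'_weight(1)[of i l] 0 by simp
      moreover have "F i * E l = E l * F i" using relations(7)[OF li] by simp
      ultimately have "iB D U \<sigma> i * E l = E l * iB D U \<sigma> i"
        unfolding iB_X[OF True] distrib_left distrib_right
        by (simp add: mult.assoc) (metis mult.assoc)
      then show ?thesis using commuting[of _ _ 1] 1 by simp
    next
      case 2
      obtain c where "c \<noteq> 0" "k l * iB D U \<sigma> i = sc c (iB D U \<sigma> i * k l)" by (rule iB_k_weight)
      then show ?thesis unfolding 2 by (intro torsion_affine[of _ _ c 0]) simp
    next
      case 3
      obtain c where c: "c \<noteq> 0" "k l * iB D U \<sigma> i = sc c (iB D U \<sigma> i * k l)" by (rule iB_k_weight)
      then show ?thesis unfolding 3 using inverse_commutation[OF k_inverse c(2,1)]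
        by (intro torsion_affine[of _ _ "inverse c" 0]) simp
    next
      case 4
      show ?thesis
      proof (cases "l = i")
        case True then show ?thesis using 4 torsion_self by simp
      next
        case False
        show ?thesis
        proof (cases "l \<in> black D")
          case True then show ?thesis using torsion_F[OF \<open>i \<in> X\<close> False] 4 by (simp add: iB_def)
        next
          case l: False
          show ?thesis unfolding 4 iB_white[OF l]
            by (intro torsion_add torsion_scale torsion_F torsion_tw_E \<open>i \<in> X\<close> False)
        qed
      qed
    qed
    then show ?thesis using True by (simp add: tgen_def)
  qed
qed

end

section \<open>Classical weight modules and their duals\<close>

locale iantipode_setup = iquantum_setup D B U \<sigma> X
  for D :: "'i::finite satake" and B :: "'k::alg_closed_field base_field"
    and U :: "('i, 'k, 'u::ring_1) quantum_group" and \<sigma> :: "'i \<Rightarrow> 'k" and X :: "'i set" +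
  fixes \<eta> \<zeta> :: "'i \<Rightarrow> 'k" and \<phi> :: "'u \<Rightarrow> 'u"
  assumes parameter: "is_parameter D B \<sigma>"
    and twist: "twist_parameters D B \<sigma> \<eta> \<zeta>"
    and bij: "bij_betw (pre_antipode D U) (iquantum D U \<sigma>) (iquantum D U (dual_parameter D B \<sigma>))"
    and iso: "is_twist_iso D U (dual_parameter D B \<sigma>) \<sigma> \<eta> \<zeta> \<phi>"
begin

abbreviation "\<sigma>' \<equiv> dual_parameter D B \<sigma>"
abbreviation "Ui \<equiv> generated_subalgebra sc igens"

lemma pre_antipode_eq: "pre_antipode D U x = tw (omega U (antipode U x))"
  by (simp add: pre_antipode_def tw_def)

lemma pre_antipode_antihom:
  "pre_antipode D U (x + y) = pre_antipode D U x + pre_antipode D U y"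
  "pre_antipode D U (x * y) = pre_antipode D U y * pre_antipode D U x"
  "pre_antipode D U (sc c x) = sc c (pre_antipode D U x)" "pre_antipode D U 1 = 1"
  by (simp_all add: pre_antipode_eq antipode_antihom algebra_hom_onD[OF omega_hom] tw_simps)

lemma antipode_omega_K': "antipode U (K' i) = K i" "omega U (K' i) = K i"
proof -
  have "antipode U (K' i) * K' i = 1"
    using antipode_antihom(2)[of "K i" "K' i"] antipode_gen(3) antipode_antihom(4) by (simp add: relations)
  then have "antipode U (K' i) * (K' i * K i) = K i" by (simp flip: mult.assoc)
  then show "antipode U (K' i) = K i" by (simp add: relations)
  show "omega U (K' i) = K i"
    by (rule hom_inverse[OF omega_hom relations(1,2)]) (simp_all add: omega_gen relations)
qed

lemma pre_antipode_k: "pre_antipode D U (k i) = k' i"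
proof -
  have "omega U (antipode U (k i)) = k i"
    by (simp add: ik_def antipode_antihom antipode_gen antipode_omega_K' omega_gen
        algebra_hom_onD[OF omega_hom] K_commute(2))
  then show ?thesis by (simp add: pre_antipode_eq tw_k)
qed

text \<open>The exponent of \<open>q\<^sub>j\<close> vanishes: \<open>j\<close> is orthogonal to the black vertices, so \<open>\<rho>\<^sub>\<bullet>\<close> pairs to zero with
  \<open>h\<^sub>j\<close> and \<open>\<langle>h\<^sub>j, w\<^sub>\<bullet>(\<alpha>\<^sub>j)\<rangle> = \<langle>h\<^sub>j, \<alpha>\<^sub>j\<rangle> = 2\<close>.\<close>

lemma dual_parameter_X: "j \<in> X \<Longrightarrow> \<sigma>' j = inverse (\<sigma> j)"
  using wblack_orthogonal[OF satake, of j] pairing_two_rho_orthogonal[OF satake, of j] X_orthogonal X_tau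
  by (simp add: dual_parameter_def hw_pair_def pairing_simple_simple cartan_facts(1)[OF satake])

lemma \<sigma>_nonzero:
  assumes "j \<in> X" shows "\<sigma> j \<noteq> 0"
proof -
  have "\<sigma> j \<in> K1_units B" using parameter X_white[OF assms] by (simp add: is_parameter_def)
  then show ?thesis by (auto simp: K1_units_def)
qed

text \<open>The two summands of \<open>B\<^sub>j\<close> are exchanged up to sign: \<open>F\<^sub>j \<mapsto> - E\<^sub>j K\<^sub>j\<^sup>-\<^sup>1\<close> and
  \<open>E\<^sub>j K\<^sub>j\<^sup>-\<^sup>1 \<mapsto> - F\<^sub>j\<close>.\<close>

lemma pre_antipode_B:
  assumes "j \<in> X" shows "pre_antipode D U (iB D U \<sigma> j) = sc (- \<sigma> j) (iB D U \<sigma>' j)"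
proof -
  have "antipode U (E j * K' j) = - E j"
    by (simp add: antipode_antihom antipode_gen antipode_omega_K' relations flip: mult.assoc)
  moreover have "antipode U (- x) = - antipode U x" for x
    using additive_uminus(2)[of "antipode U"] antipode_antihom(1) by blast
  ultimately have "pre_antipode D U (iB D U \<sigma> j) = - (E j * K' j) - sc (\<sigma> j) (F j)"
    using assms by (simp add: iB_X pre_antipode_eq antipode_antihom antipode_gen omega_gen
        algebra_hom_onD[OF omega_hom] tw_simps tw_X)
  then show ?thesis
    using \<sigma>_nonzero[OF assms] by (simp add: iB_X[OF assms] dual_parameter_X[OF assms] scale_right_distrib)
qed

lemma \<phi>_hom:
  assumes "x \<in> iquantum D U \<sigma>'"
  shows "y \<in> iquantum D U \<sigma>' \<Longrightarrow> \<phi> (x + y) = \<phi> x + \<phi> y" "y \<in> iquantum D U \<sigma>' \<Longrightarrow> \<phi> (x * y) = \<phi> x * \<phi> y"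
    "\<phi> (sc c x) = sc c (\<phi> x)" "\<phi> 1 = 1"
  using assms iso unfolding is_twist_iso_def algebra_hom_on_def by blast+

lemma gens_in_iquantum: "k i \<in> iquantum D U s" "k' i \<in> iquantum D U s" "iB D U s i \<in> iquantum D U s"
  unfolding iquantum_def by (auto intro: generated_subalgebra_base)

lemma \<zeta>_nonzero: "\<zeta> i \<noteq> 0"
  using twist unfolding twist_parameters_def by (metis mult_zero_left zero_neq_one)

abbreviation "S \<equiv> iantipode D U \<phi>"

lemma S_k: "S (k i) = sc (\<zeta> i) (k' i)"
proof -
  have "\<phi> (k i * k' i) = \<phi> (k i) * \<phi> (k' i)" by (intro \<phi>_hom gens_in_iquantum)
  moreover have "\<phi> (k i) = sc (inverse (\<zeta> i)) (k i)" using iso by (simp add: is_twist_iso_def)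
  ultimately have "sc (inverse (\<zeta> i)) (k i * \<phi> (k' i)) = 1"
    using \<phi>_hom(4)[OF gens_in_iquantum(1)] by (simp add: k_inverse)
  then have "sc (\<zeta> i) 1 = k i * \<phi> (k' i)" using \<zeta>_nonzero[of i] by (metis right_inverse scale_one scale_scale)
  then have "k' i * sc (\<zeta> i) 1 = k' i * k i * \<phi> (k' i)" by (simp add: mult.assoc)
  then show ?thesis by (simp add: iantipode_def pre_antipode_k k_inverse)
qed

definition sgn_X :: "'i \<Rightarrow> 'k" where
  "sgn_X j = - (\<sigma> j / \<eta> j)"

lemma S_B:
  assumes "j \<in> X" shows "S (iB D U \<sigma> j) = sc (sgn_X j) (iB D U \<sigma> j)"
proof -
  have "\<phi> (iB D U \<sigma>' j) = sc (inverse (\<eta> j)) (iB D U \<sigma> j)" using iso by (simp add: is_twist_iso_def)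
  then have "\<phi> (sc (- \<sigma> j) (iB D U \<sigma>' j)) = sc (sgn_X j) (iB D U \<sigma> j)"
    unfolding \<phi>_hom(3)[OF gens_in_iquantum(3)] by (simp add: sgn_X_def divide_inverse)
  then show ?thesis unfolding iantipode_def o_apply pre_antipode_B[OF assms] .
qed

text \<open>With \<open>\<tau>(j) = j\<close>, \<open>\<zeta>\<^sub>j = 1\<close> and \<open>\<varsigma>'\<^sub>j = \<varsigma>\<^sub>j\<^sup>-\<^sup>1\<close> the condition on \<open>\<eta>\<close> reads \<open>\<eta>\<^sub>j\<^sup>2 = \<varsigma>\<^sub>j\<^sup>2\<close>.\<close>

lemma sgn_X_cases:
  assumes "j \<in> X" shows "sgn_X j = 1 \<or> sgn_X j = - 1"
proof -
  have \<zeta>: "\<zeta> j = 1" using twist X_tau[OF assms] unfolding twist_parameters_def by blast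
  have "\<eta> j \<in> K1_units B" using twist by (simp add: twist_parameters_def)
  then have "\<eta> j \<noteq> 0" by (auto simp: K1_units_def)
  moreover have "\<sigma>' j * \<zeta> j * \<eta> j * \<eta> (tau D j) = \<sigma> j"
    using twist X_white[OF assms] unfolding twist_parameters_def by blast
  then have "\<eta> j * \<eta> j = \<sigma> j * \<sigma> j"
    using \<sigma>_nonzero[OF assms] by (simp add: \<zeta> X_tau[OF assms] dual_parameter_X[OF assms] field_simps)
  ultimately have "sgn_X j * sgn_X j = 1" using \<sigma>_nonzero[OF assms] by (simp add: sgn_X_def)
  then show ?thesis by (simp add: square_eq_1_iff)
qed

text \<open>The eigenvalue of the image of \<open>tgen i\<close> under the anti-automorphism on the eigenspace of
  \<open>tgen i\<close> for \<open>c\<close>; on that eigenspace, for unmarked \<open>i\<close>, the element \<open>k i\<close> acts by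
  \<open>1 + (q\<^sub>i - 1) c\<close>.\<close>

definition star :: "'i \<Rightarrow> 'k \<Rightarrow> 'k" where
  "star i c = (if i \<in> X then sgn_X i * c
     else (\<zeta> i / (1 + (q i - 1) * c) - 1) / (q i - 1))"

lemma q_neq_1: "q i \<noteq> 1"
  using q_power_neq_1[of 1 i] by simp

lemma q_eq: "q i = qq B ^ symm D i"
  by (simp add: qi_def)

text \<open>Both \<open>k\<^sup>-\<^sup>1 - \<kappa>\<^sup>-\<^sup>1\<close> and \<open>(k; 0) - c\<close> are multiples of \<open>k - \<kappa>\<close>, where \<open>\<kappa> = 1 + (q\<^sub>i - 1) c\<close>.\<close>

lemma S_qshift:
  assumes c: "c \<in> K1 B" and S: "S (qshift sc (k i) 0 (q i)) = sc (inverse (q i - 1)) (sc (\<zeta> i) (k' i) - 1)"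
  defines "\<kappa> \<equiv> 1 + (q i - 1) * c"
  shows "S (qshift sc (k i) 0 (q i)) - sc ((\<zeta> i / \<kappa> - 1) / (q i - 1)) 1
    = sc (- (\<zeta> i / \<kappa>)) (k' i) * (qshift sc (k i) 0 (q i) - sc c 1)"
proof -
  have \<kappa>: "\<kappa> \<noteq> 0" unfolding \<kappa>_def q_eq by (rule K1_shifted_nonzero[OF base c])
  let ?d = "inverse (q i - 1)"
  have d: "?d * (q i - 1) = 1" using q_neq_1[of i] by simp
  have "sc c 1 = sc ?d (sc \<kappa> 1 - 1)"
  proof -
    have "?d * \<kappa> = ?d + c" unfolding \<kappa>_def distrib_left mult.assoc[symmetric] d by simp
    then show ?thesis by (simp add: scale_right_diff_distrib scale_left_distrib)
  qed
  then have "qshift sc (k i) 0 (q i) - sc c 1 = sc ?d (k i - sc \<kappa> 1)"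
    by (simp add: qshift_def scale_right_diff_distrib)
  then have "sc (- (\<zeta> i / \<kappa>)) (k' i) * (qshift sc (k i) 0 (q i) - sc c 1)
      = sc (- (\<zeta> i / \<kappa>) * ?d) (1 - sc \<kappa> (k' i))"
    by (simp only: scale_mult_left scale_mult_right right_diff_distrib k_inverse mult_1_right
        scale_right_diff_distrib scale_scale mult_ac)
  also have "\<dots> = sc ?d (sc (- (\<zeta> i / \<kappa>)) (1 - sc \<kappa> (k' i)))" by (simp only: scale_scale mult.commute)
  also have "sc (- (\<zeta> i / \<kappa>)) (1 - sc \<kappa> (k' i)) = sc (\<zeta> i) (k' i) - sc (\<zeta> i / \<kappa>) 1"
    using \<kappa> by (simp add: scale_right_diff_distrib)
  also have "sc ?d (sc (\<zeta> i) (k' i) - sc (\<zeta> i / \<kappa>) 1)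
      = S (qshift sc (k i) 0 (q i)) - sc ((\<zeta> i / \<kappa> - 1) / (q i - 1)) 1"
    unfolding S by (simp add: scale_right_diff_distrib scale_left_diff_distrib divide_inverse left_diff_distrib right_diff_distrib mult_ac)
  finally show ?thesis by simp
qed

sublocale duality: weight_duality sc igens S tgen "K1 B" star
proof
  have alg: "subalgebra sc (iquantum D U s)" for s
    unfolding iquantum_def by (rule subalgebra_generated[OF is_algebra])
  have closed: "1 \<in> iquantum D U s" "x \<in> iquantum D U s \<Longrightarrow> y \<in> iquantum D U s \<Longrightarrow> x - y \<in> iquantum D U s"
     "x \<in> iquantum D U s \<Longrightarrow> sc c x \<in> iquantum D U s" for s x y c
    using alg[of s] subspace_diff subspace_scale by (auto simp: subalgebra_def)
  have P: "pre_antipode D U x \<in> iquantum D U \<sigma>'" if "x \<in> iquantum D U \<sigma>" for x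
    using bij that by (auto dest: bij_betwE)
  have \<phi>: "\<phi> x \<in> iquantum D U \<sigma>" if "x \<in> iquantum D U \<sigma>'" for x
    using iso that by (auto simp: is_twist_iso_def dest: bij_betwE)
  show S_add: "S (x + y) = S x + S y" if "x \<in> Ui" "y \<in> Ui" for x y
    using that P by (simp add: iquantum_eq[symmetric] iantipode_def pre_antipode_antihom \<phi>_hom)
  show S_scale: "S (sc c x) = sc c (S x)" if "x \<in> Ui" for x c
    using that P by (simp add: iquantum_eq[symmetric] iantipode_def pre_antipode_antihom \<phi>_hom)
  show S_one: "S 1 = 1"
    by (simp add: iantipode_def pre_antipode_antihom \<phi>_hom(4)[OF gens_in_iquantum(1)])
  show tA: "tgen i \<in> Ui" for i
    unfolding iquantum_eq[symmetric] tgen_def qshift_def by (auto intro!: closed gens_in_iquantum)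
  show "S x \<in> Ui" if "x \<in> Ui" for x
    using that P \<phi> by (simp add: iquantum_eq[symmetric] iantipode_def)
  show "S (x * y) = S y * S x" if "x \<in> Ui" "y \<in> Ui" for x y
    using that P by (simp add: iquantum_eq[symmetric] iantipode_def pre_antipode_antihom \<phi>_hom)
  have \<zeta>: "\<zeta> i \<in> K1 B" "climit B (\<zeta> i) = 1" for i
    using twist by (auto simp: twist_parameters_def K1_units_def)
  have d: "symm D i > 0" for i using cartan_facts(4)[OF satake] .
  show "star i c \<in> K1 B" if "c \<in> K1 B" for i c
    using that K1_weight_inverse[OF base that \<zeta> d, of i i] sgn_X_cases[of i] K1_minus[OF base that]
    by (auto simp: star_def q_eq)
  show "star i (star i c) = c" if "c \<in> K1 B" for i c
  proof (cases "i \<in> X")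
    case True then show ?thesis using sgn_X_cases[OF True] by (auto simp: star_def)
  next
    case False
    have "1 + (q i - 1) * c \<noteq> 0" unfolding q_eq by (rule K1_shifted_nonzero[OF base that])
    then show ?thesis using False q_neq_1[of i] \<zeta>_nonzero[of i] by (simp add: star_def)
  qed
  have S_shift: "S (qshift sc (k i) 0 (q i)) = sc (inverse (q i - 1)) (sc (\<zeta> i) (k' i) - 1)" for i
  proof -
    have kA: "k i \<in> Ui" "sc (- 1) 1 \<in> Ui"
      "1 \<in> Ui"
      using gens_in_iquantum closed by (simp_all only: iquantum_eq[symmetric])
    have "k i + sc (- 1) 1 \<in> Ui"
      using closed(2)[of "k i" \<sigma> 1] gens_in_iquantum(1)[of i \<sigma>] closed(1)[of \<sigma>]
      by (simp add: iquantum_eq[symmetric])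
    moreover have "qshift sc (k i) 0 (q i) = sc (inverse (q i - 1)) (k i + sc (- 1) 1)"
      by (simp add: qshift_def)
    ultimately show ?thesis
      by (simp only: S_scale S_add[OF kA(1,2)] S_scale[OF kA(3)] S_k S_one) simp
  qed
  show "\<exists>y\<in>Ui. S (tgen i) - sc (star i c) 1 = y * (tgen i - sc c 1)" if c: "c \<in> K1 B" for i c
  proof (cases "i \<in> X")
    case True
    then have "S (tgen i) - sc (star i c) 1 = sc (sgn_X i) 1 * (tgen i - sc c 1)"
      by (simp add: tgen_def S_B star_def scale_right_diff_distrib)
    moreover have "sc (sgn_X i) 1 \<in> Ui"
      using closed by (simp add: iquantum_eq[symmetric])
    ultimately show ?thesis by blast
  next
    case False
    have "sc (- (\<zeta> i / (1 + (q i - 1) * c))) (k' i) \<in> Ui"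
      unfolding iquantum_eq[symmetric] by (intro closed gens_in_iquantum)
    moreover have "S (tgen i) - sc (star i c) 1
        = sc (- (\<zeta> i / (1 + (q i - 1) * c))) (k' i) * (tgen i - sc c 1)"
      using S_qshift[OF c S_shift, of i] False by (simp only: tgen_def star_def if_False)
    ultimately show ?thesis by blast
  qed
  show "torsion sc (tgen i) b x" if "x \<in> igens" for x i b
    using igens_torsion that .
qed

abbreviation "torus \<equiv> itorus D U \<sigma> X"

lemma weight_space_eq: "weight_space D B U \<sigma> X M a = duality.wspace M a"
  unfolding weight_space_def duality.wspace_def tgen_def by auto

lemma restricted_dual_eq: "restricted_dual D B U \<sigma> X \<phi> M = duality.dual M"
  unfolding restricted_dual_def duality.dual_def duality.functional_def duality.supp_def
    duality.weights_def duality.precomp_def[abs_def] weight_space_eq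
  by (auto simp: fun_eq_iff)

lemma tgen_itorus: "tgen i \<in> torus"
proof -
  have alg: "subalgebra sc (torus)"
    unfolding itorus_def by (rule subalgebra_generated[OF is_algebra])
  have "k i \<in> torus" "i \<in> X \<Longrightarrow> iB D U \<sigma> i \<in> torus"
    unfolding itorus_def by (auto intro: generated_subalgebra_base)
  then show ?thesis using alg subspace_diff subspace_scale
    by (auto simp: tgen_def qshift_def subalgebra_def)
qed

text \<open>On a weight space the remaining generators of the torus act by scalars as well: \<open>k\<^sub>j = 1\<close> for
  marked \<open>j\<close>, and the scalar of \<open>k\<^sub>i\<close> is nonzero because its classical limit is 1.\<close>

lemma wspace_subset_eigenspace:
  fixes M :: "('k, 'u, 'm::ab_group_add) umodule"
  assumes M: "is_module sc duality.A M" and a: "a \<in> duality.weights"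
  shows "\<exists>\<chi>. duality.wspace M a \<subseteq> eigenspace (torus) M \<chi>"
proof -
  interpret V: vector_space "mscale M" using M by (simp add: is_module_def)
  note act = duality.act[OF M] and wD = duality.wspaceD[OF M] and closed = duality.A_closed
  let ?scalar = "\<lambda>x. \<exists>c. \<forall>m\<in>duality.wspace M a. mact M x m = mscale M c m"
  let ?N = "{x \<in> duality.A. ?scalar x}"
  have "subalgebra sc ?N"
    unfolding subalgebra_def
  proof (intro conjI subspaceI ballI CollectI)
    show A0: "0 \<in> duality.A" using closed(3)[OF closed(1) closed(1)] by simp
    have "mact M 0 m = mscale M 0 m" if "m \<in> duality.wspace M a" for m
      using act(5)[OF closed(1) wD(1)[OF that], of 0] by simp
    then show "?scalar 0" by blast
    show "?scalar 1"
      using act(7) wD(1) by (intro exI[of _ 1]) simp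
  next
    fix x y assume "x \<in> ?N" "y \<in> ?N"
    then obtain c d where *: "x \<in> duality.A" "y \<in> duality.A"
        "\<forall>m\<in>duality.wspace M a. mact M x m = mscale M c m" "\<forall>m\<in>duality.wspace M a. mact M y m = mscale M d m"
      by blast
    then show "x + y \<in> duality.A" "x * y \<in> duality.A" by (simp_all add: closed)
    show "?scalar (x + y)"
      using * wD(1) by (intro exI[of _ "c + d"]) (simp add: act V.scale_left_distrib)
    show "?scalar (x * y)"
      using * wD(1) by (intro exI[of _ "d * c"]) (simp add: act)
  next
    fix e x assume "x \<in> ?N"
    then obtain c where *: "x \<in> duality.A" "\<forall>m\<in>duality.wspace M a. mact M x m = mscale M c m" by blast
    then show "sc e x \<in> duality.A" by (simp add: closed)
    show "?scalar (sc e x)"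
      using * wD(1) by (intro exI[of _ "e * c"]) (simp add: act)
  qed (simp add: closed)
  moreover have "range k \<union> range k' \<union> iB D U \<sigma> ` X \<subseteq> ?N"
  proof -
    have kA: "k i \<in> duality.A" "k' i \<in> duality.A" "iB D U \<sigma> i \<in> duality.A" for i
      by (auto simp: igens_def intro: generated_subalgebra_base)
    have k_act: "\<exists>c. c \<noteq> 0 \<and> (\<forall>m\<in>duality.wspace M a. mact M (k i) m = mscale M c m)" for i
    proof (cases "i \<in> X")
      case True
      then have "k i = 1" using X_tau X_white by (simp add: ik_def relations)
      then show ?thesis using act(7) wD(1) by (intro exI[of _ 1]) simp
    next
      case False
      let ?\<kappa> = "1 + (q i - 1) * a i"
      have "mact M (k i) m = mscale M ?\<kappa> m" if m: "m \<in> duality.wspace M a" for m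
      proof -
        have mc: "m \<in> mcarrier M" using wD(1)[OF m] .
        have "k i = sc (q i - 1) (tgen i) + 1"
          using False q_neq_1[of i] by (simp add: tgen_def qshift_def)
        then have "mact M (k i) m = mscale M (q i - 1) (mact M (tgen i) m) + m"
          using mc by (simp add: act closed duality.t_closed)
        then show ?thesis using wD(2)[OF m] by (simp add: V.scale_left_distrib add.commute)
      qed
      moreover have "?\<kappa> \<noteq> 0" unfolding q_eq using a by (intro K1_shifted_nonzero[OF base]) (simp add: duality.weights_def)
      ultimately show ?thesis by blast
    qed
    have "?scalar (k' i)" for i
    proof -
      obtain c where c: "c \<noteq> 0" "\<forall>m\<in>duality.wspace M a. mact M (k i) m = mscale M c m" using k_act by blast
      have "mact M (k' i) m = mscale M (inverse c) m" if m: "m \<in> duality.wspace M a" for m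
      proof -
        have mc: "m \<in> mcarrier M" using wD(1)[OF m] .
        have "mact M (k' i * k i) m = mscale M c (mact M (k' i) m)"
          using c(2) m mc by (simp add: act kA)
        then have "m = mscale M c (mact M (k' i) m)" using mc by (simp add: k_inverse act)
        then show ?thesis using c(1) by (metis V.scale_one V.scale_scale left_inverse)
      qed
      then show ?thesis by blast
    qed
    moreover have "?scalar (iB D U \<sigma> j)" if "j \<in> X" for j
      using wD(2)[where i = j] that by (intro exI[of _ "a j"]) (simp add: tgen_def)
    ultimately show ?thesis using k_act kA by blast
  qed
  ultimately have "torus \<subseteq> ?N"
    unfolding itorus_def by (rule generated_subalgebra_minimal)
  then have "\<forall>x\<in>torus. ?scalar x" by blast
  then obtain \<chi> where "\<forall>x\<in>torus. \<forall>m\<in>duality.wspace M a. mact M x m = mscale M (\<chi> x) m"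
    by metis
  then show ?thesis using wD(1) by (intro exI[of _ \<chi>]) (auto simp: eigenspace_def)
qed

lemma eigenspace_subset_wspace: "eigenspace (torus) M \<chi> \<subseteq> duality.wspace M (\<lambda>i. \<chi> (tgen i))"
  using tgen_itorus by (auto simp: eigenspace_def duality.wspace_def)

text \<open>Simultaneous eigenspaces of the torus and weight spaces are the same apart from zero spaces.  The
  condition on eigenvalues in the category follows from the decomposition into weight spaces with
  weights in \<open>K1\<close>.\<close>

lemma in_C'_iff_weight_module:
  fixes M :: "('k, 'u, 'm::ab_group_add) umodule"
  shows "in_C' D B U \<sigma> X M \<longleftrightarrow> duality.weight_module M"
proof
  assume M: "in_C' D B U \<sigma> X M"
  then have is_mod: "is_module sc duality.A M"
    by (simp add: in_C'_def classical_weight_module_def iquantum_eq)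
  interpret V: vector_space "mscale M" using is_mod by (simp add: is_module_def)
  have sub: "V.subspace (mcarrier M)" by (rule duality.carrier_subspace[OF is_mod])
  have eigen: "eigenvalue M (tgen i) c \<Longrightarrow> c \<in> K1 B" for i c
    using M unfolding in_C'_def classical_weight_module_def tgen_def by (auto split: if_splits)
  have eigenspace: "eigenspace (torus) M \<chi> \<subseteq> V.span (\<Union>a\<in>duality.weights. duality.wspace M a)" for \<chi>
  proof
    fix m assume m: "m \<in> eigenspace (torus) M \<chi>"
    show "m \<in> V.span (\<Union>a\<in>duality.weights. duality.wspace M a)"
    proof (cases "m = 0")
      case False
      have w: "m \<in> duality.wspace M (\<lambda>i. \<chi> (tgen i))" using m eigenspace_subset_wspace by blast
      then have "eigenvalue M (tgen i) (\<chi> (tgen i))" for i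
        using False duality.wspaceD[OF is_mod w] unfolding eigenvalue_def by blast
      then have "(\<lambda>i. \<chi> (tgen i)) \<in> duality.weights" using eigen unfolding duality.weights_def by blast
      then show ?thesis using w V.span_base by blast
    qed (simp add: V.span_zero)
  qed
  have "mcarrier M = V.span (\<Union>\<chi>. eigenspace (torus) M \<chi>)"
    using M by (simp add: in_C'_def classical_weight_module_def acts_semisimply_def)
  also have "\<dots> \<subseteq> V.span (\<Union>a\<in>duality.weights. duality.wspace M a)"
    by (rule V.span_minimal) (use eigenspace V.subspace_span in auto)
  finally have "mcarrier M \<subseteq> V.span (\<Union>a\<in>duality.weights. duality.wspace M a)" .
  moreover have "V.span (\<Union>a\<in>duality.weights. duality.wspace M a) \<subseteq> mcarrier M"
    by (rule V.span_minimal[OF _ sub]) (auto simp: duality.wspace_def)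
  moreover have "finite_dimensional (mscale M) (duality.wspace M a)" if "a \<in> duality.weights" for a
    using wspace_subset_eigenspace[OF is_mod that] M finite_dimensional_subset[OF V.vector_space_axioms]
    unfolding in_C'_def by blast
  ultimately show "duality.weight_module M"
    using is_mod by (auto simp: duality.weight_module_def)
next
  assume M: "duality.weight_module M"
  then have is_mod: "is_module sc duality.A M" by (simp add: duality.weight_module_def)
  interpret V: vector_space "mscale M" using is_mod by (simp add: is_module_def)
  have sub: "V.subspace (mcarrier M)" by (rule duality.carrier_subspace[OF is_mod])
  have eigen: "c \<in> K1 B" if "eigenvalue M (tgen i) c" for i c
    using that duality.weight_module_eigenvalue[OF M] unfolding eigenvalue_def by blast
  have "mcarrier M = V.span (\<Union>a\<in>duality.weights. duality.wspace M a)"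
    using M by (simp add: duality.weight_module_def)
  also have "\<dots> \<subseteq> V.span (\<Union>\<chi>. eigenspace (torus) M \<chi>)"
    using wspace_subset_eigenspace[OF is_mod] by (intro V.span_mono) blast
  finally have "acts_semisimply (torus) M"
    unfolding acts_semisimply_def
    using V.span_minimal[OF _ sub, of "\<Union>\<chi>. eigenspace (torus) M \<chi>"] by (auto simp: eigenspace_def)
  moreover have "c \<in> K1 B" if "i \<notin> X" "eigenvalue M (qshift sc (k i) 0 (q i)) c" for i c
    using eigen[of i c] that by (simp add: tgen_def)
  moreover have "c \<in> K1 B" if "j \<in> X" "eigenvalue M (iB D U \<sigma> j) c" for j c
    using eigen[of j c] that by (simp add: tgen_def)
  moreover have "finite_dimensional (mscale M) (eigenspace (torus) M \<chi>)" for \<chi>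
  proof (cases "eigenspace (torus) M \<chi> \<subseteq> {0}")
    case True
    then have "eigenspace (torus) M \<chi> \<subseteq> V.span {}" by simp
    then show ?thesis unfolding finite_dimensional_def by blast
  next
    case False
    then obtain m where "m \<in> eigenspace (torus) M \<chi>" "m \<noteq> 0" by blast
    then have m: "m \<in> duality.wspace M (\<lambda>i. \<chi> (tgen i))" "m \<noteq> 0" using eigenspace_subset_wspace by blast+
    then have "\<chi> (tgen i) \<in> K1 B" for i
      using eigen[of i] duality.wspaceD[OF is_mod m(1)] unfolding eigenvalue_def by blast
    then have "finite_dimensional (mscale M) (duality.wspace M (\<lambda>i. \<chi> (tgen i)))"
      using M by (simp add: duality.weight_module_def duality.weights_def)
    then show ?thesis by (rule finite_dimensional_subset[OF V.vector_space_axioms _ eigenspace_subset_wspace])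
  qed
  ultimately show "in_C' D B U \<sigma> X M"
    using is_mod unfolding in_C'_def classical_weight_module_def iquantum_eq by blast
qed

end

theorem proposition3p1p9:
  fixes D :: "'i::finite satake"
    and B :: "'k::alg_closed_field base_field"
    and G :: "('i, 'g::ab_group_add) lie_data"
    and \<theta> :: "'g \<Rightarrow> 'g"
    and \<Gamma> :: "('i \<Rightarrow> int) set"
    and U :: "('i, 'k, 'u::ring_1) quantum_group"
    and \<sigma> \<eta> \<zeta> :: "'i \<Rightarrow> 'k"
    and \<phi> :: "'u \<Rightarrow> 'u"
    and M :: "('k, 'u, 'm::ab_group_add) umodule"
  assumes "is_base_field B"
    and "is_satake D"
    and "semisimple_lie (cartan D) G"
    and "satake_involution D G \<theta>"
    and "letzter_choice D G \<theta> \<Gamma>"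
    and "is_quantum_group D B U"
    and "is_parameter D B \<sigma>"
    and "twist_parameters D B \<sigma> \<eta> \<zeta>"
    and "bij_betw (pre_antipode D U) (iquantum D U \<sigma>) (iquantum D U (dual_parameter D B \<sigma>))"
    and "is_twist_iso D U (dual_parameter D B \<sigma>) \<sigma> \<eta> \<zeta> \<phi>"
    and "in_C' D B U \<sigma> (marked \<Gamma>) M"
  defines "dual_M \<equiv> restricted_dual D B U \<sigma> (marked \<Gamma>) \<phi> M"
  defines "dual_dual_M \<equiv> restricted_dual D B U \<sigma> (marked \<Gamma>) \<phi> dual_M"
  shows "in_C' D B U \<sigma> (marked \<Gamma>) dual_M \<and>
    (\<forall>a. (\<forall>i. a i \<in> K1 B) \<longrightarrow>
       vector_space.dim (mscale dual_dual_M) (weight_space D B U \<sigma> (marked \<Gamma>) dual_dual_M a) =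
       vector_space.dim (mscale M) (weight_space D B U \<sigma> (marked \<Gamma>) M a))"
proof -
  interpret iantipode_setup D B U \<sigma> "marked \<Gamma>" \<eta> \<zeta> \<phi>
    using assms(1,2,5-10) by unfold_locales (simp_all add: letzter_choice_def)
  have M: "duality.weight_module M" using assms(11) by (simp add: in_C'_iff_weight_module)
  show ?thesis
    unfolding dual_dual_M_def dual_M_def restricted_dual_eq weight_space_eq in_C'_iff_weight_module
    using duality.weight_module_dual[OF M] duality.dim_wspace_dual_dual[OF M]
    by (simp add: duality.weights_def)
qed

end
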